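(* Let $(N,\mathcal I,\mathcal J,\mathcal K)$ be a hypercomplex nilmanifold with $\dim_{\mathbb R}N=4n$, and let $\operatorname{Hol}(\nabla)\subset GL(n,\mathbb H)$ be the holonomy group of the Obata connection $\nabla$ of $N$. Then $\operatorname{Hol}(\nabla)\subset SL(n,\mathbb H)$.
   Context: A hypercomplex manifold is a manifold $M$ with three integrable complex structures $\mathcal I,\mathcal J,\mathcal K$ satisfying $\mathcal I\mathcal J=-\mathcal J\mathcal I=\mathcal K$. It carries a unique torsion-free connection $\nabla$ on $TM$ with $\nabla\mathcal I=\nabla\mathcal J=\nabla\mathcal K=0$, called the Obata connection; its holonomy lies in $GL(n,\mathbb H)$. A nilmanifold is a quotient $N=\Gamma\backslash G$ of a connected, simply connected nilpotent Lie group $G$ by a co-compact discrete subgroup $\Gamma$. A hypercomplex structure on $G$ is left-invariant if left translations are holomorphic with respect to $\mathcal I,\mathcal J,\mathcal K$. A hypercomplex nilmanifold is a nilmanifold $N=\Gamma\backslash G$ with the hypercomplex structure induced by a left-invariant hypercomplex structure on $G$. The group $SL(n,\mathbb H)$ is defined as follows. Let $V\cong\mathbb H^n$ with complex structure $I$, and $V\otimes_{\mathbb R}\mathbb C=V_I^{1,0}\oplus V_I^{0,1}$. An element $h\in GL(n,\mathbb H)$ acts on the complex line $\Lambda^{2n,0}_I(V)=\Lambda^{2n}(V_I^{1,0})$ by multiplication by a scalar $\det(h)$; since $h$ preserves the real structure $\eta\mapsto J(\bar\eta)$ on this line, $\det(h)$ is real, and it is positive because $GL(n,\mathbb H)$ is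 connected. $SL(n,\mathbb H)$ is the kernel of $\det: GL(n,\mathbb H)\to\mathbb R^*$. *)

theory Defs
  imports
    "HOL-Analysis.Analysis"
    "HOL-Algebra.Generated_Groups"
    "HOL-Library.Function_Algebras"
begin

section \<open>Functions into a real vector space form a real vector space\<close>

instantiation "fun" :: (type, scaleR) scaleR
begin
definition scaleR_fun where "scaleR_fun r f = (\<lambda>x. r *\<^sub>R f x)"
instance ..
end

lemma scaleR_fun_apply [simp]: "(r *\<^sub>R f) x = r *\<^sub>R f x"
  by (simp add: scaleR_fun_def)

instance "fun" :: (type, real_vector) real_vector
  by standard (simp_all add: fun_eq_iff scaleR_add_right scaleR_add_left)


section \<open>Smooth functions on open subsets of Euclidean spaces\<close>

fun Ck_on :: "nat \<Rightarrow> 'a::euclidean_space set \<Rightarrow> ('a \<Rightarrow> 'b::real_normed_vector) \<Rightarrow> bool" where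
  "Ck_on 0 S f \<longleftrightarrow> continuous_on S f"
| "Ck_on (Suc k) S f \<longleftrightarrow>
     (\<forall>x\<in>S. f differentiable (at x)) \<and> (\<forall>v. Ck_on k S (\<lambda>x. frechet_derivative f (at x) v))"

text \<open>Only meaningful for open \<open>S\<close>.\<close>

definition smooth_on :: "'a::euclidean_space set \<Rightarrow> ('a \<Rightarrow> 'b::real_normed_vector) \<Rightarrow> bool" where
  "smooth_on S f \<longleftrightarrow> (\<forall>k. Ck_on k S f)"


section \<open>Smooth manifolds\<close>

text \<open>A manifold is given by an atlas \<open>A\<close>. A chart is a pair of its domain and its coordinate map;
  values of the coordinate map outside the domain are irrelevant. The underlying set and the
  topology are recovered from the atlas.\<close>

type_synonym ('p, 'e) chart = "'p set \<times> ('p \<Rightarrow> 'e)"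

definition points :: "('p, 'e) chart set \<Rightarrow> 'p set" where
  "points A = (\<Union>c\<in>A. fst c)"

definition chart_inv :: "('p, 'e) chart \<Rightarrow> 'e \<Rightarrow> 'p" where
  "chart_inv c = inv_into (fst c) (snd c)"

definition manifold_topology :: "('p, 'e::topological_space) chart set \<Rightarrow> 'p topology" where
  "manifold_topology A =
     topology (\<lambda>S. S \<subseteq> points A \<and> (\<forall>c\<in>A. open (snd c ` (S \<inter> fst c))))"

lemma openin_manifold_topology:
  assumes "\<And>c. c \<in> A \<Longrightarrow> inj_on (snd c) (fst c)"
  shows "openin (manifold_topology A) S \<longleftrightarrow>
    S \<subseteq> points A \<and> (\<forall>c\<in>A. open (snd c ` (S \<inter> fst c)))"
proof -
  have "istopology (\<lambda>S. S \<subseteq> points A \<and> (\<forall>c\<in>A. open (snd c ` (S \<inter> fst c))))"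
    unfolding istopology_def
  proof (intro conjI allI impI ballI)
    fix S T c
    assume S: "S \<subseteq> points A \<and> (\<forall>c\<in>A. open (snd c ` (S \<inter> fst c)))"
      and T: "T \<subseteq> points A \<and> (\<forall>c\<in>A. open (snd c ` (T \<inter> fst c)))" and c: "c \<in> A"
    have "snd c ` (S \<inter> T \<inter> fst c) = snd c ` (S \<inter> fst c) \<inter> snd c ` (T \<inter> fst c)"
      using assms[OF c] by (auto dest: inj_onD)
    then show "open (snd c ` (S \<inter> T \<inter> fst c))" using S T c by auto
  next
    fix \<K> c
    assume K: "\<forall>S\<in>\<K>. S \<subseteq> points A \<and> (\<forall>c\<in>A. open (snd c ` (S \<inter> fst c)))" and c: "c \<in> A"
    have "snd c ` (\<Union>\<K> \<inter> fst c) = (\<Union>S\<in>\<K>. snd c ` (S \<inter> fst c))" by auto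
    then show "open (snd c ` (\<Union>\<K> \<inter> fst c))" using K c by auto
  qed auto
  then show ?thesis by (simp add: manifold_topology_def)
qed

definition smooth_manifold :: "('p, 'e::euclidean_space) chart set \<Rightarrow> bool" where
  "smooth_manifold A \<longleftrightarrow>
     (\<forall>c\<in>A. inj_on (snd c) (fst c) \<and> open (snd c ` fst c)) \<and>
     (\<forall>c\<in>A. \<forall>d\<in>A. open (snd c ` (fst c \<inter> fst d)) \<and>
        smooth_on (snd c ` (fst c \<inter> fst d)) (snd d \<circ> chart_inv c)) \<and>
     Hausdorff_space (manifold_topology A) \<and> second_countable (manifold_topology A)"

definition smooth_map ::
  "('p, 'e::euclidean_space) chart set \<Rightarrow> ('q, 'f::euclidean_space) chart set \<Rightarrow> ('p \<Rightarrow> 'q) \<Rightarrow> bool" where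
  "smooth_map A B f \<longleftrightarrow> f \<in> points A \<rightarrow> points B \<and>
     (\<forall>c\<in>A. \<forall>d\<in>B. open (snd c ` (fst c \<inter> f -` fst d)) \<and>
        smooth_on (snd c ` (fst c \<inter> f -` fst d)) (snd d \<circ> f \<circ> chart_inv c))"

definition smooth_function :: "('p, 'e::euclidean_space) chart set \<Rightarrow> ('p \<Rightarrow> real) \<Rightarrow> bool" where
  "smooth_function A f \<longleftrightarrow> (\<forall>c\<in>A. smooth_on (snd c ` fst c) (f \<circ> chart_inv c))"

definition product_atlas ::
  "('p, 'e) chart set \<Rightarrow> ('q, 'f) chart set \<Rightarrow> ('p \<times> 'q, 'e \<times> 'f) chart set" where
  "product_atlas A B = {(fst c \<times> fst d, map_prod (snd c) (snd d)) | c d. c \<in> A \<and> d \<in> B}"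


section \<open>Tangent vectors and tensor fields\<close>

text \<open>A tangent vector at \<open>p\<close> is the family of its components in the charts around \<open>p\<close>, which are
  related by the derivatives of the transition maps; components in all other charts are \<open>0\<close>.
  The vector space operations are pointwise.\<close>

type_synonym ('p, 'e) tvec = "('p, 'e) chart \<Rightarrow> 'e"
type_synonym ('p, 'e) vfield = "'p \<Rightarrow> ('p, 'e) tvec"
type_synonym ('p, 'e) endofield = "'p \<Rightarrow> ('p, 'e) tvec \<Rightarrow> ('p, 'e) tvec"

definition tangent_space :: "('p, 'e::euclidean_space) chart set \<Rightarrow> 'p \<Rightarrow> ('p, 'e) tvec set" where
  "tangent_space A p = {v.
     (\<forall>c. \<not> (c \<in> A \<and> p \<in> fst c) \<longrightarrow> v c = 0) \<and>
     (\<forall>c\<in>A. \<forall>d\<in>A. p \<in> fst c \<and> p \<in> fst d \<longrightarrow>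
        v d = frechet_derivative (snd d \<circ> chart_inv c) (at (snd c p)) (v c))}"

definition chart_at :: "('p, 'e) chart set \<Rightarrow> 'p \<Rightarrow> ('p, 'e) chart" where
  "chart_at A p = (SOME c. c \<in> A \<and> p \<in> fst c)"

definition linear_map_on :: "'v::real_vector set \<Rightarrow> 'w::real_vector set \<Rightarrow> ('v \<Rightarrow> 'w) \<Rightarrow> bool" where
  "linear_map_on V W h \<longleftrightarrow> h \<in> V \<rightarrow> W \<and>
     (\<forall>u\<in>V. \<forall>v\<in>V. h (u + v) = h u + h v) \<and> (\<forall>r. \<forall>v\<in>V. h (r *\<^sub>R v) = r *\<^sub>R h v)"

text \<open>The tangent vector at \<open>p\<close> with component \<open>e\<close> in the chart \<open>c\<close>.\<close>

definition coord_vector ::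
  "('p, 'e::euclidean_space) chart set \<Rightarrow> ('p, 'e) chart \<Rightarrow> 'p \<Rightarrow> 'e \<Rightarrow> ('p, 'e) tvec" where
  "coord_vector A c p e =
     (\<lambda>d. if d \<in> A \<and> p \<in> fst d
          then frechet_derivative (snd d \<circ> chart_inv c) (at (snd c p)) e else 0)"

definition differential ::
  "('p, 'e::euclidean_space) chart set \<Rightarrow> ('q, 'f::euclidean_space) chart set \<Rightarrow> ('p \<Rightarrow> 'q) \<Rightarrow>
   'p \<Rightarrow> ('p, 'e) tvec \<Rightarrow> ('q, 'f) tvec" where
  "differential A B f p v =
     (let c = chart_at A p in
      (\<lambda>d. if d \<in> B \<and> f p \<in> fst d
           then frechet_derivative (snd d \<circ> f \<circ> chart_inv c) (at (snd c p)) (v c) else 0))"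

definition dir_deriv ::
  "('p, 'e::euclidean_space) chart set \<Rightarrow> ('p \<Rightarrow> real) \<Rightarrow> 'p \<Rightarrow> ('p, 'e) tvec \<Rightarrow> real" where
  "dir_deriv A f p v =
     (let c = chart_at A p in frechet_derivative (f \<circ> chart_inv c) (at (snd c p)) (v c))"

definition vector_fields :: "('p, 'e::euclidean_space) chart set \<Rightarrow> ('p, 'e) vfield set" where
  "vector_fields A = {X.
     (\<forall>p\<in>points A. X p \<in> tangent_space A p) \<and>
     (\<forall>c\<in>A. smooth_on (snd c ` fst c) (\<lambda>x. X (chart_inv c x) c))}"

text \<open>In a chart, \<open>[X, Y] = DY(X) - DX(Y)\<close>.\<close>

definition lie_bracket ::
  "('p, 'e::euclidean_space) chart set \<Rightarrow> ('p, 'e) vfield \<Rightarrow> ('p, 'e) vfield \<Rightarrow> ('p, 'e) vfield" where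
  "lie_bracket A X Y p =
     (\<lambda>c. if c \<in> A \<and> p \<in> fst c
          then frechet_derivative (\<lambda>x. Y (chart_inv c x) c) (at (snd c p)) (X p c)
             - frechet_derivative (\<lambda>x. X (chart_inv c x) c) (at (snd c p)) (Y p c)
          else 0)"

definition smooth_endofield ::
  "('p, 'e::euclidean_space) chart set \<Rightarrow> ('p, 'e) endofield \<Rightarrow> bool" where
  "smooth_endofield A T \<longleftrightarrow>
     (\<forall>p\<in>points A. linear_map_on (tangent_space A p) (tangent_space A p) (T p)) \<and>
     (\<forall>c\<in>A. \<forall>e. smooth_on (snd c ` fst c)
        (\<lambda>x. T (chart_inv c x) (coord_vector A c (chart_inv c x) e) c))"


section \<open>Hypercomplex structures\<close>

definition almost_complex_structure ::
  "('p, 'e::euclidean_space) chart set \<Rightarrow> ('p, 'e) endofield \<Rightarrow> bool" where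
  "almost_complex_structure A I \<longleftrightarrow> smooth_endofield A I \<and>
     (\<forall>p\<in>points A. \<forall>v\<in>tangent_space A p. I p (I p v) = - v)"

text \<open>Vanishing of the Nijenhuis tensor, i.e. involutivity of the (1,0)-tangent bundle.\<close>

definition integrable_structure ::
  "('p, 'e::euclidean_space) chart set \<Rightarrow> ('p, 'e) endofield \<Rightarrow> bool" where
  "integrable_structure A I \<longleftrightarrow>
     (\<forall>X\<in>vector_fields A. \<forall>Y\<in>vector_fields A. \<forall>p\<in>points A.
        lie_bracket A (\<lambda>q. I q (X q)) (\<lambda>q. I q (Y q)) p - lie_bracket A X Y p
        = I p (lie_bracket A (\<lambda>q. I q (X q)) Y p) + I p (lie_bracket A X (\<lambda>q. I q (Y q)) p))"

definition complex_structure ::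
  "('p, 'e::euclidean_space) chart set \<Rightarrow> ('p, 'e) endofield \<Rightarrow> bool" where
  "complex_structure A I \<longleftrightarrow> almost_complex_structure A I \<and> integrable_structure A I"

definition hypercomplex_structure ::
  "('p, 'e::euclidean_space) chart set \<Rightarrow>
   ('p, 'e) endofield \<Rightarrow> ('p, 'e) endofield \<Rightarrow> ('p, 'e) endofield \<Rightarrow> bool" where
  "hypercomplex_structure A I J K \<longleftrightarrow>
     complex_structure A I \<and> complex_structure A J \<and> complex_structure A K \<and>
     (\<forall>p\<in>points A. \<forall>v\<in>tangent_space A p. I p (J p v) = K p v \<and> J p (I p v) = - K p v)"

text \<open>\<open>f\<close> intertwines the almost complex structures \<open>I\<close> and \<open>I'\<close>.\<close>

definition holomorphic_map ::
  "('p, 'e::euclidean_space) chart set \<Rightarrow> ('p, 'e) endofield \<Rightarrow>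
   ('q, 'f::euclidean_space) chart set \<Rightarrow> ('q, 'f) endofield \<Rightarrow> ('p \<Rightarrow> 'q) \<Rightarrow> bool" where
  "holomorphic_map A I B I' f \<longleftrightarrow> smooth_map A B f \<and>
     (\<forall>p\<in>points A. \<forall>v\<in>tangent_space A p.
        differential A B f p (I p v) = I' (f p) (differential A B f p v))"


section \<open>Connections\<close>

text \<open>For a vector field \<open>Y\<close>, a point \<open>p\<close> and a tangent vector \<open>v\<close> at \<open>p\<close>, \<open>nabla Y p v\<close> is the
  covariant derivative of \<open>Y\<close> in the direction of \<open>v\<close>.\<close>

type_synonym ('p, 'e) connection = "('p, 'e) vfield \<Rightarrow> ('p, 'e) endofield"

definition affine_connection ::
  "('p, 'e::euclidean_space) chart set \<Rightarrow> ('p, 'e) connection \<Rightarrow> bool" where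
  "affine_connection A nabla \<longleftrightarrow>
     (\<forall>Y\<in>vector_fields A. smooth_endofield A (nabla Y)) \<and>
     (\<forall>Y\<in>vector_fields A. \<forall>Z\<in>vector_fields A. \<forall>p\<in>points A. \<forall>v\<in>tangent_space A p.
        nabla (\<lambda>q. Y q + Z q) p v = nabla Y p v + nabla Z p v) \<and>
     (\<forall>f. \<forall>Y\<in>vector_fields A. smooth_function A f \<longrightarrow>
        (\<forall>p\<in>points A. \<forall>v\<in>tangent_space A p.
           nabla (\<lambda>q. f q *\<^sub>R Y q) p v = dir_deriv A f p v *\<^sub>R Y p + f p *\<^sub>R nabla Y p v))"

definition torsion_free ::
  "('p, 'e::euclidean_space) chart set \<Rightarrow> ('p, 'e) connection \<Rightarrow> bool" where
  "torsion_free A nabla \<longleftrightarrow>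
     (\<forall>X\<in>vector_fields A. \<forall>Y\<in>vector_fields A. \<forall>p\<in>points A.
        nabla Y p (X p) - nabla X p (Y p) = lie_bracket A X Y p)"

definition parallel_endofield ::
  "('p, 'e::euclidean_space) chart set \<Rightarrow> ('p, 'e) connection \<Rightarrow> ('p, 'e) endofield \<Rightarrow> bool" where
  "parallel_endofield A nabla T \<longleftrightarrow>
     (\<forall>Y\<in>vector_fields A. \<forall>p\<in>points A. \<forall>v\<in>tangent_space A p.
        nabla (\<lambda>q. T q (Y q)) p v = T p (nabla Y p v))"

definition obata_connection ::
  "('p, 'e::euclidean_space) chart set \<Rightarrow>
   ('p, 'e) endofield \<Rightarrow> ('p, 'e) endofield \<Rightarrow> ('p, 'e) endofield \<Rightarrow> ('p, 'e) connection \<Rightarrow> bool" where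
  "obata_connection A I J K nabla \<longleftrightarrow>
     affine_connection A nabla \<and> torsion_free A nabla \<and>
     parallel_endofield A nabla I \<and> parallel_endofield A nabla J \<and> parallel_endofield A nabla K"


section \<open>Parallel transport and holonomy\<close>

text \<open>Smoothness on a closed interval: existence of a smooth extension to a larger open interval.\<close>

definition smooth_curve_on ::
  "('p, 'e::euclidean_space) chart set \<Rightarrow> real \<Rightarrow> real \<Rightarrow> (real \<Rightarrow> 'p) \<Rightarrow> bool" where
  "smooth_curve_on A a b \<gamma> \<longleftrightarrow>
     (\<exists>\<epsilon>>0. \<exists>\<gamma>'. smooth_map {({a - \<epsilon><..<b + \<epsilon>}, \<lambda>t. t)} A \<gamma>' \<and> (\<forall>t\<in>{a..b}. \<gamma>' t = \<gamma> t))"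

definition velocity ::
  "('p, 'e::euclidean_space) chart set \<Rightarrow> (real \<Rightarrow> 'p) \<Rightarrow> real set \<Rightarrow> real \<Rightarrow> ('p, 'e) tvec" where
  "velocity A \<gamma> T t =
     (\<lambda>c. if c \<in> A \<and> \<gamma> t \<in> fst c then vector_derivative (snd c \<circ> \<gamma>) (at t within T) else 0)"

text \<open>\<open>W\<close> is the covariant derivative at time \<open>t\<close> of the vector field \<open>V\<close> along the curve
  \<open>\<gamma>\<close>, defined on the interval \<open>T\<close>: if \<open>V = (\<Sum>i. a i \<cdot> E i)\<close> along \<open>\<gamma>\<close> near \<open>t\<close>, with vector
  fields \<open>E i\<close> on the manifold, then \<open>W = (\<Sum>i. a' i \<cdot> E i + a i \<cdot> nabla (E i) (\<gamma>' t))\<close>, which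
  does not depend on the representation of \<open>V\<close>.\<close>

definition has_cov_deriv_along ::
  "('p, 'e::euclidean_space) chart set \<Rightarrow> ('p, 'e) connection \<Rightarrow> (real \<Rightarrow> 'p) \<Rightarrow> real set \<Rightarrow>
   (real \<Rightarrow> ('p, 'e) tvec) \<Rightarrow> ('p, 'e) tvec \<Rightarrow> real \<Rightarrow> bool" where
  "has_cov_deriv_along A nabla \<gamma> T V W t \<longleftrightarrow>
     (\<exists>(m::nat) E a a'.
        (\<forall>i<m. E i \<in> vector_fields A) \<and>
        (\<forall>i<m. (a i has_real_derivative a' i) (at t within T)) \<and>
        (\<exists>\<delta>>0. \<forall>s\<in>T. \<bar>s - t\<bar> < \<delta> \<longrightarrow> V s = (\<Sum>i<m. a i s *\<^sub>R E i (\<gamma> s))) \<and>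
        W = (\<Sum>i<m. a' i *\<^sub>R E i (\<gamma> t) + a i t *\<^sub>R nabla (E i) (\<gamma> t) (velocity A \<gamma> T t)))"

definition subdivision :: "nat \<Rightarrow> (nat \<Rightarrow> real) \<Rightarrow> bool" where
  "subdivision m t \<longleftrightarrow> t 0 = 0 \<and> t m = 1 \<and> (\<forall>i<m. t i < t (Suc i))"

text \<open>\<open>V\<close> is a parallel vector field along the piecewise smooth curve \<open>\<gamma>\<close> on \<open>[0,1]\<close>, whose
  pieces are those of the subdivision \<open>t\<close>.\<close>

definition parallel_along ::
  "('p, 'e::euclidean_space) chart set \<Rightarrow> ('p, 'e) connection \<Rightarrow> nat \<Rightarrow> (nat \<Rightarrow> real) \<Rightarrow>
   (real \<Rightarrow> 'p) \<Rightarrow> (real \<Rightarrow> ('p, 'e) tvec) \<Rightarrow> bool" where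
  "parallel_along A nabla m t \<gamma> V \<longleftrightarrow>
     (\<forall>s\<in>{0..1}. V s \<in> tangent_space A (\<gamma> s)) \<and>
     (\<forall>i<m. \<forall>s\<in>{t i..t (Suc i)}. has_cov_deriv_along A nabla \<gamma> {t i..t (Suc i)} V 0 s)"

text \<open>The holonomy group at \<open>p\<close>: the parallel transports \<open>h\<close> around piecewise smooth loops at \<open>p\<close>.\<close>

definition holonomy_group ::
  "('p, 'e::euclidean_space) chart set \<Rightarrow> ('p, 'e) connection \<Rightarrow> 'p \<Rightarrow>
   (('p, 'e) tvec \<Rightarrow> ('p, 'e) tvec) set" where
  "holonomy_group A nabla p =
     {h. h \<in> extensional (tangent_space A p) \<and>
        (\<exists>\<gamma> m t. subdivision m t \<and> (\<forall>i<m. smooth_curve_on A (t i) (t (Suc i)) \<gamma>) \<and>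
           \<gamma> 0 = p \<and> \<gamma> 1 = p \<and>
           (\<forall>v\<in>tangent_space A p. \<exists>V. parallel_along A nabla m t \<gamma> V \<and> V 0 = v \<and> V 1 = h v))}"


section \<open>The groups GL(n,H) and SL(n,H)\<close>

text \<open>The complexification of a real vector space \<open>V\<close> is \<open>V \<times> V\<close>, where \<open>(x, y)\<close> stands for
  \<open>x + i y\<close>.\<close>

definition scaleC :: "complex \<Rightarrow> 'v::real_vector \<times> 'v \<Rightarrow> 'v \<times> 'v" where
  "scaleC z p = (Re z *\<^sub>R fst p - Im z *\<^sub>R snd p, Im z *\<^sub>R fst p + Re z *\<^sub>R snd p)"

definition space10 :: "'v::real_vector set \<Rightarrow> ('v \<Rightarrow> 'v) \<Rightarrow> ('v \<times> 'v) set" where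
  "space10 V I = {p \<in> V \<times> V. map_prod I I p = scaleC \<i> p}"

definition tuples :: "nat \<Rightarrow> 'w set \<Rightarrow> 'w list set" where
  "tuples k W = {ws. length ws = k \<and> set ws \<subseteq> W}"

text \<open>Alternating complex \<open>k\<close>-linear forms on a complex subspace \<open>W\<close> of a complexification.\<close>

definition alt_forms :: "nat \<Rightarrow> ('v::real_vector \<times> 'v) set \<Rightarrow> (('v \<times> 'v) list \<Rightarrow> complex) set" where
  "alt_forms k W = {\<omega>.
     (\<forall>ws\<in>tuples k W. \<forall>i<k. \<forall>u\<in>W. \<forall>v\<in>W. \<forall>a b.
        \<omega> (ws[i := scaleC a u + scaleC b v]) = a * \<omega> (ws[i := u]) + b * \<omega> (ws[i := v])) \<and>
     (\<forall>ws\<in>tuples k W. \<forall>i<k. \<forall>j<k. i \<noteq> j \<and> ws ! i = ws ! j \<longrightarrow> \<omega> ws = 0)}"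

text \<open>For finite-dimensional \<open>W\<close> the \<open>k\<close>-th exterior power is realised in the dual of the space of
  alternating forms: \<open>w1 \<and> \<dots> \<and> wk\<close> is the evaluation of forms at \<open>(w1, \<dots>, wk)\<close>.\<close>

definition wedge ::
  "nat \<Rightarrow> ('v::real_vector \<times> 'v) set \<Rightarrow> ('v \<times> 'v) list \<Rightarrow> (('v \<times> 'v) list \<Rightarrow> complex) \<Rightarrow> complex" where
  "wedge k W ws = (\<lambda>\<omega>. if \<omega> \<in> alt_forms k W then \<omega> ws else 0)"

definition exterior_power ::
  "nat \<Rightarrow> ('v::real_vector \<times> 'v) set \<Rightarrow> ((('v \<times> 'v) list \<Rightarrow> complex) \<Rightarrow> complex) set" where
  "exterior_power k W =
     {(\<lambda>\<omega>. \<Sum>j<m. z j * wedge k W (ws j) \<omega>) | (m::nat) z ws. \<forall>j<m. ws j \<in> tuples k W}"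

text \<open>The map \<open>w1 \<and> \<dots> \<and> wk \<mapsto> f w1 \<and> \<dots> \<and> f wk\<close> induced by an endomorphism \<open>f\<close> of \<open>W\<close>.\<close>

definition exterior_map ::
  "nat \<Rightarrow> ('v::real_vector \<times> 'v) set \<Rightarrow> ('v \<times> 'v \<Rightarrow> 'v \<times> 'v) \<Rightarrow>
   ((('v \<times> 'v) list \<Rightarrow> complex) \<Rightarrow> complex) \<Rightarrow> (('v \<times> 'v) list \<Rightarrow> complex) \<Rightarrow> complex" where
  "exterior_map k W f T = (\<lambda>\<omega>. if \<omega> \<in> alt_forms k W then T (\<lambda>ws. \<omega> (map f ws)) else 0)"

definition quat_det :: "nat \<Rightarrow> 'v::real_vector set \<Rightarrow> ('v \<Rightarrow> 'v) \<Rightarrow> ('v \<Rightarrow> 'v) \<Rightarrow> complex" where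
  "quat_det n V I h =
     (THE z. \<forall>T\<in>exterior_power (2 * n) (space10 V I).
        exterior_map (2 * n) (space10 V I) (map_prod h h) T = (\<lambda>\<omega>. z * T \<omega>))"

text \<open>\<open>V\<close> is a quaternionic vector space with complex structures \<open>I\<close>, \<open>J\<close>, \<open>K\<close>; below, \<open>n\<close> is
  its quaternionic dimension.\<close>

definition GLH :: "'v::real_vector set \<Rightarrow> ('v \<Rightarrow> 'v) \<Rightarrow> ('v \<Rightarrow> 'v) \<Rightarrow> ('v \<Rightarrow> 'v) \<Rightarrow> ('v \<Rightarrow> 'v) set" where
  "GLH V I J K = {h. h \<in> extensional V \<and> linear_map_on V V h \<and> bij_betw h V V \<and>
     (\<forall>v\<in>V. h (I v) = I (h v) \<and> h (J v) = J (h v) \<and> h (K v) = K (h v))}"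

definition SLH ::
  "nat \<Rightarrow> 'v::real_vector set \<Rightarrow> ('v \<Rightarrow> 'v) \<Rightarrow> ('v \<Rightarrow> 'v) \<Rightarrow> ('v \<Rightarrow> 'v) \<Rightarrow> ('v \<Rightarrow> 'v) set" where
  "SLH n V I J K = {h \<in> GLH V I J K. quat_det n V I h = 1}"


section \<open>Nilmanifolds\<close>

definition lie_group :: "('g, 'b) monoid_scheme \<Rightarrow> ('g, 'e::euclidean_space) chart set \<Rightarrow> bool" where
  "lie_group G A \<longleftrightarrow> group G \<and> smooth_manifold A \<and> points A = carrier G \<and>
     smooth_map (product_atlas A A) A (\<lambda>(g, h). g \<otimes>\<^bsub>G\<^esub> h) \<and>
     smooth_map A A (\<lambda>g. inv\<^bsub>G\<^esub> g)"

fun lower_central_series :: "('g, 'b) monoid_scheme \<Rightarrow> nat \<Rightarrow> 'g set" where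
  "lower_central_series G 0 = carrier G"
| "lower_central_series G (Suc k) =
     generate G {g \<otimes>\<^bsub>G\<^esub> h \<otimes>\<^bsub>G\<^esub> inv\<^bsub>G\<^esub> g \<otimes>\<^bsub>G\<^esub> inv\<^bsub>G\<^esub> h | g h. g \<in> carrier G \<and> h \<in> lower_central_series G k}"

definition nilpotent_group :: "('g, 'b) monoid_scheme \<Rightarrow> bool" where
  "nilpotent_group G \<longleftrightarrow> group G \<and> (\<exists>k. lower_central_series G k = {\<one>\<^bsub>G\<^esub>})"

text \<open>The analogue of \<^const>\<open>simply_connected\<close> for abstract topological spaces.\<close>

definition simply_connected_space :: "'a topology \<Rightarrow> bool" where
  "simply_connected_space X \<longleftrightarrow>
     (\<forall>p q. pathin X p \<and> p 1 = p 0 \<and> pathin X q \<and> q 1 = q 0 \<longrightarrow>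
        homotopic_with (\<lambda>r. r 1 = r 0) (top_of_set {0..1::real}) X p q)"

text \<open>The quotient manifold by a discrete subgroup \<open>\<Gamma>\<close> acting by left translations, whose points
  are the right cosets of \<open>\<Gamma>\<close>: its charts are the charts of the group, restricted to open sets on
  which the projection is injective.\<close>

definition quotient_atlas ::
  "('g, 'b) monoid_scheme \<Rightarrow> ('g, 'e::euclidean_space) chart set \<Rightarrow> 'g set \<Rightarrow> ('g set, 'e) chart set" where
  "quotient_atlas G A \<Gamma> =
     {((\<lambda>g. \<Gamma> #>\<^bsub>G\<^esub> g) ` U, snd c \<circ> inv_into U (\<lambda>g. \<Gamma> #>\<^bsub>G\<^esub> g)) | U c.
        c \<in> A \<and> U \<subseteq> fst c \<and> openin (manifold_topology A) U \<and> inj_on (\<lambda>g. \<Gamma> #>\<^bsub>G\<^esub> g) U}"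

definition nilmanifold ::
  "('g, 'b) monoid_scheme \<Rightarrow> ('g, 'e::euclidean_space) chart set \<Rightarrow> 'g set \<Rightarrow> bool" where
  "nilmanifold G A \<Gamma> \<longleftrightarrow>
     lie_group G A \<and> connected_space (manifold_topology A) \<and>
     simply_connected_space (manifold_topology A) \<and> nilpotent_group G \<and>
     subgroup \<Gamma> G \<and> subtopology (manifold_topology A) \<Gamma> = discrete_topology \<Gamma> \<and>
     compact_space (manifold_topology (quotient_atlas G A \<Gamma>))"

definition left_invariant ::
  "('g, 'b) monoid_scheme \<Rightarrow> ('g, 'e::euclidean_space) chart set \<Rightarrow> ('g, 'e) endofield \<Rightarrow> bool" where
  "left_invariant G A I \<longleftrightarrow> (\<forall>g\<in>carrier G. holomorphic_map A I A I (\<lambda>h. g \<otimes>\<^bsub>G\<^esub> h))"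

text \<open>\<open>I\<close>, \<open>J\<close>, \<open>K\<close> are the structures on the quotient induced by a left-invariant hypercomplex
  structure on the group, i.e. those for which the projection, a local diffeomorphism, is holomorphic.\<close>

definition hypercomplex_nilmanifold ::
  "('g, 'b) monoid_scheme \<Rightarrow> ('g, 'e::euclidean_space) chart set \<Rightarrow> 'g set \<Rightarrow>
   ('g set, 'e) endofield \<Rightarrow> ('g set, 'e) endofield \<Rightarrow> ('g set, 'e) endofield \<Rightarrow> bool" where
  "hypercomplex_nilmanifold G A \<Gamma> I J K \<longleftrightarrow> nilmanifold G A \<Gamma> \<and>
     (\<exists>I' J' K'. hypercomplex_structure A I' J' K' \<and>
        left_invariant G A I' \<and> left_invariant G A J' \<and> left_invariant G A K' \<and>
        holomorphic_map A I' (quotient_atlas G A \<Gamma>) I (\<lambda>g. \<Gamma> #>\<^bsub>G\<^esub> g) \<and>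
        holomorphic_map A J' (quotient_atlas G A \<Gamma>) J (\<lambda>g. \<Gamma> #>\<^bsub>G\<^esub> g) \<and>
        holomorphic_map A K' (quotient_atlas G A \<Gamma>) K (\<lambda>g. \<Gamma> #>\<^bsub>G\<^esub> g))"

end

theory Submission
  imports Defs
begin

text \<open>The right action of \<open>G\<close> on \<open>N = \<Gamma>\G\<close> provides a global frame of vector fields, which identifies every
  tangent space with the Lie algebra of \<open>G\<close>; in this frame \<open>I\<close>, \<open>J\<close>, \<open>K\<close> are constant and the
  brackets are those of the Lie algebra. At each point, the covariant derivative in the direction \<open>u\<close>
  becomes an endomorphism \<open>T u\<close> of the Lie algebra commuting with \<open>I\<close>, \<open>J\<close>, \<open>K\<close>, and
  \<open>T u w - T w u = [u, w]\<close>. Nilpotency enters through a flag of subspaces that is lowered by all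
  brackets: it implies that \<open>ad u\<close> and, by integrability of \<open>I\<close> (a consequence of the two properties of
  \<open>T\<close>), also \<open>I ad u\<close> have trace zero, and hence that \<open>T u\<close> has complex trace zero. By Liouville's formula, parallel transport preserves
  every complex volume form on the (1,0)-vectors.\<close>

section \<open>Smooth maps between Euclidean spaces\<close>

text \<open>The connection is given only by its axioms, so neither a formula for it nor its
  invariance under the group is at hand. The endomorphisms \<open>T u\<close> are therefore read off
  at one point at a time; they may vary with the point, and the trace argument is pure algebra at
  each of them. That \<open>I T u\<close> has trace zero is forced by the quaternionic structure and
  makes the complex trace real; the real trace is where nilpotency acts. The flag comes from the
  adjoint representation: level 0 is the zero space, and a vector is in level \<open>j + 1\<close>
  if every \<open>Ad g - id\<close> sends it to level \<open>j\<close>. Commutators of group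
  elements with curves, pushed down the lower central series, show that the flag exhausts the Lie
  algebra; a difference quotient of \<open>Ad\<close> along a curve shows that brackets lower it. So
  the group yields the flag without an exponential map. The flag need not be stable under
  \<open>I\<close>; this is cured by passing to the vectors \<open>x\<close> for which both
  \<open>x\<close> and \<open>I x\<close> lie in a given level.\<close>

lemma differentiable_has_frechet:
  assumes "f differentiable (at x)"
  shows "(f has_derivative frechet_derivative f (at x)) (at x)"
  using assms frechet_derivative_works by blast

lemma Ck_on_cong:
  assumes "open S"
  shows "Ck_on k S f \<Longrightarrow> (\<And>x. x \<in> S \<Longrightarrow> f x = g x) \<Longrightarrow> Ck_on k S g"
proof (induction k arbitrary: f g)
  case 0
  then show ?case by (simp cong: continuous_on_cong)
next
  case (Suc k)
  have D: "(g has_derivative frechet_derivative f (at x)) (at x)" if x: "x \<in> S" for x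
  proof -
    have "(f has_derivative frechet_derivative f (at x)) (at x)"
      using Suc.prems(1) x differentiable_has_frechet by auto
    then show ?thesis
      using has_derivative_transform_within_open[OF _ assms x] Suc.prems(2) by blast
  qed
  have "Ck_on k S (\<lambda>x. frechet_derivative g (at x) v)" for v
  proof (rule Suc.IH)
    show "Ck_on k S (\<lambda>x. frechet_derivative f (at x) v)" using Suc.prems(1) by simp
    show "frechet_derivative f (at x) v = frechet_derivative g (at x) v" if "x \<in> S" for x
      using frechet_derivative_at[OF D[OF that]] by simp
  qed
  then show ?case using D by (auto simp: differentiable_def)
qed

text \<open>Uniqueness of derivatives on the open set \<open>S\<close> replaces the chosen
  \<open>frechet_derivative f\<close> by any explicit formula \<open>f'\<close>. The product and
  chain rules below enter the recursion of \<open>Ck_on\<close> through this.\<close>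

lemma Ck_on_intro:
  assumes "open S" "\<And>x. x \<in> S \<Longrightarrow> (f has_derivative f' x) (at x)"
    and "\<And>v. Ck_on k S (\<lambda>x. f' x v)"
  shows "Ck_on (Suc k) S f"
proof -
  have "f' x v = frechet_derivative f (at x) v" if "x \<in> S" for x v
    using frechet_derivative_at[OF assms(2)[OF that]] by simp
  then have "Ck_on k S (\<lambda>x. frechet_derivative f (at x) v)" for v
    by (intro Ck_on_cong[OF assms(1) assms(3)])
  moreover have "f differentiable (at x)" if "x \<in> S" for x
    using assms(2)[OF that] by (rule differentiableI)
  ultimately show ?thesis by (simp only: Ck_on.simps) simp
qed

lemma Ck_on_SucD: "Ck_on (Suc k) S f \<Longrightarrow> Ck_on k S f"
proof (induction k arbitrary: f)
  case 0
  then have "\<forall>x\<in>S. continuous (at x) f" by (simp add: differentiable_imp_continuous_within)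
  then show ?case by (simp add: continuous_at_imp_continuous_on)
next
  case (Suc k)
  then show ?case unfolding Ck_on.simps(2)[of "Suc k"] Ck_on.simps(2)[of k] by blast
qed

lemma Ck_on_has_derivative:
  "Ck_on (Suc k) S f \<Longrightarrow> x \<in> S \<Longrightarrow> (f has_derivative frechet_derivative f (at x)) (at x)"
  using differentiable_has_frechet by auto

lemma Ck_on_const: "Ck_on k S (\<lambda>x. c)"
  by (induction k arbitrary: c) (simp_all add: frechet_derivative_const)

lemma Ck_on_add:
  assumes "open S"
  shows "Ck_on k S f \<Longrightarrow> Ck_on k S g \<Longrightarrow> Ck_on k S (\<lambda>x. f x + g x)"
proof (induction k arbitrary: f g)
  case 0
  then show ?case by (auto intro: continuous_on_add)
next
  case (Suc k)
  show ?case
    by (rule Ck_on_intro[OF assms has_derivative_add[OF Ck_on_has_derivative[OF Suc.prems(1)]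
            Ck_on_has_derivative[OF Suc.prems(2)]]])
      (use Suc in auto)
qed

lemma Ck_on_scaleR:
  assumes "open S"
  shows "Ck_on k S f \<Longrightarrow> Ck_on k S g \<Longrightarrow> Ck_on k S (\<lambda>x. f x *\<^sub>R g x)"
proof (induction k arbitrary: f g)
  case 0
  then show ?case by (auto intro: continuous_on_scaleR)
next
  case (Suc k)
  show ?case
    by (rule Ck_on_intro[OF assms has_derivative_scaleR[OF Ck_on_has_derivative[OF Suc.prems(1)]
            Ck_on_has_derivative[OF Suc.prems(2)]]])
      (assumption+, (intro Ck_on_add[OF assms] Suc.IH Ck_on_SucD[OF Suc.prems(1)]
          Ck_on_SucD[OF Suc.prems(2)]; use Suc.prems in simp))
qed

lemma Ck_on_bounded_linear:
  assumes "open S" "bounded_linear L"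
  shows "Ck_on k S f \<Longrightarrow> Ck_on k S (\<lambda>x. L (f x))"
proof (induction k arbitrary: f)
  case 0
  then show ?case using bounded_linear.continuous_on[OF assms(2)] by auto
next
  case (Suc k)
  show ?case
    by (rule Ck_on_intro[OF assms(1) bounded_linear.has_derivative[OF assms(2)
            Ck_on_has_derivative[OF Suc.prems]]])
      (use Suc in auto)
qed

lemma Ck_on_sum:
  assumes "open S" "\<And>i. i \<in> F \<Longrightarrow> Ck_on k S (f i)"
  shows "Ck_on k S (\<lambda>x. \<Sum>i\<in>F. f i x)"
  using assms(2)
  by (induction F rule: infinite_finite_induct) (auto simp: Ck_on_const intro!: Ck_on_add[OF assms(1)])

text \<open>In the chain rule both the base point and the argument of the derivative of
  \<open>g\<close> depend on \<open>x\<close>. Expanding the argument in \<open>Basis\<close> leaves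
  products of scalar functions with derivatives of \<open>g\<close> in fixed directions, and the
  induction hypothesis applies to the latter.\<close>

lemma Ck_on_compose:
  fixes f :: "'a::euclidean_space \<Rightarrow> 'b::euclidean_space" and g :: "'b \<Rightarrow> 'c::real_normed_vector"
  assumes "open S"
  shows "Ck_on k T g \<Longrightarrow> Ck_on k S f \<Longrightarrow> f ` S \<subseteq> T \<Longrightarrow> Ck_on k S (\<lambda>x. g (f x))"
proof (induction k arbitrary: f g)
  case 0
  then show ?case using continuous_on_compose2 by auto
next
  case (Suc k)
  let ?Dg = "\<lambda>y. frechet_derivative g (at y)" and ?Df = "\<lambda>x. frechet_derivative f (at x)"
  have lin: "linear (?Dg (f x))" if "x \<in> S" for x
    using Ck_on_has_derivative[OF Suc.prems(1), of "f x"] Suc.prems(3) that has_derivative_linear by blast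
  show ?case
  proof (rule Ck_on_intro[OF assms, where f' = "\<lambda>x v. \<Sum>b\<in>Basis. (?Df x v \<bullet> b) *\<^sub>R ?Dg (f x) b"])
    fix x assume x: "x \<in> S"
    have "(\<lambda>v. \<Sum>b\<in>Basis. (?Df x v \<bullet> b) *\<^sub>R ?Dg (f x) b) = (\<lambda>v. ?Dg (f x) (?Df x v))"
    proof
      fix v
      have "?Dg (f x) (\<Sum>b\<in>Basis. (?Df x v \<bullet> b) *\<^sub>R b) = (\<Sum>b\<in>Basis. (?Df x v \<bullet> b) *\<^sub>R ?Dg (f x) b)"
        by (simp add: linear_sum[OF lin[OF x]] linear_cmul[OF lin[OF x]])
      then show "(\<Sum>b\<in>Basis. (?Df x v \<bullet> b) *\<^sub>R ?Dg (f x) b) = ?Dg (f x) (?Df x v)"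
        by (simp add: euclidean_representation)
    qed
    moreover have "((\<lambda>x. g (f x)) has_derivative (\<lambda>v. ?Dg (f x) (?Df x v))) (at x)"
      by (rule has_derivative_compose[OF Ck_on_has_derivative[OF Suc.prems(2) x]
            Ck_on_has_derivative[OF Suc.prems(1)]]) (use Suc.prems x in auto)
    ultimately show "((\<lambda>x. g (f x)) has_derivative (\<lambda>v. \<Sum>b\<in>Basis. (?Df x v \<bullet> b) *\<^sub>R ?Dg (f x) b)) (at x)"
      by simp
  next
    fix v
    show "Ck_on k S (\<lambda>x. \<Sum>b\<in>Basis. (?Df x v \<bullet> b) *\<^sub>R ?Dg (f x) b)"
    proof (rule Ck_on_sum[OF assms], rule Ck_on_scaleR[OF assms])
      fix b :: 'b
      show "Ck_on k S (\<lambda>x. ?Df x v \<bullet> b)"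
        by (rule Ck_on_bounded_linear[OF assms bounded_linear_inner_left]) (use Suc.prems(2) in simp)
      show "Ck_on k S (\<lambda>x. ?Dg (f x) b)"
        by (rule Suc.IH[OF _ Ck_on_SucD[OF Suc.prems(2)] Suc.prems(3)]) (use Suc.prems(1) in simp)
    qed
  qed
qed

lemma Ck_on_linear:
  assumes "open S" "bounded_linear L"
  shows "Ck_on k S L"
proof (cases k)
  case 0
  then show ?thesis using linear_continuous_on[OF assms(2)] by simp
next
  case (Suc m)
  show ?thesis unfolding Suc
    by (rule Ck_on_intro[OF assms(1) bounded_linear_imp_has_derivative[OF assms(2)]])
       (rule Ck_on_const)
qed

section \<open>Calculus of infinitely differentiable maps\<close>

lemma smooth_on_cong:
  "open S \<Longrightarrow> smooth_on S f \<Longrightarrow> (\<And>x. x \<in> S \<Longrightarrow> f x = g x) \<Longrightarrow> smooth_on S g"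
  unfolding smooth_on_def using Ck_on_cong by blast

lemma smooth_on_subset: "smooth_on T f \<Longrightarrow> S \<subseteq> T \<Longrightarrow> smooth_on S f"
proof -
  have "Ck_on k T f \<Longrightarrow> S \<subseteq> T \<Longrightarrow> Ck_on k S f" for k
    by (induction k arbitrary: f) (auto intro: continuous_on_subset)
  then show "smooth_on T f \<Longrightarrow> S \<subseteq> T \<Longrightarrow> smooth_on S f" by (auto simp: smooth_on_def)
qed

lemma smooth_on_locally:
  assumes "\<And>x. x \<in> S \<Longrightarrow> \<exists>T. open T \<and> x \<in> T \<and> smooth_on T f"
  shows "smooth_on S f"
proof -
  have "(\<And>x. x \<in> S \<Longrightarrow> \<exists>T. open T \<and> x \<in> T \<and> Ck_on k T f) \<Longrightarrow> Ck_on k S f" for k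
  proof (induction k arbitrary: f)
    case 0
    have "continuous (at x within S) f" if x: "x \<in> S" for x
    proof -
      obtain T where "open T" "x \<in> T" "continuous_on T f" using 0 x by force
      then show ?thesis
        using continuous_on_eq_continuous_at continuous_at_imp_continuous_at_within by blast
    qed
    then show ?case by (simp add: continuous_on_eq_continuous_within)
  next
    case (Suc k)
    have "f differentiable (at x)" if "x \<in> S" for x using Suc.prems[OF that] by auto
    moreover have "Ck_on k S (\<lambda>x. frechet_derivative f (at x) v)" for v
      by (rule Suc.IH) (use Suc.prems in force)
    ultimately show ?case by simp
  qed
  then show ?thesis using assms unfolding smooth_on_def by blast
qed

lemma smooth_on_continuous: "smooth_on S f \<Longrightarrow> continuous_on S f"
  unfolding smooth_on_def by (metis Ck_on.simps(1))

lemma smooth_on_has_derivative: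
  "smooth_on S f \<Longrightarrow> x \<in> S \<Longrightarrow> (f has_derivative frechet_derivative f (at x)) (at x)"
  unfolding smooth_on_def by (metis Ck_on_has_derivative)

lemma smooth_on_linear_derivative:
  "smooth_on S f \<Longrightarrow> x \<in> S \<Longrightarrow> linear (frechet_derivative f (at x))"
  using smooth_on_has_derivative has_derivative_linear by blast

lemma smooth_on_frechet_derivative:
  "smooth_on S f \<Longrightarrow> smooth_on S (\<lambda>x. frechet_derivative f (at x) v)"
  unfolding smooth_on_def by (metis Ck_on.simps(2))

lemma smooth_on_const [simp]: "smooth_on S (\<lambda>x. c)"
  by (simp add: smooth_on_def Ck_on_const)

lemma smooth_on_add:
  "open S \<Longrightarrow> smooth_on S f \<Longrightarrow> smooth_on S g \<Longrightarrow> smooth_on S (\<lambda>x. f x + g x)"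
  by (simp add: smooth_on_def Ck_on_add)

lemma smooth_on_scaleR:
  "open S \<Longrightarrow> smooth_on S f \<Longrightarrow> smooth_on S g \<Longrightarrow> smooth_on S (\<lambda>x. f x *\<^sub>R g x)"
  by (simp add: smooth_on_def Ck_on_scaleR)

lemma smooth_on_bounded_linear:
  "open S \<Longrightarrow> bounded_linear L \<Longrightarrow> smooth_on S f \<Longrightarrow> smooth_on S (\<lambda>x. L (f x))"
  by (simp add: smooth_on_def Ck_on_bounded_linear)

lemma smooth_on_linear: "open S \<Longrightarrow> bounded_linear L \<Longrightarrow> smooth_on S L"
  by (simp add: smooth_on_def Ck_on_linear)

lemma smooth_on_sum:
  "open S \<Longrightarrow> (\<And>i. i \<in> F \<Longrightarrow> smooth_on S (f i)) \<Longrightarrow> smooth_on S (\<lambda>x. \<Sum>i\<in>F. f i x)"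
  unfolding smooth_on_def by (rule allI, rule Ck_on_sum) blast+

lemma smooth_on_compose:
  fixes f :: "'a::euclidean_space \<Rightarrow> 'b::euclidean_space" and g :: "'b \<Rightarrow> 'c::real_normed_vector"
  shows "open S \<Longrightarrow> smooth_on T g \<Longrightarrow> smooth_on S f \<Longrightarrow> f ` S \<subseteq> T \<Longrightarrow> smooth_on S (\<lambda>x. g (f x))"
  unfolding smooth_on_def by (rule allI, rule Ck_on_compose) blast+

lemma smooth_on_Pair:
  fixes f :: "'a::euclidean_space \<Rightarrow> 'b::euclidean_space" and g :: "'a \<Rightarrow> 'c::euclidean_space"
  assumes "open S" "smooth_on S f" "smooth_on S g"
  shows "smooth_on S (\<lambda>x. (f x, g x))"
proof -
  have "smooth_on S (\<lambda>x. (f x, 0) + (0, g x))"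
    by (intro smooth_on_add assms
        smooth_on_bounded_linear[OF assms(1) _ assms(2), where L = "\<lambda>y. (y, 0)"]
        smooth_on_bounded_linear[OF assms(1) _ assms(3), where L = "\<lambda>y. (0, y)"]
        bounded_linear_Pair bounded_linear_ident bounded_linear_zero)
  then show ?thesis by simp
qed

text \<open>The mean value theorem, applied in both directions to the second difference
  \<open>f (p + su + sv) - f (p + su) - f (p + sv) + f p\<close>.\<close>

lemma second_difference_limit:
  fixes f :: "'a::euclidean_space \<Rightarrow> real"
  assumes W: "open W" "p \<in> W" and f: "smooth_on W f"
  shows "((\<lambda>s. (f (p + s *\<^sub>R u + s *\<^sub>R v) - f (p + s *\<^sub>R u) - f (p + s *\<^sub>R v) + f p) / s\<^sup>2)
     \<longlongrightarrow> frechet_derivative (\<lambda>x. frechet_derivative f (at x) u) (at p) v) (at_right 0)"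
    (is "(?Q \<longlongrightarrow> ?L) _")
proof -
  define q where "q = (\<lambda>x. frechet_derivative f (at x) u)"
  define r where "r = (\<lambda>x. frechet_derivative q (at x) v)"
  have q: "smooth_on W q" unfolding q_def by (rule smooth_on_frechet_derivative[OF f])
  have r: "smooth_on W r" unfolding r_def by (rule smooth_on_frechet_derivative[OF q])
  have "\<exists>\<xi> \<eta>. 0 < \<xi> \<and> \<xi> < s \<and> 0 < \<eta> \<and> \<eta> < s \<and> ?Q s = r (p + \<xi> *\<^sub>R u + \<eta> *\<^sub>R v)"
    if s: "0 < s" and in_W: "\<And>a b. 0 \<le> a \<Longrightarrow> a \<le> s \<Longrightarrow> 0 \<le> b \<Longrightarrow> b \<le> s \<Longrightarrow> p + a *\<^sub>R u + b *\<^sub>R v \<in> W" for s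
  proof -
    have df: "((\<lambda>a. f (p + a *\<^sub>R u + b *\<^sub>R v)) has_real_derivative q (p + a *\<^sub>R u + b *\<^sub>R v)) (at a)"
      if "0 \<le> a" "a \<le> s" "0 \<le> b" "b \<le> s" for a b
    proof -
      have "((\<lambda>a. f (p + a *\<^sub>R u + b *\<^sub>R v)) has_derivative
          (\<lambda>h. frechet_derivative f (at (p + a *\<^sub>R u + b *\<^sub>R v)) (h *\<^sub>R u))) (at a)"
        by (rule has_derivative_compose[where f = "\<lambda>a. p + a *\<^sub>R u + b *\<^sub>R v" and g = f])
           (auto intro!: derivative_eq_intros smooth_on_has_derivative[OF f in_W[OF that]])
      then show ?thesis unfolding q_def has_field_derivative_def
        by (simp add: linear_cmul[OF smooth_on_linear_derivative[OF f in_W[OF that]]] mult.commute[of _ "frechet_derivative _ _ _"])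
    qed
    have dq: "((\<lambda>b. q (p + a *\<^sub>R u + b *\<^sub>R v)) has_real_derivative r (p + a *\<^sub>R u + b *\<^sub>R v)) (at b)"
      if "0 \<le> a" "a \<le> s" "0 \<le> b" "b \<le> s" for a b
    proof -
      have "((\<lambda>b. q (p + a *\<^sub>R u + b *\<^sub>R v)) has_derivative
          (\<lambda>h. frechet_derivative q (at (p + a *\<^sub>R u + b *\<^sub>R v)) (h *\<^sub>R v))) (at b)"
        by (rule has_derivative_compose[where f = "\<lambda>b. p + a *\<^sub>R u + b *\<^sub>R v" and g = q])
           (auto intro!: derivative_eq_intros smooth_on_has_derivative[OF q in_W[OF that]])
      then show ?thesis unfolding r_def has_field_derivative_def
        by (simp add: linear_cmul[OF smooth_on_linear_derivative[OF q in_W[OF that]]] mult.commute[of _ "frechet_derivative _ _ _"])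
    qed
    have "\<exists>\<xi>. 0 < \<xi> \<and> \<xi> < s \<and>
        (f (p + s *\<^sub>R u + s *\<^sub>R v) - f (p + s *\<^sub>R u + 0 *\<^sub>R v)) - (f (p + 0 *\<^sub>R u + s *\<^sub>R v) - f (p + 0 *\<^sub>R u + 0 *\<^sub>R v))
        = (s - 0) * (q (p + \<xi> *\<^sub>R u + s *\<^sub>R v) - q (p + \<xi> *\<^sub>R u + 0 *\<^sub>R v))"
      by (rule MVT2[OF s]) (intro DERIV_diff df; use s in simp)
    then obtain \<xi> where \<xi>: "0 < \<xi>" "\<xi> < s"
      "f (p + s *\<^sub>R u + s *\<^sub>R v) - f (p + s *\<^sub>R u) - f (p + s *\<^sub>R v) + f p
        = s * (q (p + \<xi> *\<^sub>R u + s *\<^sub>R v) - q (p + \<xi> *\<^sub>R u + 0 *\<^sub>R v))"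
      by (auto simp: algebra_simps)
    have "\<exists>\<eta>. 0 < \<eta> \<and> \<eta> < s \<and>
        q (p + \<xi> *\<^sub>R u + s *\<^sub>R v) - q (p + \<xi> *\<^sub>R u + 0 *\<^sub>R v) = (s - 0) * r (p + \<xi> *\<^sub>R u + \<eta> *\<^sub>R v)"
      by (rule MVT2[OF s]) (intro dq; use \<xi> in simp)
    then obtain \<eta> where \<eta>: "0 < \<eta>" "\<eta> < s"
      "q (p + \<xi> *\<^sub>R u + s *\<^sub>R v) - q (p + \<xi> *\<^sub>R u + 0 *\<^sub>R v) = s * r (p + \<xi> *\<^sub>R u + \<eta> *\<^sub>R v)"
      by auto
    have "?Q s = r (p + \<xi> *\<^sub>R u + \<eta> *\<^sub>R v)"
      unfolding \<xi>(3) \<eta>(3) using s by (simp add: power2_eq_square)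
    then show ?thesis using \<xi> \<eta> by blast
  qed note mvt = this
  show ?thesis
  proof (rule tendstoI)
    fix \<epsilon> :: real assume "\<epsilon> > 0"
    have "continuous (at p) r"
      using smooth_on_continuous[OF r] W continuous_on_eq_continuous_at by blast
    then obtain d where d: "d > 0" "\<And>x. dist x p < d \<Longrightarrow> dist (r x) (r p) < \<epsilon>"
      using \<open>\<epsilon> > 0\<close> unfolding continuous_at_eps_delta by blast
    obtain e where e: "e > 0" "ball p e \<subseteq> W" using W open_contains_ball by blast
    \<comment> \<open>For steps \<open>s < m\<close> the whole parallelogram stays within
      \<open>min d e\<close> of \<open>p\<close>. The summand 1 keeps the denominator positive when
      \<open>u\<close> and \<open>v\<close> are zero.\<close>
    define m where "m = min d e / (norm u + norm v + 1)"
    have nuv: "norm u + norm v + 1 > 0" by (simp add: add_nonneg_pos)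
    then have "m > 0" using d e by (simp add: m_def)
    have near: "dist (p + a *\<^sub>R u + b *\<^sub>R v) p < min d e" if "0 \<le> a" "a \<le> s" "0 \<le> b" "b \<le> s" "s < m" "0 < s" for a b s
    proof -
      have "dist (p + a *\<^sub>R u + b *\<^sub>R v) p = norm (a *\<^sub>R u + b *\<^sub>R v)"
        by (simp add: dist_norm)
      also have "\<dots> \<le> a * norm u + b * norm v" using that norm_triangle_ineq[of "a *\<^sub>R u" "b *\<^sub>R v"] by simp
      also have "\<dots> \<le> s * norm u + s * norm v" using that by (intro add_mono mult_right_mono) auto
      also have "\<dots> < s * (norm u + norm v + 1)" using that by (simp add: algebra_simps)
      also have "\<dots> \<le> m * (norm u + norm v + 1)" using that nuv by (intro mult_right_mono) auto
      also have "\<dots> = min d e" using nuv by (simp add: m_def)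
      finally show ?thesis .
    qed
    have "dist (?Q s) ?L < \<epsilon>" if s: "0 < s" "s < m" for s
    proof -
      have "p + a *\<^sub>R u + b *\<^sub>R v \<in> W" if "0 \<le> a" "a \<le> s" "0 \<le> b" "b \<le> s" for a b
        using near[OF that s(2,1)] e(2) by (auto simp: dist_commute)
      then obtain \<xi> \<eta> where \<xi>: "0 < \<xi>" "\<xi> < s" "0 < \<eta>" "\<eta> < s" "?Q s = r (p + \<xi> *\<^sub>R u + \<eta> *\<^sub>R v)"
        using mvt[OF s(1)] by blast
      have "dist (p + \<xi> *\<^sub>R u + \<eta> *\<^sub>R v) p < d" using near[of \<xi> s \<eta>] \<xi> s by simp
      then show ?thesis using d(2) \<xi>(5) unfolding r_def q_def by simp
    qed
    then show "\<forall>\<^sub>F s in at_right 0. dist (?Q s) ?L < \<epsilon>"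
      unfolding eventually_at_right_field using \<open>m > 0\<close> by blast
  qed
qed

text \<open>The second difference is symmetric in \<open>u\<close> and \<open>v\<close>, so its
  limit computes both mixed derivatives. The mean value theorem needs real values, hence the passage
  to the components \<open>f x \<bullet> b\<close>.\<close>

lemma second_derivative_commute:
  fixes f :: "'a::euclidean_space \<Rightarrow> 'b::euclidean_space"
  assumes W: "open W" "p \<in> W" and f: "smooth_on W f"
  shows "frechet_derivative (\<lambda>x. frechet_derivative f (at x) u) (at p) v
    = frechet_derivative (\<lambda>x. frechet_derivative f (at x) v) (at p) u"
proof (rule euclidean_eqI)
  fix b :: 'b assume "b \<in> Basis"
  define g where "g x = f x \<bullet> b" for x
  have g: "smooth_on W g"
    unfolding g_def by (rule smooth_on_bounded_linear[OF W(1) bounded_linear_inner_left f])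
  have Dg: "frechet_derivative g (at x) w = frechet_derivative f (at x) w \<bullet> b" if "x \<in> W" for x w
  proof -
    have "(g has_derivative (\<lambda>w. frechet_derivative f (at x) w \<bullet> b)) (at x)"
      unfolding g_def by (rule has_derivative_inner_left[OF smooth_on_has_derivative[OF f that]])
    then show ?thesis by (metis frechet_derivative_at)
  qed
  have DDg: "frechet_derivative (\<lambda>x. frechet_derivative g (at x) w) (at p) z
      = frechet_derivative (\<lambda>x. frechet_derivative f (at x) w) (at p) z \<bullet> b" for w z
  proof -
    have "((\<lambda>x. frechet_derivative f (at x) w \<bullet> b) has_derivative
        (\<lambda>z. frechet_derivative (\<lambda>x. frechet_derivative f (at x) w) (at p) z \<bullet> b)) (at p)"
      by (rule has_derivative_inner_left[OF smooth_on_has_derivative[OF smooth_on_frechet_derivative[OF f] W(2)]])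
    then have "((\<lambda>x. frechet_derivative g (at x) w) has_derivative
        (\<lambda>z. frechet_derivative (\<lambda>x. frechet_derivative f (at x) w) (at p) z \<bullet> b)) (at p)"
      by (rule has_derivative_transform_within_open[OF _ W]) (simp add: Dg)
    then show ?thesis by (metis frechet_derivative_at)
  qed
  have "(\<lambda>s. (g (p + s *\<^sub>R u + s *\<^sub>R v) - g (p + s *\<^sub>R u) - g (p + s *\<^sub>R v) + g p) / s\<^sup>2)
      = (\<lambda>s. (g (p + s *\<^sub>R v + s *\<^sub>R u) - g (p + s *\<^sub>R v) - g (p + s *\<^sub>R u) + g p) / s\<^sup>2)"
    by (simp add: algebra_simps)
  then have "frechet_derivative (\<lambda>x. frechet_derivative g (at x) u) (at p) v
      = frechet_derivative (\<lambda>x. frechet_derivative g (at x) v) (at p) u"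
    using tendsto_unique[OF _ second_difference_limit[OF W g, of u v]]
      second_difference_limit[OF W g, of v u] by simp
  then show "frechet_derivative (\<lambda>x. frechet_derivative f (at x) u) (at p) v \<bullet> b
    = frechet_derivative (\<lambda>x. frechet_derivative f (at x) v) (at p) u \<bullet> b"
    by (simp add: DDg)
qed

section \<open>Traces and nilpotent flags\<close>

definition tr :: "('a::euclidean_space \<Rightarrow> 'a) \<Rightarrow> real" where
  "tr f = (\<Sum>b\<in>Basis. f b \<bullet> b)"

lemma tr_add: "tr (\<lambda>x. f x + g x) = tr f + tr g"
  by (simp add: tr_def inner_add_left sum.distrib)

lemma tr_diff: "tr (\<lambda>x. f x - g x) = tr f - tr g"
  by (simp add: tr_def inner_diff_left sum_subtractf)

lemma tr_minus: "tr (\<lambda>x. - f x) = - tr f"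
  by (simp add: tr_def sum_negf)

lemma linear_expand_Basis:
  assumes "linear (f :: 'a::euclidean_space \<Rightarrow> 'b::real_vector)"
  shows "f x = (\<Sum>b\<in>Basis. (x \<bullet> b) *\<^sub>R f b)"
proof -
  have "f (\<Sum>b\<in>Basis. (x \<bullet> b) *\<^sub>R b) = (\<Sum>b\<in>Basis. (x \<bullet> b) *\<^sub>R f b)"
    by (simp add: linear_sum[OF assms] linear_cmul[OF assms])
  then show ?thesis by (simp add: euclidean_representation)
qed

text \<open>The trace does not depend on the frame. The frames used later consist of the real and
  imaginary directions of a complex basis and are unrelated to \<open>Basis\<close>.\<close>

lemma tr_dual_frame:
  assumes f: "linear f" and rep: "\<And>y. y = (\<Sum>k\<in>K. l k y *\<^sub>R u k)" and l: "\<And>k. k \<in> K \<Longrightarrow> linear (l k)"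
  shows "tr f = (\<Sum>k\<in>K. l k (f (u k)))"
proof -
  have "f b \<bullet> b = (\<Sum>k\<in>K. l k b * (f (u k) \<bullet> b))" for b
  proof -
    have "f b = (\<Sum>k\<in>K. l k b *\<^sub>R f (u k))"
      using arg_cong[OF rep[of b], of f] by (simp add: linear_sum[OF f] linear_cmul[OF f])
    then show ?thesis by (simp add: inner_sum_left)
  qed
  then have "tr f = (\<Sum>k\<in>K. \<Sum>b\<in>Basis. l k b * (f (u k) \<bullet> b))"
    unfolding tr_def by (simp add: sum.swap[of _ Basis K])
  also have "\<dots> = (\<Sum>k\<in>K. l k (f (u k)))"
  proof (rule sum.cong[OF refl])
    fix k assume "k \<in> K"
    show "(\<Sum>b\<in>Basis. l k b * (f (u k) \<bullet> b)) = l k (f (u k))"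
      unfolding linear_expand_Basis[OF l[OF \<open>k \<in> K\<close>], of "f (u k)"] by (simp add: mult.commute)
  qed
  finally show ?thesis .
qed

lemma tr_commute:
  assumes f: "linear f" and g: "linear g"
  shows "tr (\<lambda>x. f (g x)) = tr (\<lambda>x. g (f x))"
proof -
  have "tr (\<lambda>x. f (g x)) = (\<Sum>b\<in>Basis. \<Sum>c\<in>Basis. (g b \<bullet> c) * (f c \<bullet> b))"
    unfolding tr_def by (subst linear_expand_Basis[OF f]) (simp add: inner_sum_left)
  also have "\<dots> = (\<Sum>c\<in>Basis. \<Sum>b\<in>Basis. (f c \<bullet> b) * (g b \<bullet> c))"
    by (subst sum.swap) (simp add: mult.commute)
  also have "\<dots> = tr (\<lambda>x. g (f x))"
    unfolding tr_def by (subst (2) linear_expand_Basis[OF g]) (simp add: inner_sum_left)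
  finally show ?thesis .
qed

lemma subspace_projection:
  fixes U :: "'a::euclidean_space set"
  assumes "subspace U"
  obtains P where "linear P" "\<And>x. P x \<in> U" "\<And>x. x \<in> U \<Longrightarrow> P x = x"
proof -
  obtain B where B: "B \<subseteq> U" "independent B" "U \<subseteq> span B"
    using maximal_independent_subset by metis
  then have UB: "U = span B" using assms span_minimal by blast
  obtain P where P: "linear P" "\<forall>x\<in>B. P x = id x" "range P = span (id ` B)"
    using linear_independent_extend_subspace[OF B(2), of id] by blast
  have "P x = x" if "x \<in> U" for x
    using linear_eq_on[OF P(1) linear_ident, of x B] that P(2) UB by simp
  moreover have "P x \<in> U" for x using P(3) UB by auto
  ultimately show thesis using that P(1) by blast
qed

text \<open>If \<open>P\<close> and \<open>Q\<close> project onto consecutive members of the flag, then \<open>S Q = P S Q\<close> and \<open>Q P = P\<close>,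
  so \<open>tr (S Q) = tr (P S Q) = tr (S Q P) = tr (S P)\<close>.\<close>

lemma tr_nilpotent_flag:
  fixes S :: "'a::euclidean_space \<Rightarrow> 'a"
  assumes S: "linear S" and sub: "\<And>j. subspace (Z j)" and Z0: "Z 0 = {0}" and Zk: "Z k = UNIV"
    and mono: "\<And>j. Z j \<subseteq> Z (Suc j)" and step: "\<And>j x. x \<in> Z (Suc j) \<Longrightarrow> S x \<in> Z j"
  shows "tr S = 0"
proof -
  have "\<forall>j. \<exists>P. linear P \<and> (\<forall>x. P x \<in> Z j) \<and> (\<forall>x\<in>Z j. P x = x)"
    using subspace_projection[OF sub] by metis
  then obtain P where P: "\<And>j. linear (P j)" "\<And>j x. P j x \<in> Z j" "\<And>j x. x \<in> Z j \<Longrightarrow> P j x = x"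
    by metis
  have "tr (\<lambda>x. S (P j x)) = 0" for j
  proof (induction j)
    case 0
    have "P 0 x = 0" for x using P(2)[of 0 x] Z0 by simp
    then show ?case using linear_0[OF S] by (simp add: tr_def)
  next
    case (Suc j)
    have "tr (\<lambda>x. S (P (Suc j) x)) = tr (\<lambda>x. P j (S (P (Suc j) x)))"
      using P(3)[OF step[OF P(2)]] by simp
    also have "\<dots> = tr (\<lambda>x. S (P (Suc j) (P j x)))"
      by (rule tr_commute[OF P(1) linear_compose[OF P(1) S, unfolded comp_def]])
    also have "\<dots> = tr (\<lambda>x. S (P j x))"
      using P(3)[of _ "Suc j"] mono P(2)[of j] by (simp add: subset_iff)
    finally show ?case using Suc by simp
  qed
  from this[of k] show ?thesis using P(3)[of _ k] Zk by simp
qed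

text \<open>Conjugation by \<open>J\<close> fixes \<open>A\<close> and reverses the sign of
  \<open>I\<close>, while the trace is invariant under conjugation; so the trace equals its own
  negative.\<close>

lemma tr_anticommuting:
  assumes A: "linear A" and I: "linear I" and J: "linear J"
    and JJ: "\<And>x. J (J x) = - x" and IJ: "\<And>x. I (J x) = - J (I x)" and AJ: "\<And>x. A (J x) = J (A x)"
  shows "tr (\<lambda>x. I (A x)) = 0"
proof -
  have lin: "linear (\<lambda>x. J (I (A x)))"
    using linear_compose[OF linear_compose[OF A I] J] by (simp add: comp_def)
  have "tr (\<lambda>x. I (A x)) = tr (\<lambda>x. - J (J (I (A x))))" using JJ by simp
  also have "\<dots> = - tr (\<lambda>x. J (J (I (A x))))" by (rule tr_minus)
  also have "\<dots> = - tr (\<lambda>x. J (I (A (J x))))"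
    using tr_commute[OF J lin] by simp
  also have "\<dots> = - tr (\<lambda>x. J (I (J (A x))))" by (simp add: AJ)
  also have "\<dots> = - tr (\<lambda>x. I (A x))" by (simp add: IJ JJ linear_neg[OF J])
  finally show ?thesis by simp
qed

text \<open>Let \<open>T u w = \<nabla>\<^sub>u w\<close> and \<open>R u w = \<nabla>\<^sub>w u\<close>, so that \<open>ad u = T u - R u\<close>. As \<open>tr (ad u) = 0\<close> and
  \<open>R (I u) = I R u\<close>, we have \<open>tr (T (I u)) = tr (I R u) = tr (I T u) - tr (I ad u)\<close>. Here
  \<open>tr (I T u) = 0\<close> because \<open>J\<close> commutes with \<open>T u\<close> and anticommutes with \<open>I\<close>. The last term vanishes since
  \<open>ad v - ad (I v) I\<close>, which corresponds to \<open>ad (v - i I v)\<close> on the (1,0)-vectors, is nilpotent.\<close>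

lemma obata_traces_zero:
  fixes T :: "'a::euclidean_space \<Rightarrow> 'a \<Rightarrow> 'a"
  assumes T1: "\<And>w. linear (\<lambda>u. T u w)" and T2: "\<And>u. linear (T u)"
    and I: "linear I" and J: "linear J" and II: "\<And>x. I (I x) = - x" and JJ: "\<And>x. J (J x) = - x"
    and IJ: "\<And>x. I (J x) = - J (I x)"
    and TI: "\<And>u w. T u (I w) = I (T u w)" and TJ: "\<And>u w. T u (J w) = J (T u w)"
    and sub: "\<And>j. subspace (Z j)" and Z0: "Z 0 = {0}" and Zk: "Z k = UNIV"
    and mono: "\<And>j. Z j \<subseteq> Z (Suc j)" and step: "\<And>j v w. w \<in> Z (Suc j) \<Longrightarrow> T v w - T w v \<in> Z j"
  shows "tr (T u) = 0" "tr (\<lambda>w. I (T u w)) = 0"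
proof -
  define ad where "ad v w = T v w - T w v" for v w
  have ad_lin: "linear (ad v)" for v
    unfolding ad_def by (rule linear_compose_sub[OF T2 T1])
  have tr_ad: "tr (ad v) = 0" for v
    by (rule tr_nilpotent_flag[OF ad_lin sub Z0 Zk mono]) (simp add: ad_def step)
  have tr_IT: "tr (\<lambda>w. I (T v w)) = 0" for v
    using tr_anticommuting[OF T2[of v] I J] JJ IJ TJ by blast
  have adI_lin: "linear (\<lambda>x. ad v (I x))" for v
    using linear_compose[OF I ad_lin[of v]] by (simp add: comp_def)
  have tr_Iad: "tr (\<lambda>w. I (ad u w)) = 0" for u
  proof -
    define v where "v = - I u"
    have Iv: "I v = u" by (simp add: v_def linear_neg[OF I] II)
    \<comment> \<open>The levels \<open>Z j\<close> need not be stable under \<open>I\<close>. The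
      set \<open>Z' j\<close> is the largest subspace of \<open>Z j\<close> that is.\<close>
    define Z' where "Z' j = {x \<in> Z j. I x \<in> Z j}" for j
    have "tr (\<lambda>x. ad v x - ad u (I x)) = 0"
    proof (rule tr_nilpotent_flag[where Z = Z' and k = k])
      show "linear (\<lambda>x. ad v x - ad u (I x))" by (rule linear_compose_sub[OF ad_lin adI_lin])
      show "subspace (Z' j)" for j
        using sub[of j] unfolding Z'_def subspace_def
        by (auto simp: linear_0[OF I] linear_add[OF I] linear_cmul[OF I])
      show "Z' 0 = {0}" using linear_0[OF I] by (auto simp: Z'_def Z0)
      show "Z' k = UNIV" by (simp add: Z'_def Zk)
      show "Z' j \<subseteq> Z' (Suc j)" for j using mono by (auto simp: Z'_def)
      show "ad v x - ad u (I x) \<in> Z' j" if x: "x \<in> Z' (Suc j)" for j x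
      proof -
        \<comment> \<open>With \<open>u = I v\<close> this is the vanishing of the Nijenhuis tensor,
          deduced from \<open>T\<close> commuting with \<open>I\<close> in its second argument. It
          keeps the operator inside the smaller flag \<open>Z'\<close>.\<close>
        have "I (ad v x - ad u (I x)) = ad u x + ad v (I x)"
          unfolding ad_def Iv[symmetric]
          by (simp add: linear_diff[OF I] TI[symmetric] II linear_neg[OF T2])
        moreover have "ad v x \<in> Z j" "ad u (I x) \<in> Z j" "ad u x \<in> Z j" "ad v (I x) \<in> Z j"
          using x step unfolding Z'_def ad_def by auto
        ultimately show ?thesis
          using subspace_diff[OF sub] subspace_add[OF sub] unfolding Z'_def by simp
      qed
    qed
    then have "tr (\<lambda>x. ad u (I x)) = 0" using tr_ad[of v] tr_diff[of "ad v"] by simp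
    then show ?thesis using tr_commute[OF I ad_lin] by simp
  qed
  have tr_TI: "tr (T (I v)) = 0" for v
  proof -
    have "T (I v) = (\<lambda>w. ad (I v) w + I (T v w) - I (ad v w))"
      by (simp add: fun_eq_iff ad_def linear_diff[OF I] TI)
    then have "tr (T (I v)) = tr (\<lambda>w. ad (I v) w + I (T v w)) - tr (\<lambda>w. I (ad v w))"
      by (simp add: tr_diff)
    then show ?thesis using tr_add[of "ad (I v)"] tr_ad tr_IT tr_Iad by simp
  qed
  have "u = I (- I u)" by (simp add: linear_neg[OF I] II)
  then show "tr (T u) = 0" using tr_TI[of "- I u"] by simp
  show "tr (\<lambda>w. I (T u w)) = 0" by (rule tr_IT)
qed


section \<open>Complex bases and complex multilinear forms on a real vector space\<close>

definition cscale :: "('a::real_vector \<Rightarrow> 'a) \<Rightarrow> complex \<Rightarrow> 'a \<Rightarrow> 'a" where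
  "cscale I z x = Re z *\<^sub>R x + Im z *\<^sub>R I x"

definition cindep :: "('a::real_vector \<Rightarrow> 'a) \<Rightarrow> nat \<Rightarrow> (nat \<Rightarrow> 'a) \<Rightarrow> bool" where
  "cindep I m x \<longleftrightarrow> (\<forall>z. (\<Sum>i<m. cscale I (z i) (x i)) = 0 \<longrightarrow> (\<forall>i<m. z i = 0))"

text \<open>Alternating forms on the real model space, complex multilinear with the imaginary unit
  acting as \<open>I\<close>. Forms on the (1,0)-vectors are transported to these, so that
  determinants are computed without the complexification.\<close>

definition calt :: "('a::real_vector \<Rightarrow> 'a) \<Rightarrow> nat \<Rightarrow> ('a list \<Rightarrow> complex) \<Rightarrow> bool" where
  "calt I m \<Omega> \<longleftrightarrow>
     (\<forall>xs i u v a b. length xs = m \<and> i < m \<longrightarrow>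
        \<Omega> (xs[i := cscale I a u + cscale I b v]) = a * \<Omega> (xs[i := u]) + b * \<Omega> (xs[i := v])) \<and>
     (\<forall>xs i j. length xs = m \<and> i < m \<and> j < m \<and> i \<noteq> j \<and> xs ! i = xs ! j \<longrightarrow> \<Omega> xs = 0)"

lemma cindepD: "cindep I m x \<Longrightarrow> (\<Sum>i<m. cscale I (z i) (x i)) = 0 \<Longrightarrow> i < m \<Longrightarrow> z i = 0"
  by (auto simp: cindep_def)

lemma cscale_complex_of_real [simp]: "cscale I (complex_of_real a) x = a *\<^sub>R x"
  by (simp add: cscale_def)

lemma cscale_0 [simp]: "cscale I 0 x = 0"
  by (simp add: cscale_def)

lemma sum_times_bool:
  fixes f :: "nat \<times> bool \<Rightarrow> 'b::comm_monoid_add"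
  shows "(\<Sum>k\<in>{..<m} \<times> UNIV. f k) = (\<Sum>i<m. f (i, True) + f (i, False))"
proof -
  have "(\<Sum>k\<in>{..<m} \<times> UNIV. f k) = (\<Sum>i<m. \<Sum>s\<in>UNIV. f (i, s))"
    by (simp add: sum.cartesian_product)
  then show ?thesis by (simp add: UNIV_bool add.commute)
qed

locale linear_complex_structure =
  fixes I :: "'a::euclidean_space \<Rightarrow> 'a"
  assumes linear_I: "linear I" and I_I: "I (I x) = - x"
begin

lemma cscale_cscale: "cscale I a (cscale I b x) = cscale I (a * b) x"
  by (simp add: cscale_def linear_add[OF linear_I] linear_cmul[OF linear_I] I_I algebra_simps)

lemma cscale_add_left: "cscale I (a + b) x = cscale I a x + cscale I b x"
  by (simp add: cscale_def algebra_simps)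

lemma linear_cscale: "linear (cscale I a)"
  by (rule linearI)
     (simp_all add: cscale_def linear_add[OF linear_I] linear_cmul[OF linear_I] algebra_simps)

lemma I_eq_cscale: "I x = cscale I \<i> x"
  by (simp add: cscale_def)

lemma cindep_coords_unique:
  assumes "cindep I m x" "(\<Sum>i<m. cscale I (z i) (x i)) = (\<Sum>i<m. cscale I (z' i) (x i))" "i < m"
  shows "z i = z' i"
proof -
  have "(\<Sum>i<m. cscale I (z i - z' i) (x i)) = 0"
    using assms(2) by (simp add: cscale_def sum_subtractf algebra_simps sum.distrib)
  then show ?thesis using assms(1,3) unfolding cindep_def by fastforce
qed

text \<open>A complex relation among the \<open>x i\<close> is a real relation among the
  \<open>x i\<close> and \<open>I (x i)\<close>: the real parts of the coefficients go with the
  index \<open>True\<close>, the imaginary parts with \<open>False\<close>.\<close>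

lemma cindep_real_family:
  assumes x: "cindep I m x"
  defines "u \<equiv> \<lambda>(i, s). if s then x i else I (x i)"
  shows "inj_on u ({..<m} \<times> UNIV)" "independent (u ` ({..<m} \<times> UNIV))"
proof -
  let ?K = "{..<m} \<times> (UNIV :: bool set)"
  have rel: "(\<Sum>k\<in>?K. r k *\<^sub>R u k) = (\<Sum>i<m. cscale I (Complex (r (i, True)) (r (i, False))) (x i))" for r
    by (simp add: sum_times_bool u_def cscale_def)
  have indep: "r k = 0" if "(\<Sum>k\<in>?K. r k *\<^sub>R u k) = 0" "k \<in> ?K" for r k
  proof -
    obtain i s where k: "k = (i, s)" "i < m" using \<open>k \<in> ?K\<close> by auto
    have "Complex (r (i, True)) (r (i, False)) = 0"
      using cindepD[OF x, of "\<lambda>i. Complex (r (i, True)) (r (i, False))", OF _ k(2)] that(1)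
      unfolding rel by simp
    then show ?thesis using k by (cases s) (auto simp: complex_eq_iff)
  qed
  show inj: "inj_on u ?K"
  proof (rule inj_onI, rule ccontr)
    fix k l assume kl: "k \<in> ?K" "l \<in> ?K" "u k = u l" "k \<noteq> l"
    let ?r = "\<lambda>j. if j = k then 1 else if j = l then -1 else (0::real)"
    have "(\<Sum>j\<in>?K. ?r j *\<^sub>R u j) = (\<Sum>j\<in>{k, l}. ?r j *\<^sub>R u j)"
      using kl(1,2) by (intro sum.mono_neutral_right) auto
    also have "\<dots> = 0" using kl(3,4) by simp
    finally have "?r k = 0" by (rule indep[OF _ kl(1)])
    then show False by simp
  qed
  show "independent (u ` ?K)"
  proof (subst independent_explicit_finite_subsets, intro allI impI ballI)
    fix S r v assume S: "S \<subseteq> u ` ?K" "finite S" "(\<Sum>v\<in>S. r v *\<^sub>R v) = 0" "v \<in> S"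
    define r' where "r' k = (if u k \<in> S then r (u k) else 0)" for k
    have "(\<Sum>k\<in>?K. r' k *\<^sub>R u k) = (\<Sum>v\<in>u ` ?K. (if v \<in> S then r v else 0) *\<^sub>R v)"
      by (simp add: sum.reindex[OF inj] r'_def)
    also have "\<dots> = (\<Sum>v\<in>S. r v *\<^sub>R v)"
      using S(1) by (intro sum.mono_neutral_cong_right) auto
    finally have "r' k = 0" if "k \<in> ?K" for k using indep[OF _ that] S(3) by simp
    moreover obtain k where "k \<in> ?K" "v = u k" using S(1,4) by blast
    ultimately show "r v = 0" using S(4) unfolding r'_def by (metis (full_types))
  qed
qed

text \<open>By the dimension count the \<open>2 * m\<close> real vectors \<open>x i\<close> and
  \<open>I (x i)\<close> form a real basis, which gives existence of complex coordinates; their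
  uniqueness gives complex linearity.\<close>

lemma cindep_coordinates:
  assumes x: "cindep I m x" and dim: "DIM('a) = 2 * m"
  obtains l where "\<And>y. y = (\<Sum>i<m. cscale I (l i y) (x i))"
    "\<And>i a u b v. i < m \<Longrightarrow> l i (cscale I a u + cscale I b v) = a * l i u + b * l i v"
proof -
  let ?K = "{..<m} \<times> (UNIV :: bool set)"
  define u where "u = (\<lambda>(i, s). if s then x i else I (x i))"
  have u: "inj_on u ?K" "independent (u ` ?K)"
    using cindep_real_family[OF x] by (simp_all add: u_def)
  have "card (u ` ?K) = DIM('a)" using card_image[OF u(1)] dim by (simp add: card_cartesian_product)
  then have span: "y \<in> span (u ` ?K)" for y
    using card_ge_dim_independent[OF subset_UNIV u(2)] by (auto simp: dim_UNIV)
  have "\<exists>z. y = (\<Sum>i<m. cscale I (z i) (x i))" for y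
  proof -
    obtain r where r: "y = (\<Sum>v\<in>u ` ?K. r v *\<^sub>R v)"
      using span[of y] span_finite[of "u ` ?K"] by auto
    have "y = (\<Sum>k\<in>?K. r (u k) *\<^sub>R u k)" unfolding r by (simp add: sum.reindex[OF u(1)])
    also have "\<dots> = (\<Sum>i<m. cscale I (Complex (r (u (i, True))) (r (u (i, False)))) (x i))"
      by (simp add: sum_times_bool u_def cscale_def)
    finally show ?thesis by (intro exI[of _ "\<lambda>i. Complex (r (u (i, True))) (r (u (i, False)))"])
  qed
  then obtain z where z: "\<And>y. y = (\<Sum>i<m. cscale I (z y i) (x i))" by metis
  show thesis
  proof (rule that[of "\<lambda>i y. z y i"])
    show "y = (\<Sum>i<m. cscale I (z y i) (x i))" for y by (rule z)
    fix i a p b q assume "i < m"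
    have "(\<Sum>i<m. cscale I (a * z p i + b * z q i) (x i)) =
        cscale I a (\<Sum>i<m. cscale I (z p i) (x i)) + cscale I b (\<Sum>i<m. cscale I (z q i) (x i))"
      by (simp add: linear_sum[OF linear_cscale] cscale_cscale cscale_add_left sum.distrib)
    then have "(\<Sum>i<m. cscale I (z (cscale I a p + cscale I b q) i) (x i)) =
        (\<Sum>i<m. cscale I (a * z p i + b * z q i) (x i))"
      using z[of p, symmetric] z[of q, symmetric] z[of "cscale I a p + cscale I b q", symmetric] by simp
    from cindep_coords_unique[OF x this \<open>i < m\<close>]
    show "z (cscale I a p + cscale I b q) i = a * z p i + b * z q i" .
  qed
qed

text \<open>The real trace of a complex linear map is twice the real part of its complex trace.
  Applied to \<open>A\<close> and to \<open>I A\<close>, this recovers real and imaginary parts, so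
  vanishing of the two real traces means vanishing of the complex trace.\<close>

lemma tr_complex_coordinates:
  fixes m :: nat
  assumes A: "linear A" and AI: "\<And>x. A (I x) = I (A x)"
    and rep: "\<And>y. y = (\<Sum>i<m. cscale I (l i y) (x i))"
    and l: "\<And>i a u b v. i < m \<Longrightarrow> l i (cscale I a u + cscale I b v) = a * l i u + b * l i v"
  shows "complex_of_real (tr A) - \<i> * complex_of_real (tr (\<lambda>y. I (A y))) = 2 * (\<Sum>i<m. l i (A (x i)))"
proof -
  let ?K = "{..<m} \<times> (UNIV :: bool set)"
  define u where "u = (\<lambda>(i, s). if s then x i else I (x i))"
  define r where "r = (\<lambda>(i, s) y. if s then Re (l i y) else Im (l i y))"
  have l_I: "l i (I y) = \<i> * l i y" if "i < m" for i y
    using l[OF that, of \<i> y 0 0] by (simp add: I_eq_cscale[symmetric])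
  have l_lin: "linear (l i)" if "i < m" for i
  proof (rule linearI)
    show "l i (a + b) = l i a + l i b" for a b
      using l[OF that, of 1 a 1 b] cscale_complex_of_real[of I 1] by simp
    show "l i (c *\<^sub>R a) = c *\<^sub>R l i a" for c a
      using l[OF that, of "complex_of_real c" a 0 0] by (simp add: scaleR_conv_of_real)
  qed
  have rep': "y = (\<Sum>k\<in>?K. r k y *\<^sub>R u k)" for y
    unfolding sum_times_bool by (subst rep) (simp add: u_def r_def cscale_def)
  have r_lin: "linear (r k)" if "k \<in> ?K" for k
  proof -
    obtain i s where k: "k = (i, s)" "i < m" using \<open>k \<in> ?K\<close> by auto
    show ?thesis unfolding k r_def
      using linear_add[OF l_lin[OF k(2)]] linear_cmul[OF l_lin[OF k(2)]]
      by (auto intro!: linearI)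
  qed
  have "tr B = (\<Sum>i<m. 2 * Re (l i (B (x i))))" if B: "linear B" "\<And>x. B (I x) = I (B x)" for B
  proof -
    have "tr B = (\<Sum>k\<in>?K. r k (B (u k)))" by (rule tr_dual_frame[OF B(1) rep' r_lin])
    also have "\<dots> = (\<Sum>i<m. 2 * Re (l i (B (x i))))"
      by (simp add: sum_times_bool u_def r_def B(2) l_I)
    finally show ?thesis .
  qed
  from this[OF A AI] this[of "\<lambda>y. I (A y)", OF linear_compose[OF A linear_I, unfolded comp_def]]
  have "tr A = (\<Sum>i<m. 2 * Re (l i (A (x i))))" "tr (\<lambda>y. I (A y)) = (\<Sum>i<m. 2 * Re (\<i> * l i (A (x i))))"
    using AI l_I by simp_all
  then show ?thesis by (simp add: complex_eq_iff sum_distrib_left sum_negf)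
qed

text \<open>A complex span of \<open>k < m\<close> vectors has real dimension at most
  \<open>2 * k\<close>, so some vector lies outside it and extends the family.\<close>

lemma cindep_exists:
  assumes dim: "DIM('a) = 2 * m"
  shows "\<exists>x. cindep I m x"
proof -
  have "k \<le> m \<Longrightarrow> \<exists>x. cindep I k x" for k
  proof (induction k)
    case 0
    show ?case by (simp add: cindep_def)
  next
    case (Suc k)
    then obtain x where x: "cindep I k x" by auto
    let ?K = "{..<k} \<times> (UNIV :: bool set)"
    define S where "S = {y. \<exists>z. y = (\<Sum>i<k. cscale I (z i) (x i))}"
    have "\<exists>y. y \<notin> S"
    proof (rule ccontr)
      assume "\<not> (\<exists>y. y \<notin> S)"
      define u where "u = (\<lambda>(i, s). if s then x i else I (x i))"
      have "y \<in> span (u ` ?K)" for y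
      proof -
        obtain z where z: "y = (\<Sum>i<k. cscale I (z i) (x i))" using \<open>\<not> (\<exists>y. y \<notin> S)\<close> by (auto simp: S_def)
        have "cscale I (z i) (x i) \<in> span (u ` ?K)" if "i < k" for i
        proof -
          have "x i = u (i, True)" "I (x i) = u (i, False)" by (simp_all add: u_def)
          then have "x i \<in> u ` ?K" "I (x i) \<in> u ` ?K" using that by blast+
          then show ?thesis unfolding cscale_def by (intro span_add span_scale span_base)
        qed
        then show ?thesis unfolding z by (intro span_sum) auto
      qed
      then have "UNIV \<subseteq> span (u ` ?K)" by blast
      from dim_le_card[OF this] have "DIM('a) \<le> card (u ` ?K)" by (simp add: dim_UNIV)
      also have "\<dots> \<le> card ?K" by (rule card_image_le) simp
      also have "\<dots> = 2 * k" by (simp add: card_cartesian_product)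
      finally show False using dim Suc.prems by simp
    qed
    then obtain y where y: "y \<notin> S" by blast
    have "cindep I (Suc k) (x(k := y))"
      unfolding cindep_def
    proof (intro allI impI)
      fix z i assume "(\<Sum>i<Suc k. cscale I (z i) ((x(k := y)) i)) = 0" and i: "i < Suc k"
      then have rel: "(\<Sum>i<k. cscale I (z i) (x i)) + cscale I (z k) y = 0" by simp
      have "z k = 0"
      proof (rule ccontr)
        assume zk: "z k \<noteq> 0"
        have "cscale I (- 1 / z k) (\<Sum>i<k. cscale I (z i) (x i)) = cscale I (- 1 / z k) (- cscale I (z k) y)"
          using rel by (simp add: add_eq_0_iff)
        also have "\<dots> = y"
          using zk by (simp add: linear_neg[OF linear_cscale] cscale_cscale) (simp add: cscale_def)
        finally have "y = (\<Sum>i<k. cscale I (- 1 / z k * z i) (x i))"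
          by (simp add: linear_sum[OF linear_cscale] cscale_cscale)
        then show False using y unfolding S_def by (auto intro!: exI[of _ "\<lambda>i. - 1 / z k * z i"])
      qed
      then show "z i = 0" using rel x i unfolding cindep_def by (cases "i = k") auto
    qed
    then show ?case by blast
  qed
  then show ?thesis by simp
qed

section \<open>Top-degree complex forms and determinants\<close>

lemma calt_sum:
  assumes \<Omega>: "calt I m \<Omega>" and xs: "length xs = m" "i < m" and "finite F"
  shows "\<Omega> (xs[i := (\<Sum>j\<in>F. cscale I (z j) (y j))]) = (\<Sum>j\<in>F. z j * \<Omega> (xs[i := y j]))"
  using \<open>finite F\<close>
proof (induction F)
  case empty
  have "\<Omega> (xs[i := cscale I 0 0 + cscale I 0 0]) = 0 * \<Omega> (xs[i := 0]) + 0 * \<Omega> (xs[i := 0])"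
    using \<Omega> xs unfolding calt_def by blast
  then show ?case by simp
next
  case (insert j F)
  have "\<Omega> (xs[i := cscale I (z j) (y j) + cscale I 1 (\<Sum>j\<in>F. cscale I (z j) (y j))])
      = z j * \<Omega> (xs[i := y j]) + 1 * \<Omega> (xs[i := (\<Sum>j\<in>F. cscale I (z j) (y j))])"
    using \<Omega> xs unfolding calt_def by blast
  then show ?case using insert cscale_complex_of_real[of I 1] by simp
qed

lemma calt_repeat:
  assumes "calt I m \<Omega>" "i < m" "j < m" "i \<noteq> j"
  shows "\<Omega> ((map x [0..<m])[i := x j]) = 0"
proof -
  let ?xs = "(map x [0..<m])[i := x j]"
  have "length ?xs = m" "?xs ! i = ?xs ! j" using assms(2-4) by auto
  then show ?thesis using assms unfolding calt_def by blast
qed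

text \<open>Expanding slot \<open>i\<close>, every term with \<open>j \<noteq> i\<close> repeats an
  argument and vanishes; the diagonal coefficient survives.\<close>

lemma calt_coordinate:
  assumes \<Omega>: "calt I m \<Omega>" and i: "i < m"
  shows "\<Omega> ((map x [0..<m])[i := (\<Sum>j<m. cscale I (z j) (x j))]) = z i * \<Omega> (map x [0..<m])"
proof -
  have "\<Omega> ((map x [0..<m])[i := (\<Sum>j<m. cscale I (z j) (x j))])
      = (\<Sum>j<m. z j * \<Omega> ((map x [0..<m])[i := x j]))"
    by (rule calt_sum[OF \<Omega>]) (use i in auto)
  also have "\<dots> = (\<Sum>j\<in>{i}. z j * \<Omega> ((map x [0..<m])[i := x j]))"
    using calt_repeat[OF \<Omega> i] i by (intro sum.mono_neutral_right) auto
  also have "\<dots> = z i * \<Omega> (map x [0..<m])"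
    using i list_update_id[of "map x [0..<m]" i] by simp
  finally show ?thesis .
qed

lemma calt_dependent:
  assumes \<Omega>: "calt I m \<Omega>" and dep: "\<not> cindep I m x"
  shows "\<Omega> (map x [0..<m]) = 0"
proof -
  obtain z i where z: "(\<Sum>i<m. cscale I (z i) (x i)) = 0" "i < m" "z i \<noteq> 0"
    using dep unfolding cindep_def by blast
  have "z i * \<Omega> (map x [0..<m]) = \<Omega> ((map x [0..<m])[i := 0])"
    using calt_coordinate[OF \<Omega> z(2), of x z] z(1) by simp
  also have "\<dots> = 0" using calt_sum[OF \<Omega> _ z(2), of "map x [0..<m]" "{}"] by simp
  finally show ?thesis using z(3) by simp
qed

text \<open>The derivative of the determinant is the trace: inserting \<open>A\<close> in slot
  \<open>i\<close> multiplies the form by the \<open>i\<close>-th diagonal coefficient of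
  \<open>A\<close>, so the sum is the complex trace of \<open>A\<close> times the form.\<close>

lemma calt_derivation:
  assumes \<Omega>: "calt I m \<Omega>" and x: "cindep I m x" and dim: "DIM('a) = 2 * m"
    and A: "linear A" "\<And>x. A (I x) = I (A x)" and tr: "tr A = 0" "tr (\<lambda>x. I (A x)) = 0"
  shows "(\<Sum>i<m. \<Omega> ((map x [0..<m])[i := A (x i)])) = 0"
proof -
  obtain l where rep: "\<And>y. y = (\<Sum>i<m. cscale I (l i y) (x i))"
    and l: "\<And>i a u b v. i < m \<Longrightarrow> l i (cscale I a u + cscale I b v) = a * l i u + b * l i v"
    using cindep_coordinates[OF x dim] by blast
  have "\<Omega> ((map x [0..<m])[i := A (x i)]) = l i (A (x i)) * \<Omega> (map x [0..<m])" if "i < m" for i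
    using calt_coordinate[OF \<Omega> that, of x "\<lambda>j. l j (A (x i))"] rep[of "A (x i)"] by simp
  then have "(\<Sum>i<m. \<Omega> ((map x [0..<m])[i := A (x i)])) = (\<Sum>i<m. l i (A (x i))) * \<Omega> (map x [0..<m])"
    by (simp add: sum_distrib_right)
  also have "(\<Sum>i<m. l i (A (x i))) = 0"
    using tr_complex_coordinates[OF A rep l] tr by simp
  finally show ?thesis by simp
qed

text \<open>The form is the determinant of the complex coordinates, by the Leibniz formula. It
  witnesses that the top exterior power is nonzero, without which the scalar in
  \<open>quat_det\<close> would not be unique.\<close>

lemma calt_exists:
  assumes x: "cindep I m x" and dim: "DIM('a) = 2 * m"
  obtains \<Omega> where "calt I m \<Omega>" "\<Omega> (map x [0..<m]) = 1"
proof -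
  obtain l where rep: "\<And>y. y = (\<Sum>i<m. cscale I (l i y) (x i))"
    and l: "\<And>i a u b v. i < m \<Longrightarrow> l i (cscale I a u + cscale I b v) = a * l i u + b * l i v"
    using cindep_coordinates[OF x dim] by blast
  let ?P = "{p. p permutes {..<m}}"
  define \<Omega> where "\<Omega> xs = (\<Sum>p\<in>?P. of_int (sign p) * (\<Prod>i<m. l (p i) (xs ! i)))" for xs
  have "calt I m \<Omega>"
    unfolding calt_def
  proof (intro conjI allI impI; elim conjE)
    fix xs :: "'a list" and i u v a b assume xs: "length xs = m" "i < m"
    have split: "(\<Prod>k<m. l (p k) (xs[i := y] ! k)) = l (p i) y * (\<Prod>k\<in>{..<m} - {i}. l (p k) (xs ! k))" for p y
    proof -
      have "(\<Prod>k<m. l (p k) (xs[i := y] ! k))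
          = l (p i) (xs[i := y] ! i) * (\<Prod>k\<in>{..<m} - {i}. l (p k) (xs[i := y] ! k))"
        using xs by (intro prod.remove) auto
      also have "(\<Prod>k\<in>{..<m} - {i}. l (p k) (xs[i := y] ! k)) = (\<Prod>k\<in>{..<m} - {i}. l (p k) (xs ! k))"
        by (rule prod.cong) auto
      finally show ?thesis using xs by simp
    qed
    have "l (p i) (cscale I a u + cscale I b v) = a * l (p i) u + b * l (p i) v" if "p \<in> ?P" for p
      using l permutes_in_image[of p "{..<m}" i] that xs(2) by simp
    then have "\<Omega> (xs[i := cscale I a u + cscale I b v]) = (\<Sum>p\<in>?P.
        a * (of_int (sign p) * (l (p i) u * (\<Prod>k\<in>{..<m} - {i}. l (p k) (xs ! k)))) +
        b * (of_int (sign p) * (l (p i) v * (\<Prod>k\<in>{..<m} - {i}. l (p k) (xs ! k)))))"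
      unfolding \<Omega>_def split by (intro sum.cong) (simp_all add: algebra_simps)
    then show "\<Omega> (xs[i := cscale I a u + cscale I b v]) = a * \<Omega> (xs[i := u]) + b * \<Omega> (xs[i := v])"
      unfolding \<Omega>_def split by (simp add: sum.distrib sum_distrib_left)
  next
    fix xs :: "'a list" and i j assume ij: "length xs = m" "i < m" "j < m" "i \<noteq> j" "xs ! i = xs ! j"
    \<comment> \<open>Composing each permutation with the transposition of the two equal slots
      permutes the Leibniz sum, reverses all signs and leaves the products unchanged.\<close>
    let ?t = "Transposition.transpose i j"
    have t: "?t permutes {..<m}" using ij by (intro permutes_swap_id) auto
    have "\<Omega> xs = (\<Sum>p\<in>?P. of_int (sign (p \<circ> ?t)) * (\<Prod>k<m. l ((p \<circ> ?t) k) (xs ! k)))"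
      unfolding \<Omega>_def by (rule sum.reindex_bij_betw[symmetric], rule bij_betw_byWitness[where f' = "\<lambda>p. p \<circ> ?t"])
        (auto simp: comp_assoc intro!: permutes_compose[OF t])
    also have "\<dots> = (\<Sum>p\<in>?P. - (of_int (sign p) * (\<Prod>k<m. l (p k) (xs ! k))))"
    proof (rule sum.cong[OF refl])
      fix p assume "p \<in> ?P"
      then have "permutation p" "permutation ?t"
        using permutation_permutes t by blast+
      then have "sign (p \<circ> ?t) = - sign p" using ij by (simp add: sign_compose sign_swap_id)
      moreover have "(\<Prod>k<m. l ((p \<circ> ?t) k) (xs ! k)) = (\<Prod>k<m. l (p (?t k)) (xs ! (?t k)))"
      proof (rule prod.cong[OF refl])
        fix k
        have "xs ! (?t k) = xs ! k" using ij by (auto simp: Transposition.transpose_def)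
        then show "l ((p \<circ> ?t) k) (xs ! k) = l (p (?t k)) (xs ! (?t k))" by simp
      qed
      moreover have "\<dots> = (\<Prod>k<m. l (p k) (xs ! k))"
        by (rule prod.reindex_bij_betw[OF permutes_imp_bij[OF t]])
      ultimately show "of_int (sign (p \<circ> ?t)) * (\<Prod>k<m. l ((p \<circ> ?t) k) (xs ! k))
          = - (of_int (sign p) * (\<Prod>k<m. l (p k) (xs ! k)))" by simp
    qed
    also have "\<dots> = - \<Omega> xs" by (simp add: \<Omega>_def sum_negf)
    finally show "\<Omega> xs = 0" by simp
  qed
  moreover have "\<Omega> (map x [0..<m]) = 1"
  proof -
    \<comment> \<open>The functionals \<open>l\<close> are dual to \<open>x\<close>, so a
      permutation that moves some index contributes a zero factor, and the identity contributes
      1.\<close>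
    have delta: "l j (x i) = (if j = i then 1 else 0)" if "i < m" "j < m" for i j
    proof -
      have "(\<Sum>j<m. cscale I (if j = i then 1 else 0) (x j)) = (\<Sum>j\<in>{i}. cscale I (if j = i then 1 else 0) (x j))"
        using that by (intro sum.mono_neutral_right) auto
      also have "\<dots> = x i" using cscale_complex_of_real[of I 1] by simp
      finally have "(\<Sum>j<m. cscale I (l j (x i)) (x j)) = (\<Sum>j<m. cscale I (if j = i then 1 else 0) (x j))"
        using rep[of "x i"] by simp
      from cindep_coords_unique[OF x this that(2)] show ?thesis .
    qed
    have "(\<Prod>i<m. l (p i) (map x [0..<m] ! i)) = 0" if p: "p \<in> ?P - {id}" for p
    proof -
      obtain i where i: "p i \<noteq> i" using p by (metis DiffE eq_id_iff singletonI)
      then have "i < m" using p by (auto simp: permutes_def)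
      moreover have "p i < m" using p \<open>i < m\<close> permutes_in_image[of p "{..<m}" i] by simp
      ultimately have "l (p i) (map x [0..<m] ! i) = 0" using delta[of i "p i"] i by simp
      then show ?thesis using \<open>i < m\<close> by (intro prod_zero) auto
    qed
    then have "\<Omega> (map x [0..<m]) = (\<Sum>p\<in>{id}. of_int (sign p) * (\<Prod>i<m. l (p i) (map x [0..<m] ! i)))"
      unfolding \<Omega>_def by (intro sum.mono_neutral_right finite_permutations) (auto simp: permutes_id)
    then show ?thesis using delta by (simp add: sign_id)
  qed
  ultimately show thesis using that by blast
qed

end

text \<open>The product rule, by induction on the number of slots: expanding the first argument in
  \<open>Basis\<close> leaves scalar functions times forms with a fixed first entry, which have one
  slot fewer.\<close>

lemma multilinear_has_vector_derivative:
  fixes \<Omega> :: "'a::euclidean_space list \<Rightarrow> complex"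
  assumes "\<And>xs i u v a b. length xs = m \<Longrightarrow> i < m \<Longrightarrow>
      \<Omega> (xs[i := a *\<^sub>R u + b *\<^sub>R v]) = a *\<^sub>R \<Omega> (xs[i := u]) + b *\<^sub>R \<Omega> (xs[i := v])"
    and "\<And>i. i < m \<Longrightarrow> (v i has_vector_derivative v' i) (at s within S)"
  shows "((\<lambda>s. \<Omega> (map (\<lambda>i. v i s) [0..<m])) has_vector_derivative
     (\<Sum>i<m. \<Omega> ((map (\<lambda>i. v i s) [0..<m])[i := v' i]))) (at s within S)"
  using assms
proof (induction m arbitrary: \<Omega> v v')
  case 0
  then show ?case by simp
next
  case (Suc m)
  have upt: "map f [0..<Suc m] = f 0 # map (\<lambda>i. f (Suc i)) [0..<m]" for f :: "nat \<Rightarrow> 'a"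
    by (simp add: upt_conv_Cons map_Suc_upt[symmetric] comp_def del: upt_Suc)
  have lin0: "linear (\<lambda>y. \<Omega> (y # xs))" if "length xs = m" for xs
  proof (rule linearI)
    show "\<Omega> ((a + b) # xs) = \<Omega> (a # xs) + \<Omega> (b # xs)" for a b
      using Suc.prems(1)[of "0 # xs" 0 1 a 1 b] that by simp
    show "\<Omega> ((c *\<^sub>R a) # xs) = c *\<^sub>R \<Omega> (a # xs)" for c a
      using Suc.prems(1)[of "0 # xs" 0 c a 0 0] that by simp
  qed
  have IH: "((\<lambda>s. \<Omega> (b # map (\<lambda>i. v (Suc i) s) [0..<m])) has_vector_derivative
     (\<Sum>i<m. \<Omega> (b # (map (\<lambda>i. v (Suc i) s) [0..<m])[i := v' (Suc i)]))) (at s within S)" for b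
  proof (rule Suc.IH[of "\<lambda>xs. \<Omega> (b # xs)" "\<lambda>i. v (Suc i)" "\<lambda>i. v' (Suc i)"])
    show "\<Omega> (b # xs[i := r *\<^sub>R u + t *\<^sub>R w]) = r *\<^sub>R \<Omega> (b # xs[i := u]) + t *\<^sub>R \<Omega> (b # xs[i := w])"
      if "length xs = m" "i < m" for xs i r u t w
      using Suc.prems(1)[of "b # xs" "Suc i" r u t w] that by simp
    show "(v (Suc i) has_vector_derivative v' (Suc i)) (at s within S)" if "i < m" for i
      using Suc.prems(2) that by simp
  qed
  let ?w = "\<lambda>s. map (\<lambda>i. v (Suc i) s) [0..<m]"
  have "((\<lambda>s. \<Sum>b\<in>Basis. (v 0 s \<bullet> b) *\<^sub>R \<Omega> (b # ?w s)) has_vector_derivative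
      (\<Sum>b\<in>Basis. (v 0 s \<bullet> b) *\<^sub>R (\<Sum>i<m. \<Omega> (b # (?w s)[i := v' (Suc i)])) + (v' 0 \<bullet> b) *\<^sub>R \<Omega> (b # ?w s)))
      (at s within S)"
  proof (rule has_vector_derivative_sum, rule has_vector_derivative_scaleR[OF _ IH])
    fix b :: 'a
    show "((\<lambda>s. v 0 s \<bullet> b) has_real_derivative v' 0 \<bullet> b) (at s within S)"
      using bounded_linear.has_vector_derivative[OF bounded_linear_inner_left Suc.prems(2)[of 0]]
      by (simp add: has_real_derivative_iff_has_vector_derivative)
  qed
  moreover have "(\<Sum>b\<in>Basis. (v 0 s \<bullet> b) *\<^sub>R \<Omega> (b # ?w s)) = \<Omega> (map (\<lambda>i. v i s) [0..<Suc m])" for s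
    unfolding upt by (rule linear_expand_Basis[OF lin0, symmetric]) simp
  moreover have "(\<Sum>b\<in>Basis. (v 0 s \<bullet> b) *\<^sub>R (\<Sum>i<m. \<Omega> (b # (?w s)[i := v' (Suc i)])) + (v' 0 \<bullet> b) *\<^sub>R \<Omega> (b # ?w s))
      = (\<Sum>i<Suc m. \<Omega> ((map (\<lambda>i. v i s) [0..<Suc m])[i := v' i]))"
  proof -
    have "(\<Sum>b\<in>Basis. (v' 0 \<bullet> b) *\<^sub>R \<Omega> (b # ?w s)) = \<Omega> (v' 0 # ?w s)"
      by (rule linear_expand_Basis[OF lin0, symmetric]) simp
    moreover have "(\<Sum>b\<in>Basis. (v 0 s \<bullet> b) *\<^sub>R (\<Sum>i<m. \<Omega> (b # (?w s)[i := v' (Suc i)])))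
        = (\<Sum>i<m. \<Omega> (v 0 s # (?w s)[i := v' (Suc i)]))"
    proof -
      have "(\<Sum>b\<in>Basis. (v 0 s \<bullet> b) *\<^sub>R (\<Sum>i<m. \<Omega> (b # (?w s)[i := v' (Suc i)])))
          = (\<Sum>i<m. \<Sum>b\<in>Basis. (v 0 s \<bullet> b) *\<^sub>R \<Omega> (b # (?w s)[i := v' (Suc i)]))"
        by (simp add: scaleR_sum_right) (rule sum.swap)
      then show ?thesis
        by (simp add: linear_expand_Basis[OF lin0, symmetric])
    qed
    ultimately show ?thesis
      unfolding upt sum.lessThan_Suc_shift by (simp add: sum.distrib)
  qed
  ultimately show ?case by simp
qed

section \<open>Linear differential equations along a subdivided interval\<close>

text \<open>Gronwall's argument: \<open>f\<close>, the square of the norm of \<open>v\<close>,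
  satisfies \<open>\<bar>f'\<bar> \<le> 2 * C * f\<close>. Hence
  \<open>exp (- 2 * C * s) * f s\<close> does not increase and \<open>exp (2 * C * s) * f s\<close>
  does not decrease, which bounds \<open>f\<close> by 0 on either side of \<open>s0\<close>.\<close>

lemma linear_ode_zero:
  fixes v :: "real \<Rightarrow> 'a::euclidean_space"
  assumes deriv: "\<And>s. s \<in> {a..b} \<Longrightarrow> (v has_vector_derivative - \<Theta> s (v s)) (at s within {a..b})"
    and bound: "\<And>s w. s \<in> {a..b} \<Longrightarrow> norm (\<Theta> s w) \<le> C * norm w"
    and s0: "s0 \<in> {a..b}" "v s0 = 0" and s: "s \<in> {a..b}"
  shows "v s = 0"
proof -
  define f where "f s = v s \<bullet> v s" for s
  define f' where "f' s = 2 * (v s \<bullet> - \<Theta> s (v s))" for s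
  have cont: "continuous_on {a..b} f"
  proof -
    have "continuous (at s within {a..b}) v" if "s \<in> {a..b}" for s
      using has_vector_derivative_continuous[OF deriv[OF that]] .
    then have "continuous_on {a..b} v" by (simp add: continuous_on_eq_continuous_within)
    then show ?thesis unfolding f_def by (intro continuous_intros)
  qed
  \<comment> \<open>Inside the interval the derivative within it is a full derivative. The end
    points, where only a one-sided derivative exists, enter through continuity of
    \<open>f\<close>.\<close>
  have df: "(f has_real_derivative f' s) (at s)" if "a < s" "s < b" for s
  proof -
    have "(v has_vector_derivative - \<Theta> s (v s)) (at s)"
      using deriv[of s] that at_within_Icc_at[OF that] by simp
    then have "(v has_derivative (\<lambda>h. h *\<^sub>R - \<Theta> s (v s))) (at s)"
      by (simp add: has_vector_derivative_def)
    from has_derivative_inner[OF this this]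
    have "(f has_derivative (\<lambda>h. v s \<bullet> h *\<^sub>R - \<Theta> s (v s) + h *\<^sub>R - \<Theta> s (v s) \<bullet> v s)) (at s)"
      unfolding f_def .
    moreover have "(\<lambda>h. v s \<bullet> h *\<^sub>R - \<Theta> s (v s) + h *\<^sub>R - \<Theta> s (v s) \<bullet> v s) = (*) (f' s)"
      by (simp add: fun_eq_iff f'_def inner_commute)
    ultimately show ?thesis unfolding has_field_derivative_def by simp
  qed
  have f': "\<bar>f' s\<bar> \<le> 2 * C * f s" if "s \<in> {a..b}" for s
  proof -
    have "\<bar>v s \<bullet> \<Theta> s (v s)\<bar> \<le> norm (v s) * norm (\<Theta> s (v s))" by (rule Cauchy_Schwarz_ineq2)
    also have "\<dots> \<le> norm (v s) * (C * norm (v s))" by (intro mult_left_mono bound that) simp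
    finally show ?thesis unfolding f'_def f_def
      by (simp add: abs_mult power2_norm_eq_inner[symmetric] power2_eq_square algebra_simps)
  qed
  have "f s \<le> 0"
  proof (cases s0 s rule: linorder_cases)
    case less
    have "exp (- 2 * C * s) * f s \<le> exp (- 2 * C * s0) * f s0"
    proof (rule DERIV_nonpos_imp_decreasing_open[OF less[THEN less_imp_le]])
      fix x assume x: "s0 < x" "x < s"
      then have x': "a < x" "x < b" using s0 s by auto
      have "((\<lambda>s. exp (- 2 * C * s) * f s) has_real_derivative
          exp (- 2 * C * x) * (f' x - 2 * C * f x)) (at x)"
        by (auto intro!: derivative_eq_intros df[OF x'] simp: algebra_simps)
      moreover have "exp (- 2 * C * x) * (f' x - 2 * C * f x) \<le> 0"
        using f'[of x] x' by (intro mult_nonneg_nonpos) auto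
      ultimately show "\<exists>y. ((\<lambda>s. exp (- 2 * C * s) * f s) has_real_derivative y) (at x) \<and> y \<le> 0" by blast
    next
      show "continuous_on {s0..s} (\<lambda>s. exp (- 2 * C * s) * f s)"
        using s0 s by (intro continuous_intros continuous_on_subset[OF cont]) auto
    qed
    then show ?thesis using s0(2) by (simp add: f_def[of s0] mult_le_0_iff)
  next
    case equal
    then show ?thesis using s0 by (simp add: f_def)
  next
    case greater
    have "exp (2 * C * s) * f s \<le> exp (2 * C * s0) * f s0"
    proof (rule DERIV_nonneg_imp_increasing_open[OF greater[THEN less_imp_le]])
      fix x assume x: "s < x" "x < s0"
      then have x': "a < x" "x < b" using s0 s by auto
      have "((\<lambda>s. exp (2 * C * s) * f s) has_real_derivative
          exp (2 * C * x) * (f' x + 2 * C * f x)) (at x)"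
        by (auto intro!: derivative_eq_intros df[OF x'] simp: algebra_simps)
      moreover have "exp (2 * C * x) * (f' x + 2 * C * f x) \<ge> 0"
        using f'[of x] x' by (intro mult_nonneg_nonneg) auto
      ultimately show "\<exists>y. ((\<lambda>s. exp (2 * C * s) * f s) has_real_derivative y) (at x) \<and> 0 \<le> y" by blast
    next
      show "continuous_on {s..s0} (\<lambda>s. exp (2 * C * s) * f s)"
        using s0 s by (intro continuous_intros continuous_on_subset[OF cont]) auto
    qed
    then show ?thesis using s0(2) by (simp add: f_def[of s0] mult_le_0_iff)
  qed
  then show ?thesis unfolding f_def by (metis inner_gt_zero_iff not_le)
qed

text \<open>The coefficient depends on the piece as well as on the time, since the velocity of a
  piecewise smooth curve may jump at a node. There a solution satisfies two equations, each with its
  own one-sided derivative.\<close>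

locale piecewise_ode =
  fixes m :: nat and t :: "nat \<Rightarrow> real" and \<Theta> :: "nat \<Rightarrow> real \<Rightarrow> 'a::euclidean_space \<Rightarrow> 'a"
  assumes subdivision: "subdivision m t"
    and linear_\<Theta>: "\<And>i s. i < m \<Longrightarrow> s \<in> {t i..t (Suc i)} \<Longrightarrow> linear (\<Theta> i s)"
    and bounded_\<Theta>: "\<And>i. i < m \<Longrightarrow> \<exists>C. \<forall>s\<in>{t i..t (Suc i)}. \<forall>w. norm (\<Theta> i s w) \<le> C * norm w"
begin

definition sol :: "(real \<Rightarrow> 'a) \<Rightarrow> bool" where
  "sol v \<longleftrightarrow> (\<forall>i<m. \<forall>s\<in>{t i..t (Suc i)}.
     (v has_vector_derivative - \<Theta> i s (v s)) (at s within {t i..t (Suc i)}))"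

lemma t_0: "t 0 = 0" and t_m: "t m = 1" and t_less: "i < m \<Longrightarrow> t i < t (Suc i)"
  using subdivision by (simp_all add: subdivision_def)

lemma t_mono: "i \<le> j \<Longrightarrow> j \<le> m \<Longrightarrow> t i \<le> t j"
proof (induction j)
  case (Suc j)
  show ?case
  proof (cases "i = Suc j")
    case False
    then have "t i \<le> t j" using Suc by simp
    also have "\<dots> \<le> t (Suc j)" using t_less[of j] Suc.prems by simp
    finally show ?thesis .
  qed simp
qed simp

lemma piece_exists:
  assumes "s \<in> {0..1}"
  obtains i where "i < m" "s \<in> {t i..t (Suc i)}"
proof -
  have "k \<le> m \<Longrightarrow> s \<le> t k \<Longrightarrow> 0 < k \<Longrightarrow> \<exists>i<m. s \<in> {t i..t (Suc i)}" for k
  proof (induction k)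
    case (Suc k)
    show ?case
    proof (cases "s \<le> t k \<and> 0 < k")
      case True
      then show ?thesis using Suc by simp
    next
      case False
      then have "t k \<le> s" using assms t_0 by (cases "k = 0") auto
      then show ?thesis using Suc.prems by (intro exI[of _ k]) auto
    qed
  qed simp
  moreover have "0 < m" using t_0 t_m by (cases m) auto
  ultimately show thesis using that assms t_m by force
qed

lemma sol_piece_zero:
  assumes "sol v" "i < m" "s \<in> {t i..t (Suc i)}" "v s = 0" "s' \<in> {t i..t (Suc i)}"
  shows "v s' = 0"
proof -
  obtain C where "\<And>s w. s \<in> {t i..t (Suc i)} \<Longrightarrow> norm (\<Theta> i s w) \<le> C * norm w"
    using bounded_\<Theta>[OF assms(2)] by blast
  then show ?thesis
    using linear_ode_zero[of "t i" "t (Suc i)" v "\<Theta> i" C s s'] assms unfolding sol_def by blast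
qed

lemma sol_node_zero:
  assumes v: "sol v" and "i \<le> m"
  shows "v (t i) = 0 \<longleftrightarrow> v 0 = 0"
  using \<open>i \<le> m\<close>
proof (induction i)
  case 0
  show ?case by (simp add: t_0)
next
  case (Suc i)
  have "t i \<in> {t i..t (Suc i)}" "t (Suc i) \<in> {t i..t (Suc i)}" using t_less[of i] Suc.prems by auto
  then have "v (t i) = 0 \<longleftrightarrow> v (t (Suc i)) = 0" using sol_piece_zero[OF v, of i] Suc.prems by auto
  then show ?case using Suc by simp
qed

text \<open>Zeros propagate in both directions within a piece and across the nodes. Applied to
  linear combinations of solutions, this shows that transport preserves linear independence.\<close>

lemma sol_zero:
  assumes v: "sol v" and s: "s \<in> {0..1}"
  shows "v s = 0 \<longleftrightarrow> v 0 = 0"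
proof -
  obtain i where i: "i < m" "s \<in> {t i..t (Suc i)}" using piece_exists[OF s] .
  have "t i \<in> {t i..t (Suc i)}" using t_less[OF i(1)] by auto
  then have "v s = 0 \<longleftrightarrow> v (t i) = 0" using sol_piece_zero[OF v i(1)] i(2) by blast
  then show ?thesis using sol_node_zero[OF v, of i] i(1) by simp
qed

lemma sol_add: "sol v \<Longrightarrow> sol w \<Longrightarrow> sol (\<lambda>s. v s + w s)"
  unfolding sol_def using linear_add[OF linear_\<Theta>]
  by (auto intro!: derivative_eq_intros)

text \<open>An endomorphism commuting with all coefficients maps solutions to solutions. Together
  with uniqueness this is why transport commutes with the quaternionic structure.\<close>

lemma sol_linear:
  assumes v: "sol v" and L: "linear L"
    and comm: "\<And>i s x. i < m \<Longrightarrow> s \<in> {t i..t (Suc i)} \<Longrightarrow> \<Theta> i s (L x) = L (\<Theta> i s x)"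
  shows "sol (\<lambda>s. L (v s))"
  unfolding sol_def
proof (intro allI impI ballI)
  fix i s assume i: "i < m" and s: "s \<in> {t i..t (Suc i)}"
  have "(v has_vector_derivative - \<Theta> i s (v s)) (at s within {t i..t (Suc i)})"
    using v i s unfolding sol_def by blast
  from bounded_linear.has_vector_derivative[OF linear_conv_bounded_linear[THEN iffD1, OF L] this]
  show "((\<lambda>s. L (v s)) has_vector_derivative - \<Theta> i s (L (v s))) (at s within {t i..t (Suc i)})"
    using comm[OF i s] by (simp add: linear_neg[OF L])
qed

lemma sol_0: "sol (\<lambda>s. 0)"
  unfolding sol_def using linear_0[OF linear_\<Theta>] by auto

lemma sol_unique:
  assumes v: "sol v" and w: "sol w" and eq: "v 0 = w 0" and s: "s \<in> {0..1}"
  shows "v s = w s"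
proof -
  have "\<Theta> i s (- x) = - \<Theta> i s x" if "i < m" "s \<in> {t i..t (Suc i)}" for i s x
    using linear_neg[OF linear_\<Theta>[OF that]] by simp
  then have "sol (\<lambda>s. - w s)" using sol_linear[OF w linear_uminus] by simp
  from sol_add[OF v this] have "sol (\<lambda>s. v s + - w s)" .
  from sol_zero[OF this s] eq show ?thesis by simp
qed

end

locale piecewise_complex_ode = piecewise_ode m t \<Theta> + linear_complex_structure I
  for m t and \<Theta> :: "nat \<Rightarrow> real \<Rightarrow> 'a::euclidean_space \<Rightarrow> 'a" and I :: "'a \<Rightarrow> 'a" +
  assumes \<Theta>_I: "\<And>i s x. i < m \<Longrightarrow> s \<in> {t i..t (Suc i)} \<Longrightarrow> \<Theta> i s (I x) = I (\<Theta> i s x)"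
    and tr_\<Theta>: "\<And>i s. i < m \<Longrightarrow> s \<in> {t i..t (Suc i)} \<Longrightarrow> tr (\<Theta> i s) = 0"
    and tr_I_\<Theta>: "\<And>i s. i < m \<Longrightarrow> s \<in> {t i..t (Suc i)} \<Longrightarrow> tr (\<lambda>x. I (\<Theta> i s x)) = 0"
begin

lemma sol_cscale: "sol v \<Longrightarrow> sol (\<lambda>s. cscale I z (v s))"
  by (rule sol_linear[OF _ linear_cscale])
     (simp_all add: cscale_def linear_add[OF linear_\<Theta>] linear_cmul[OF linear_\<Theta>] \<Theta>_I)

lemma sol_sum_cscale:
  fixes k :: nat
  assumes "\<And>i. i < k \<Longrightarrow> sol (v i)"
  shows "sol (\<lambda>s. \<Sum>i<k. cscale I (z i) (v i s))"
  using assms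
proof (induction k)
  case 0
  then show ?case by (simp add: sol_0)
next
  case (Suc k)
  have "sol (\<lambda>s. (\<Sum>i<k. cscale I (z i) (v i s)) + cscale I (z k) (v k s))"
    by (intro sol_add Suc.IH sol_cscale Suc.prems) auto
  then show ?case by simp
qed

text \<open>Liouville's formula: the logarithmic derivative of a complex volume form along solutions is the
  complex trace of \<open>- \<Theta>\<close>, which is zero.\<close>

lemma calt_sol_invariant:
  assumes \<Omega>: "calt I k \<Omega>" and dim: "DIM('a) = 2 * k" and v: "\<And>i. i < k \<Longrightarrow> sol (v i)"
  shows "\<Omega> (map (\<lambda>i. v i 1) [0..<k]) = \<Omega> (map (\<lambda>i. v i 0) [0..<k])"
proof -
  \<comment> \<open>Complex combinations of solutions are solutions, so the family is independent at
    all times or at none. If at none, both sides vanish; otherwise the solutions form a complex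
    basis at every time and \<open>calt_derivation\<close> applies.\<close>
  have indep: "cindep I k (\<lambda>i. v i s) \<longleftrightarrow> cindep I k (\<lambda>i. v i 0)" if "s \<in> {0..1}" for s
  proof -
    have "(\<Sum>i<k. cscale I (z i) (v i s)) = 0 \<longleftrightarrow> (\<Sum>i<k. cscale I (z i) (v i 0)) = 0" for z
      by (rule sol_zero[OF sol_sum_cscale[OF v] that])
    then show ?thesis unfolding cindep_def by simp
  qed
  show ?thesis
  proof (cases "cindep I k (\<lambda>i. v i 0)")
    case False
    then show ?thesis
      using indep[of 1] calt_dependent[OF \<Omega>, of "\<lambda>i. v i 0"] calt_dependent[OF \<Omega>, of "\<lambda>i. v i 1"] by simp
  next
    case True
    define F where "F s = \<Omega> (map (\<lambda>i. v i s) [0..<k])" for s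
    have F': "(F has_vector_derivative 0) (at s within {t j..t (Suc j)})"
      if j: "j < m" and s: "s \<in> {t j..t (Suc j)}" for j s
    proof -
      have "0 \<le> s" "s \<le> 1" using s j t_mono[of 0 j] t_mono[of "Suc j" m] t_0 t_m by auto
      then have x: "cindep I k (\<lambda>i. v i s)" using indep[of s] True by simp
      define A where "A x = - \<Theta> j s x" for x
      have A: "linear A" unfolding A_def
        using linear_compose_neg[OF linear_\<Theta>[OF j s]] by (simp add: fun_Compl_def)
      have AI: "A (I x) = I (A x)" for x by (simp add: A_def \<Theta>_I[OF j s] linear_neg[OF linear_I])
      have trA: "tr A = 0" unfolding A_def by (simp add: tr_minus tr_\<Theta>[OF j s])
      have trIA: "tr (\<lambda>x. I (A x)) = 0"
        unfolding A_def linear_neg[OF linear_I] by (simp add: tr_minus tr_I_\<Theta>[OF j s])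
      have "((\<lambda>s. \<Omega> (map (\<lambda>i. v i s) [0..<k])) has_vector_derivative
          (\<Sum>i<k. \<Omega> ((map (\<lambda>i. v i s) [0..<k])[i := A (v i s)]))) (at s within {t j..t (Suc j)})"
      proof (rule multilinear_has_vector_derivative)
        show "(v i has_vector_derivative A (v i s)) (at s within {t j..t (Suc j)})" if "i < k" for i
          using v[OF that] j s unfolding sol_def A_def by blast
        fix xs :: "'a list" and i x y and a b :: real assume "length xs = k" "i < k"
        then have "\<Omega> (xs[i := cscale I (complex_of_real a) x + cscale I (complex_of_real b) y])
            = complex_of_real a * \<Omega> (xs[i := x]) + complex_of_real b * \<Omega> (xs[i := y])"
          using \<Omega> unfolding calt_def by blast
        then show "\<Omega> (xs[i := a *\<^sub>R x + b *\<^sub>R y]) = a *\<^sub>R \<Omega> (xs[i := x]) + b *\<^sub>R \<Omega> (xs[i := y])"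
          by (simp add: scaleR_conv_of_real)
      qed
      then show ?thesis
        unfolding calt_derivation[OF \<Omega> x dim A AI trA trIA] F_def by simp
    qed
    have "j \<le> m \<Longrightarrow> F (t j) = F 0" for j
    proof (induction j)
      case 0
      show ?case by (simp add: t_0)
    next
      case (Suc j)
      then have j: "j < m" by simp
      obtain c where c: "\<And>s. s \<in> {t j..t (Suc j)} \<Longrightarrow> F s = c"
        using has_vector_derivative_zero_constant[OF convex_real_interval(5) F'[OF j]] by blast
      have "F (t (Suc j)) = F (t j)" using c[of "t j"] c[of "t (Suc j)"] t_less[OF j] by simp
      then show ?case using Suc by simp
    qed
    from this[of m] show ?thesis by (simp add: t_m F_def)
  qed
qed

end

section \<open>Local smoothness in charts\<close>

definition good_chart :: "('p, 'e::euclidean_space) chart \<Rightarrow> bool" where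
  "good_chart c \<longleftrightarrow> inj_on (snd c) (fst c) \<and> open (snd c ` fst c)"

text \<open>The clause that a whole coordinate neighbourhood is mapped into the target chart is part
  of the notion. Composition can then be handled in coordinates, without the topology of the
  manifold.\<close>

definition local_smooth ::
  "('p, 'e::euclidean_space) chart \<Rightarrow> ('q, 'f::euclidean_space) chart \<Rightarrow> ('p \<Rightarrow> 'q) \<Rightarrow> 'p \<Rightarrow> bool" where
  "local_smooth c d f p \<longleftrightarrow> p \<in> fst c \<and> f p \<in> fst d \<and>
     (\<exists>W. open W \<and> snd c p \<in> W \<and> W \<subseteq> snd c ` fst c \<and> (\<forall>x\<in>W. f (chart_inv c x) \<in> fst d) \<and>
        smooth_on W (snd d \<circ> f \<circ> chart_inv c))"

definition chart_deriv ::
  "('p, 'e::euclidean_space) chart \<Rightarrow> ('q, 'f::euclidean_space) chart \<Rightarrow> ('p \<Rightarrow> 'q) \<Rightarrow> 'p \<Rightarrow> 'e \<Rightarrow> 'f" where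
  "chart_deriv c d f p = frechet_derivative (snd d \<circ> f \<circ> chart_inv c) (at (snd c p))"

definition prod_chart :: "('p, 'e) chart \<Rightarrow> ('q, 'f) chart \<Rightarrow> ('p \<times> 'q, 'e \<times> 'f) chart" where
  "prod_chart c d = (fst c \<times> fst d, map_prod (snd c) (snd d))"

lemma chart_inv_in:
  assumes "x \<in> snd c ` fst c"
  shows "chart_inv c x \<in> fst c" "snd c (chart_inv c x) = x"
  using assms unfolding chart_inv_def by (auto simp: inv_into_into f_inv_into_f)

lemma chart_inv_left: "good_chart c \<Longrightarrow> p \<in> fst c \<Longrightarrow> chart_inv c (snd c p) = p"
  unfolding chart_inv_def good_chart_def by (simp add: inv_into_f_f)

lemma local_smooth_has_derivative:
  assumes "local_smooth c d f p"
  shows "((snd d \<circ> f \<circ> chart_inv c) has_derivative chart_deriv c d f p) (at (snd c p))"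
  using assms smooth_on_has_derivative unfolding local_smooth_def chart_deriv_def by blast

lemma linear_chart_deriv: "local_smooth c d f p \<Longrightarrow> linear (chart_deriv c d f p)"
  by (rule has_derivative_linear[OF local_smooth_has_derivative])

lemma local_smooth_point: "local_smooth c d f p \<Longrightarrow> p \<in> fst c" "local_smooth c d f p \<Longrightarrow> f p \<in> fst d"
  by (simp_all add: local_smooth_def)

lemma local_smooth_compose:
  fixes c :: "('p, 'a::euclidean_space) chart" and d :: "('q, 'b::euclidean_space) chart"
    and e :: "('r, 'c::euclidean_space) chart"
  assumes f: "local_smooth c d f p" and g: "local_smooth d e g (f p)" and c: "good_chart c" and d: "good_chart d"
  shows "local_smooth c e (\<lambda>x. g (f x)) p"
    and "chart_deriv c e (\<lambda>x. g (f x)) p v = chart_deriv d e g (f p) (chart_deriv c d f p v)"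
proof -
  let ?F = "snd d \<circ> f \<circ> chart_inv c" and ?G = "snd e \<circ> g \<circ> chart_inv d"
  obtain W where W: "open W" "snd c p \<in> W" "W \<subseteq> snd c ` fst c" "\<forall>x\<in>W. f (chart_inv c x) \<in> fst d"
    "smooth_on W ?F" using f unfolding local_smooth_def by blast
  obtain V where V: "open V" "snd d (f p) \<in> V" "V \<subseteq> snd d ` fst d" "\<forall>x\<in>V. g (chart_inv d x) \<in> fst e"
    "smooth_on V ?G" using g unfolding local_smooth_def by blast
  \<comment> \<open>The neighbourhood is shrunk to the points sent into the region where
    \<open>g\<close> is controlled; it stays open since the coordinate expression of
    \<open>f\<close> is continuous.\<close>
  define U where "U = W \<inter> ?F -` V"
  have U: "open U" unfolding U_def
    by (rule continuous_open_preimage[OF smooth_on_continuous[OF W(5)] W(1) V(1)])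
  have Fp: "?F (snd c p) = snd d (f p)"
    using chart_inv_left[OF c local_smooth_point(1)[OF f]] by simp
  have pU: "snd c p \<in> U" using W V Fp by (simp add: U_def)
  have inv: "chart_inv d (?F x) = f (chart_inv c x)" if "x \<in> W" for x
    using chart_inv_left[OF d] W(4) that by simp
  have eq: "?G (?F x) = (snd e \<circ> (\<lambda>x. g (f x)) \<circ> chart_inv c) x" if "x \<in> U" for x
    using inv that by (simp add: U_def)
  have "smooth_on U (\<lambda>x. ?G (?F x))"
    by (rule smooth_on_compose[OF U V(5) smooth_on_subset[OF W(5)]]) (auto simp: U_def)
  then have "smooth_on U (snd e \<circ> (\<lambda>x. g (f x)) \<circ> chart_inv c)"
    by (rule smooth_on_cong[OF U]) (rule eq)
  moreover have "\<forall>x\<in>U. g (f (chart_inv c x)) \<in> fst e"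
    using V(4) inv unfolding U_def by (metis IntE vimageE)
  moreover have "U \<subseteq> snd c ` fst c" using W(3) by (auto simp: U_def)
  ultimately show "local_smooth c e (\<lambda>x. g (f x)) p"
    using U pU local_smooth_point(1)[OF f] local_smooth_point(2)[OF g] unfolding local_smooth_def by blast
  have "((\<lambda>x. ?G (?F x)) has_derivative (\<lambda>v. chart_deriv d e g (f p) (chart_deriv c d f p v))) (at (snd c p))"
    using has_derivative_compose[OF local_smooth_has_derivative[OF f], of ?G]
      local_smooth_has_derivative[OF g] Fp by simp
  then have "((snd e \<circ> (\<lambda>x. g (f x)) \<circ> chart_inv c) has_derivative
      (\<lambda>v. chart_deriv d e g (f p) (chart_deriv c d f p v))) (at (snd c p))"
    by (rule has_derivative_transform_within_open[OF _ U pU]) (rule eq)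
  from frechet_derivative_at[OF this]
  show "chart_deriv c e (\<lambda>x. g (f x)) p v = chart_deriv d e g (f p) (chart_deriv c d f p v)"
    unfolding chart_deriv_def by metis
qed

lemma local_smooth_cong_open:
  assumes f: "local_smooth c d f p" and c: "good_chart c"
    and V: "open V" "snd c p \<in> V" "\<And>q. q \<in> fst c \<Longrightarrow> snd c q \<in> V \<Longrightarrow> f q = g q"
  shows "local_smooth c d g p" "chart_deriv c d f p = chart_deriv c d g p"
proof -
  obtain W where W: "open W" "snd c p \<in> W" "W \<subseteq> snd c ` fst c" "\<forall>x\<in>W. f (chart_inv c x) \<in> fst d"
    "smooth_on W (snd d \<circ> f \<circ> chart_inv c)" using f unfolding local_smooth_def by blast
  have U: "open (W \<inter> V)" "snd c p \<in> W \<inter> V" using W V by auto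
  have fg: "f (chart_inv c x) = g (chart_inv c x)" if "x \<in> W \<inter> V" for x
    using V(3) chart_inv_in[of x c] W(3) that by auto
  then have eq: "(snd d \<circ> f \<circ> chart_inv c) x = (snd d \<circ> g \<circ> chart_inv c) x" if "x \<in> W \<inter> V" for x
    using that by simp
  have "smooth_on (W \<inter> V) (snd d \<circ> g \<circ> chart_inv c)"
    by (rule smooth_on_cong[OF U(1) smooth_on_subset[OF W(5)] eq]) auto
  moreover have "\<forall>x\<in>W \<inter> V. g (chart_inv c x) \<in> fst d" using W(4) fg by auto
  moreover have "g p \<in> fst d"
    using V(2,3) local_smooth_point[OF f] by metis
  ultimately show "local_smooth c d g p"
    using U W(3) local_smooth_point(1)[OF f] unfolding local_smooth_def by blast
  have "((snd d \<circ> g \<circ> chart_inv c) has_derivative chart_deriv c d f p) (at (snd c p))"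
    by (rule has_derivative_transform_within_open[OF local_smooth_has_derivative[OF f] U]) (rule eq)
  from frechet_derivative_at[OF this] show "chart_deriv c d f p = chart_deriv c d g p"
    unfolding chart_deriv_def by metis
qed

lemma local_smooth_cong:
  assumes "local_smooth c d f p" "good_chart c" "\<And>q. q \<in> fst c \<Longrightarrow> f q = g q"
  shows "local_smooth c d g p" "chart_deriv c d f p = chart_deriv c d g p"
  using local_smooth_cong_open[OF assms(1,2), of UNIV g] assms(3) by auto

text \<open>A quotient chart inherits its coordinates from a chart of the group. Hence the
  projection and its local sections read as the identity in matching charts, on the open set
  \<open>W\<close>.\<close>

lemma local_smooth_chart_identity:
  fixes c :: "('p, 'a::euclidean_space) chart" and d :: "('q, 'a) chart"
  assumes c: "good_chart c" and W: "open W" "snd c p \<in> W" "p \<in> fst c"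
    and f: "\<And>q. q \<in> fst c \<Longrightarrow> snd c q \<in> W \<Longrightarrow> f q \<in> fst d \<and> snd d (f q) = snd c q"
  shows "local_smooth c d f p" "chart_deriv c d f p = (\<lambda>v. v)"
proof -
  let ?U = "W \<inter> snd c ` fst c"
  have U: "open ?U" "snd c p \<in> ?U" using W c by (auto simp: good_chart_def)
  have eq: "x = (snd d \<circ> f \<circ> chart_inv c) x" if "x \<in> ?U" for x
    using f[of "chart_inv c x"] chart_inv_in[of x c] that by auto
  have "smooth_on ?U (snd d \<circ> f \<circ> chart_inv c)"
    by (rule smooth_on_cong[OF U(1) smooth_on_linear[OF U(1) bounded_linear_ident] eq])
  moreover have "\<forall>x\<in>?U. f (chart_inv c x) \<in> fst d"
    using f chart_inv_in[of _ c] by auto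
  ultimately show "local_smooth c d f p"
    using U f[OF W(3,2)] W(3) unfolding local_smooth_def by blast
  have "((snd d \<circ> f \<circ> chart_inv c) has_derivative (\<lambda>v. v)) (at (snd c p))"
    by (rule has_derivative_transform_within_open[OF has_derivative_ident U]) (rule eq)
  from frechet_derivative_at[OF this] show "chart_deriv c d f p = (\<lambda>v. v)"
    unfolding chart_deriv_def by metis
qed

lemma local_smooth_id:
  assumes "good_chart c" "p \<in> fst c"
  shows "local_smooth c c (\<lambda>x. x) p" "chart_deriv c c (\<lambda>x. x) p = (\<lambda>v. v)"
  using local_smooth_chart_identity[OF assms(1), of UNIV p "\<lambda>x. x" c] assms(2) by auto

lemma local_smooth_const:
  assumes "good_chart c" "p \<in> fst c" "q \<in> fst d"
  shows "local_smooth c d (\<lambda>x. q) p" "chart_deriv c d (\<lambda>x. q) p = (\<lambda>v. 0)"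
proof -
  have "snd d \<circ> (\<lambda>x. q) \<circ> chart_inv c = (\<lambda>x. snd d q)" by auto
  then show "local_smooth c d (\<lambda>x. q) p" "chart_deriv c d (\<lambda>x. q) p = (\<lambda>v. 0)"
    using assms by (auto simp: local_smooth_def chart_deriv_def good_chart_def frechet_derivative_const
        intro!: exI[of _ "snd c ` fst c"])
qed

lemma good_prod_chart:
  assumes "good_chart c" "good_chart d"
  shows "good_chart (prod_chart c d)"
proof -
  have "map_prod (snd c) (snd d) ` (fst c \<times> fst d) = snd c ` fst c \<times> snd d ` fst d" by force
  then show ?thesis using assms by (auto simp: good_chart_def prod_chart_def map_prod_inj_on open_Times)
qed

lemma prod_chart_simps [simp]:
  "(p, q) \<in> fst (prod_chart c d) \<longleftrightarrow> p \<in> fst c \<and> q \<in> fst d"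
  "snd (prod_chart c d) (p, q) = (snd c p, snd d q)"
  by (simp_all add: prod_chart_def)

lemma image_prod_chart: "snd (prod_chart c d) ` fst (prod_chart c d) = snd c ` fst c \<times> snd d ` fst d"
  by (force simp: prod_chart_def)

lemma chart_inv_prod:
  assumes "good_chart c" "good_chart d" "x \<in> snd c ` fst c" "y \<in> snd d ` fst d"
  shows "chart_inv (prod_chart c d) (x, y) = (chart_inv c x, chart_inv d y)"
  using chart_inv_left[OF good_prod_chart[OF assms(1,2)], of "(chart_inv c x, chart_inv d y)"]
    chart_inv_in[OF assms(3)] chart_inv_in[OF assms(4)] by simp

lemma local_smooth_Pair:
  fixes d :: "('q, 'b::euclidean_space) chart" and d' :: "('r, 'c::euclidean_space) chart"
  assumes f: "local_smooth c d f p" and g: "local_smooth c d' g p"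
  shows "local_smooth c (prod_chart d d') (\<lambda>x. (f x, g x)) p"
    and "chart_deriv c (prod_chart d d') (\<lambda>x. (f x, g x)) p = (\<lambda>v. (chart_deriv c d f p v, chart_deriv c d' g p v))"
proof -
  let ?F = "snd d \<circ> f \<circ> chart_inv c" and ?G = "snd d' \<circ> g \<circ> chart_inv c"
  have eq: "snd (prod_chart d d') \<circ> (\<lambda>x. (f x, g x)) \<circ> chart_inv c = (\<lambda>x. (?F x, ?G x))" by auto
  obtain W where W: "open W" "snd c p \<in> W" "W \<subseteq> snd c ` fst c" "\<forall>x\<in>W. f (chart_inv c x) \<in> fst d"
    "smooth_on W ?F" using f unfolding local_smooth_def by blast
  obtain V where V: "open V" "snd c p \<in> V" "V \<subseteq> snd c ` fst c" "\<forall>x\<in>V. g (chart_inv c x) \<in> fst d'"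
    "smooth_on V ?G" using g unfolding local_smooth_def by blast
  have "open (W \<inter> V)" using W V by blast
  then have "smooth_on (W \<inter> V) (\<lambda>x. (?F x, ?G x))"
    by (rule smooth_on_Pair) (use smooth_on_subset W(5) V(5) in blast)+
  then show "local_smooth c (prod_chart d d') (\<lambda>x. (f x, g x)) p"
    unfolding local_smooth_def eq using W V local_smooth_point[OF f] local_smooth_point[OF g]
    by (intro conjI exI[of _ "W \<inter> V"]) auto
  have "((\<lambda>x. (?F x, ?G x)) has_derivative (\<lambda>v. (chart_deriv c d f p v, chart_deriv c d' g p v))) (at (snd c p))"
    by (rule has_derivative_Pair[OF local_smooth_has_derivative[OF f] local_smooth_has_derivative[OF g]])
  from frechet_derivative_at[OF this]
  show "chart_deriv c (prod_chart d d') (\<lambda>x. (f x, g x)) p = (\<lambda>v. (chart_deriv c d f p v, chart_deriv c d' g p v))"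
    unfolding chart_deriv_def eq by metis
qed

lemma local_smooth_fst:
  fixes c :: "('p, 'a::euclidean_space) chart" and d :: "('q, 'b::euclidean_space) chart"
  assumes c: "good_chart c" and d: "good_chart d" and p: "p \<in> fst c" "q \<in> fst d"
  shows "local_smooth (prod_chart c d) c fst (p, q)" "chart_deriv (prod_chart c d) c fst (p, q) = fst"
proof -
  let ?U = "snd c ` fst c \<times> snd d ` fst d"
  have U: "open ?U" using c d by (simp add: good_chart_def open_Times)
  have eq: "fst z = (snd c \<circ> fst \<circ> chart_inv (prod_chart c d)) z" if "z \<in> ?U" for z
    using that chart_inv_prod[OF c d, of "fst z" "snd z"] chart_inv_in[of "fst z" c] by auto
  have "smooth_on ?U (snd c \<circ> fst \<circ> chart_inv (prod_chart c d))"
    by (rule smooth_on_cong[OF U smooth_on_linear[OF U bounded_linear_fst] eq])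
  moreover have "\<forall>z\<in>?U. fst (chart_inv (prod_chart c d) z) \<in> fst c"
    using chart_inv_prod[OF c d] chart_inv_in[of _ c] by auto
  ultimately show "local_smooth (prod_chart c d) c fst (p, q)"
    unfolding local_smooth_def image_prod_chart using U p by (intro conjI exI[of _ ?U]) auto
  have "((snd c \<circ> fst \<circ> chart_inv (prod_chart c d)) has_derivative fst) (at (snd (prod_chart c d) (p, q)))"
    by (rule has_derivative_transform_within_open[OF bounded_linear_imp_has_derivative[OF bounded_linear_fst] U])
       (use p eq in auto)
  from frechet_derivative_at[OF this] show "chart_deriv (prod_chart c d) c fst (p, q) = fst"
    unfolding chart_deriv_def by metis
qed

lemma local_smooth_snd:
  fixes c :: "('p, 'a::euclidean_space) chart" and d :: "('q, 'b::euclidean_space) chart"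
  assumes c: "good_chart c" and d: "good_chart d" and p: "p \<in> fst c" "q \<in> fst d"
  shows "local_smooth (prod_chart c d) d snd (p, q)" "chart_deriv (prod_chart c d) d snd (p, q) = snd"
proof -
  let ?U = "snd c ` fst c \<times> snd d ` fst d"
  have U: "open ?U" using c d by (simp add: good_chart_def open_Times)
  have eq: "snd z = (snd d \<circ> snd \<circ> chart_inv (prod_chart c d)) z" if "z \<in> ?U" for z
    using that chart_inv_prod[OF c d, of "fst z" "snd z"] chart_inv_in[of "snd z" d] by auto
  have "smooth_on ?U (snd d \<circ> snd \<circ> chart_inv (prod_chart c d))"
    by (rule smooth_on_cong[OF U smooth_on_linear[OF U bounded_linear_snd] eq])
  moreover have "\<forall>z\<in>?U. snd (chart_inv (prod_chart c d) z) \<in> fst d"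
    using chart_inv_prod[OF c d] chart_inv_in[of _ d] by auto
  ultimately show "local_smooth (prod_chart c d) d snd (p, q)"
    unfolding local_smooth_def image_prod_chart using U p by (intro conjI exI[of _ ?U]) auto
  have "((snd d \<circ> snd \<circ> chart_inv (prod_chart c d)) has_derivative snd) (at (snd (prod_chart c d) (p, q)))"
    by (rule has_derivative_transform_within_open[OF bounded_linear_imp_has_derivative[OF bounded_linear_snd] U])
       (use p eq in auto)
  from frechet_derivative_at[OF this] show "chart_deriv (prod_chart c d) d snd (p, q) = snd"
    unfolding chart_deriv_def by metis
qed

lemma smooth_map_local_smooth:
  assumes f: "smooth_map A B f" and cd: "c \<in> A" "d \<in> B" and p: "p \<in> fst c" "f p \<in> fst d" and c: "good_chart c"
  shows "local_smooth c d f p"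
proof -
  let ?W = "snd c ` (fst c \<inter> f -` fst d)"
  have "open ?W" "smooth_on ?W (snd d \<circ> f \<circ> chart_inv c)"
    using f cd unfolding smooth_map_def by blast+
  moreover have "\<forall>x\<in>?W. f (chart_inv c x) \<in> fst d" using chart_inv_left[OF c] by auto
  ultimately show ?thesis unfolding local_smooth_def using p by (intro conjI exI[of _ ?W]) auto
qed

lemma smooth_on_local_smooth:
  assumes c: "good_chart c" and f: "\<And>p. p \<in> fst c \<Longrightarrow> local_smooth c d f p"
  shows "smooth_on (snd c ` fst c) (snd d \<circ> f \<circ> chart_inv c)"
proof (rule smooth_on_locally)
  fix x assume "x \<in> snd c ` fst c"
  then obtain p where "p \<in> fst c" "x = snd c p" by blast
  then show "\<exists>T. open T \<and> x \<in> T \<and> smooth_on T (snd d \<circ> f \<circ> chart_inv c)"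
    using f[of p] unfolding local_smooth_def by blast
qed

text \<open>Smooth dependence on a parameter: the partial derivative in the second variable is the
  total derivative on \<open>(0, v)\<close>, evaluated along the smooth graph of \<open>g\<close>.
  It yields smoothness of the invariant frame and of its inverse.\<close>

lemma smooth_on_chart_deriv:
  fixes c :: "('p, 'a::euclidean_space) chart" and c' :: "('r, 'c::euclidean_space) chart"
    and d :: "('q, 'b::euclidean_space) chart"
  assumes good: "good_chart c" "good_chart c'" "good_chart d"
    and g: "\<And>p. p \<in> fst c \<Longrightarrow> local_smooth c c' g p"
    and F: "\<And>p. p \<in> fst c \<Longrightarrow> local_smooth (prod_chart c c') d F (p, g p)"
  shows "smooth_on (snd c ` fst c)
    (\<lambda>x. chart_deriv c' d (\<lambda>h. F (chart_inv c x, h)) (g (chart_inv c x)) v)"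
proof -
  let ?O = "snd c ` fst c" and ?P = "prod_chart c c'"
  let ?F = "snd d \<circ> F \<circ> chart_inv ?P" and ?g = "snd c' \<circ> g \<circ> chart_inv c"
  have O: "open ?O" using good by (simp add: good_chart_def)
  have P: "good_chart ?P" by (rule good_prod_chart) fact+
  \<comment> \<open>Smoothness is known near each point of the graph separately; the union of all
    open sets on which \<open>?F\<close> is smooth contains the entire graph.\<close>
  define W where "W = \<Union>{W. open W \<and> smooth_on W ?F}"
  have W: "open W" by (auto simp: W_def)
  have sW: "smooth_on W ?F" by (rule smooth_on_locally) (auto simp: W_def)
  have inW: "(x, ?g x) \<in> W" if x: "x \<in> ?O" for x
  proof -
    have "snd ?P (chart_inv c x, g (chart_inv c x)) = (x, ?g x)" using chart_inv_in[OF x] by simp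
    then show ?thesis using F[OF chart_inv_in(1)[OF x]] unfolding local_smooth_def W_def by auto
  qed
  have g': "smooth_on ?O ?g" by (rule smooth_on_local_smooth[OF good(1) g])
  have "smooth_on ?O (\<lambda>x. frechet_derivative ?F (at (x, ?g x)) (0, v))"
    by (rule smooth_on_compose[OF O smooth_on_frechet_derivative[OF sW]
          smooth_on_Pair[OF O smooth_on_linear[OF O bounded_linear_ident] g']]) (use inW in auto)
  then show ?thesis
  proof (rule smooth_on_cong[OF O])
    fix x assume x: "x \<in> ?O"
    let ?p = "chart_inv c x"
    have p: "?p \<in> fst c" "snd c ?p = x" by (rule chart_inv_in[OF x])+
    have gp: "g ?p \<in> fst c'" using g[OF p(1)] by (rule local_smooth_point)
    have pair: "local_smooth c' ?P (\<lambda>h. (?p, h)) (g ?p)"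
      "chart_deriv c' ?P (\<lambda>h. (?p, h)) (g ?p) = (\<lambda>v. (0, v))"
      using local_smooth_Pair[OF local_smooth_const(1)[OF good(2) gp p(1)] local_smooth_id(1)[OF good(2) gp]]
      by (simp_all add: local_smooth_const(2)[OF good(2) gp p(1)] local_smooth_id(2)[OF good(2) gp])
    have "chart_deriv c' d (\<lambda>h. F (?p, h)) (g ?p) v = chart_deriv ?P d F (?p, g ?p) (0, v)"
      using local_smooth_compose(2)[OF pair(1) F[OF p(1)] good(2) P, of v] pair(2) by simp
    then show "frechet_derivative ?F (at (x, ?g x)) (0, v) = chart_deriv c' d (\<lambda>h. F (?p, h)) (g ?p) v"
      by (simp add: chart_deriv_def p(2))
  qed
qed

section \<open>Connections on manifolds with a global frame\<close>

lemma linear_apply_tvec: "linear (\<lambda>V :: 'c \<Rightarrow> 'e::real_vector. V d)"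
  by (rule linearI) simp_all

text \<open>The common interface of the group atlas and the quotient atlas: tangent vectors and
  their components are treated once for both.\<close>

locale smooth_charts =
  fixes N :: "('p, 'e::euclidean_space) chart set"
  assumes good: "d \<in> N \<Longrightarrow> good_chart d"
    and transition: "d \<in> N \<Longrightarrow> d' \<in> N \<Longrightarrow> q \<in> fst d \<Longrightarrow> q \<in> fst d' \<Longrightarrow> local_smooth d d' (\<lambda>x. x) q"
begin

lemma in_points: "d \<in> N \<Longrightarrow> q \<in> fst d \<Longrightarrow> q \<in> points N"
  by (auto simp: points_def)

lemma chart_at: "q \<in> points N \<Longrightarrow> chart_at N q \<in> N \<and> q \<in> fst (chart_at N q)"
  unfolding chart_at_def points_def by (rule someI_ex) auto

lemma open_image: "d \<in> N \<Longrightarrow> open (snd d ` fst d)"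
  using good by (auto simp: good_chart_def)

lemma chart_inv_points: "d \<in> N \<Longrightarrow> x \<in> snd d ` fst d \<Longrightarrow> chart_inv d x \<in> points N"
  by (rule in_points[OF _ chart_inv_in(1)])

lemma transition_deriv:
  "chart_deriv d d' (\<lambda>x. x) q = frechet_derivative (snd d' \<circ> chart_inv d) (at (snd d q))"
  by (simp add: chart_deriv_def comp_def)

lemma tangentD:
  "V \<in> tangent_space N q \<Longrightarrow> c \<in> N \<Longrightarrow> d \<in> N \<Longrightarrow> q \<in> fst c \<Longrightarrow> q \<in> fst d \<Longrightarrow>
    V d = chart_deriv c d (\<lambda>x. x) q (V c)"
  unfolding tangent_space_def transition_deriv by blast

lemma tangent_zero: "V \<in> tangent_space N q \<Longrightarrow> \<not> (c \<in> N \<and> q \<in> fst c) \<Longrightarrow> V c = 0"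
  unfolding tangent_space_def by blast

lemma tangent_eqI:
  assumes "V \<in> tangent_space N q" "V' \<in> tangent_space N q" "d \<in> N" "q \<in> fst d" "V d = V' d"
  shows "V = V'"
proof
  fix c
  show "V c = V' c"
  proof (cases "c \<in> N \<and> q \<in> fst c")
    case True
    then show ?thesis using tangentD[OF assms(1), of d c] tangentD[OF assms(2), of d c] assms(3-5) by simp
  next
    case False
    then show ?thesis using tangent_zero[OF assms(1)] tangent_zero[OF assms(2)] by metis
  qed
qed

lemma tangentI:
  assumes "\<And>c. \<not> (c \<in> N \<and> q \<in> fst c) \<Longrightarrow> V c = 0"
    and "\<And>c d. c \<in> N \<Longrightarrow> d \<in> N \<Longrightarrow> q \<in> fst c \<Longrightarrow> q \<in> fst d \<Longrightarrow> V d = chart_deriv c d (\<lambda>x. x) q (V c)"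
  shows "V \<in> tangent_space N q"
  using assms unfolding tangent_space_def transition_deriv by blast

lemma subspace_tangent_space: "subspace (tangent_space N q)"
proof -
  have lin: "linear (chart_deriv c d (\<lambda>x. x) q)" if "c \<in> N" "d \<in> N" "q \<in> fst c" "q \<in> fst d" for c d
    by (rule linear_chart_deriv[OF transition[OF that]])
  show ?thesis
  proof (rule subspaceI)
    show "0 \<in> tangent_space N q" by (rule tangentI) (simp_all add: linear_0[OF lin])
    fix V W r assume V: "V \<in> tangent_space N q"
    show "r *\<^sub>R V \<in> tangent_space N q"
    proof (rule tangentI)
      fix c d assume cd: "c \<in> N" "d \<in> N" "q \<in> fst c" "q \<in> fst d"
      show "(r *\<^sub>R V) d = chart_deriv c d (\<lambda>x. x) q ((r *\<^sub>R V) c)"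
        using tangentD[OF V cd] by (simp add: linear_cmul[OF lin[OF cd]])
    qed (simp add: tangent_zero[OF V])
    assume W: "W \<in> tangent_space N q"
    show "V + W \<in> tangent_space N q"
    proof (rule tangentI)
      fix c d assume cd: "c \<in> N" "d \<in> N" "q \<in> fst c" "q \<in> fst d"
      show "(V + W) d = chart_deriv c d (\<lambda>x. x) q ((V + W) c)"
        using tangentD[OF V cd] tangentD[OF W cd] by (simp add: linear_add[OF lin[OF cd]])
    qed (simp add: tangent_zero[OF V] tangent_zero[OF W])
  qed
qed

lemma tangent_coord_vector:
  assumes "V \<in> tangent_space N q" "d \<in> N" "q \<in> fst d"
  shows "V = coord_vector N d q (V d)"
proof
  fix c
  show "V c = coord_vector N d q (V d) c"
    using tangentD[OF assms(1,2), of c] tangent_zero[OF assms(1), of c] assms(3)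
    unfolding coord_vector_def transition_deriv by simp
qed

lemma coord_vector_tangent:
  assumes d: "d \<in> N" "q \<in> fst d"
  shows "coord_vector N d q e \<in> tangent_space N q" "coord_vector N d q e d = e"
proof -
  have eq: "coord_vector N d q e c = chart_deriv d c (\<lambda>x. x) q e" if "c \<in> N" "q \<in> fst c" for c
    using that by (simp add: coord_vector_def transition_deriv)
  show "coord_vector N d q e d = e"
    using eq[OF d] local_smooth_id(2)[OF good[OF d(1)] d(2)] by simp
  show "coord_vector N d q e \<in> tangent_space N q"
  proof (rule tangentI)
    show "coord_vector N d q e c = 0" if "\<not> (c \<in> N \<and> q \<in> fst c)" for c
      using that unfolding coord_vector_def by (rule if_not_P)
    fix c c' assume c: "c \<in> N" "c' \<in> N" "q \<in> fst c" "q \<in> fst c'"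
    show "coord_vector N d q e c' = chart_deriv c c' (\<lambda>x. x) q (coord_vector N d q e c)"
      unfolding eq[OF c(1,3)] eq[OF c(2,4)]
      by (rule local_smooth_compose(2)[OF transition[OF d(1) c(1) d(2) c(3)]
            transition[OF c] good[OF d(1)] good[OF c(1)]])
  qed
qed

end

text \<open>The frame is indexed by the model space \<open>'e\<close>, so the frame coordinates at
  all points lie in one Euclidean space, where an ordinary differential equation can be written. The
  coframe is a smooth right inverse in each chart.\<close>

locale framed_manifold = smooth_charts N
  for N :: "('p, 'e::euclidean_space) chart set" +
  fixes frame :: "'e \<Rightarrow> ('p, 'e) vfield"
  assumes frame_field: "frame w \<in> vector_fields N"
    and frame_linear: "q \<in> points N \<Longrightarrow> linear (\<lambda>w. frame w q)"
    and coframe: "d \<in> N \<Longrightarrow> \<exists>\<theta>. (\<forall>b. smooth_on (snd d ` fst d) (\<lambda>x. \<theta> x b)) \<and>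
      (\<forall>x\<in>snd d ` fst d. linear (\<theta> x) \<and> (\<forall>u. frame (\<theta> x u) (chart_inv d x) d = u))"
begin

lemma frame_tangent: "q \<in> points N \<Longrightarrow> frame w q \<in> tangent_space N q"
  using frame_field unfolding vector_fields_def by blast

definition theta :: "('p, 'e) chart \<Rightarrow> 'e \<Rightarrow> 'e \<Rightarrow> 'e" where
  "theta d = (SOME \<theta>. (\<forall>b. smooth_on (snd d ` fst d) (\<lambda>x. \<theta> x b)) \<and>
      (\<forall>x\<in>snd d ` fst d. linear (\<theta> x) \<and> (\<forall>u. frame (\<theta> x u) (chart_inv d x) d = u)))"

lemma theta:
  assumes "d \<in> N"
  shows "smooth_on (snd d ` fst d) (\<lambda>x. theta d x b)"
    and "x \<in> snd d ` fst d \<Longrightarrow> linear (theta d x)"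
    and "x \<in> snd d ` fst d \<Longrightarrow> frame (theta d x u) (chart_inv d x) d = u"
  using someI_ex[OF coframe[OF assms]] unfolding theta_def[symmetric] by blast+

text \<open>The coframe is also a left inverse: a surjective linear endomorphism of a
  finite-dimensional space is injective.\<close>

lemma theta_frame:
  assumes d: "d \<in> N" "q \<in> fst d"
  shows "theta d (snd d q) (frame w q d) = w"
proof -
  let ?f = "\<lambda>w. frame w q d"
  have q: "q \<in> points N" using d by (rule in_points)
  have "linear ?f" using linear_compose[OF frame_linear[OF q] linear_apply_tvec] by (simp add: comp_def)
  moreover have right: "?f (theta d (snd d q) u) = u" for u
    using theta(3)[OF d(1), of "snd d q"] d chart_inv_left[OF good[OF d(1)]] by simp
  then have "surj ?f" by (metis surjI)
  ultimately have "inj ?f" by (rule linear_surjective_imp_injective[OF _ _ refl])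
  then show ?thesis using right by (metis injD)
qed

definition coords :: "'p \<Rightarrow> ('p, 'e) tvec \<Rightarrow> 'e" where
  "coords q V = (let d = chart_at N q in theta d (snd d q) (V d))"

lemma linear_coords:
  assumes "q \<in> points N"
  shows "linear (coords q)"
proof -
  have "linear (theta (chart_at N q) (snd (chart_at N q) q))"
    using theta(2)[of "chart_at N q" "snd (chart_at N q) q"] chart_at[OF assms] by simp
  from linear_compose[OF linear_apply_tvec this] show ?thesis
    unfolding coords_def Let_def by (simp add: comp_def)
qed

lemma coords_frame: "q \<in> points N \<Longrightarrow> coords q (frame w q) = w"
  using theta_frame[of "chart_at N q" q w] chart_at[of q] by (simp add: coords_def)

lemma frame_coords:
  assumes q: "q \<in> points N" and V: "V \<in> tangent_space N q"
  shows "frame (coords q V) q = V"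
proof -
  let ?d = "chart_at N q"
  have d: "?d \<in> N" "q \<in> fst ?d" using chart_at[OF q] by auto
  have "frame (coords q V) q ?d = V ?d"
    using theta(3)[OF d(1), of "snd ?d q" "V ?d"] d chart_inv_left[OF good[OF d(1)] d(2)]
    by (simp add: coords_def Let_def)
  then show ?thesis using tangent_eqI[OF frame_tangent[OF q] V d] by blast
qed

text \<open>Frees \<open>coords\<close> from the chart chosen by \<open>chart_at\<close>, so that
  its smoothness can be checked in any chart.\<close>

lemma coords_chart:
  assumes d: "d \<in> N" "q \<in> fst d" and V: "V \<in> tangent_space N q"
  shows "coords q V = theta d (snd d q) (V d)"
proof -
  have q: "q \<in> points N" using d by (rule in_points)
  show ?thesis using theta_frame[OF d, of "coords q V"] frame_coords[OF q V] by simp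
qed

lemma field_tangent: "X \<in> vector_fields N \<Longrightarrow> q \<in> points N \<Longrightarrow> X q \<in> tangent_space N q"
  by (simp add: vector_fields_def)

lemma field_smooth: "X \<in> vector_fields N \<Longrightarrow> d \<in> N \<Longrightarrow> smooth_on (snd d ` fst d) (\<lambda>x. X (chart_inv d x) d)"
  by (simp add: vector_fields_def)

lemma vector_fields_cong:
  assumes X: "X \<in> vector_fields N" and eq: "\<And>q. q \<in> points N \<Longrightarrow> X q = Y q"
  shows "Y \<in> vector_fields N"
proof -
  have "smooth_on (snd c ` fst c) (\<lambda>x. Y (chart_inv c x) c)" if c: "c \<in> N" for c
    by (rule smooth_on_cong[OF open_image[OF c] field_smooth[OF X c]])
       (simp add: eq[OF chart_inv_points[OF c]])
  then show ?thesis using field_tangent[OF X] eq by (simp add: vector_fields_def)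
qed

lemma vector_fields_add:
  assumes "X \<in> vector_fields N" "Y \<in> vector_fields N"
  shows "(\<lambda>q. X q + Y q) \<in> vector_fields N"
proof -
  have "smooth_on (snd c ` fst c) (\<lambda>x. X (chart_inv c x) c + Y (chart_inv c x) c)" if c: "c \<in> N" for c
    by (rule smooth_on_add[OF open_image[OF c] field_smooth[OF assms(1) c] field_smooth[OF assms(2) c]])
  then show ?thesis
    using field_tangent[OF assms(1)] field_tangent[OF assms(2)] subspace_add[OF subspace_tangent_space]
    by (simp add: vector_fields_def)
qed

lemma vector_fields_scale:
  assumes "smooth_function N f" "X \<in> vector_fields N"
  shows "(\<lambda>q. f q *\<^sub>R X q) \<in> vector_fields N"
proof -
  have "smooth_on (snd c ` fst c) (\<lambda>x. f (chart_inv c x) *\<^sub>R X (chart_inv c x) c)" if c: "c \<in> N" for c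
  proof (rule smooth_on_scaleR[OF open_image[OF c]])
    show "smooth_on (snd c ` fst c) (\<lambda>x. f (chart_inv c x))"
      using assms(1) c by (simp add: smooth_function_def comp_def)
  qed (rule field_smooth[OF assms(2) c])
  then show ?thesis using field_tangent[OF assms(2)] subspace_scale[OF subspace_tangent_space]
    by (simp add: vector_fields_def)
qed

lemma smooth_function_const: "smooth_function N (\<lambda>q. r)"
  by (simp add: smooth_function_def comp_def)

lemma vector_fields_0: "(\<lambda>q. 0) \<in> vector_fields N"
  using vector_fields_scale[OF smooth_function_const[of 0] frame_field] by simp

lemma vector_fields_sum:
  assumes "\<And>i. i \<in> F \<Longrightarrow> X i \<in> vector_fields N"
  shows "(\<lambda>q. \<Sum>i\<in>F. X i q) \<in> vector_fields N"
  using assms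
proof (induction F rule: infinite_finite_induct)
  case (insert i F)
  then have "(\<lambda>q. X i q + (\<Sum>i\<in>F. X i q)) \<in> vector_fields N" by (intro vector_fields_add) auto
  then show ?case by (simp only: sum.insert[OF insert(1,2)])
qed (simp_all add: vector_fields_0)

text \<open>\<open>smooth_endofield\<close> speaks of vectors with constant components in a chart.
  Writing the field in \<open>Basis\<close> reduces the claim to products of smooth
  functions.\<close>

lemma endofield_apply_field:
  assumes P: "smooth_endofield N P" and X: "X \<in> vector_fields N"
  shows "(\<lambda>q. P q (X q)) \<in> vector_fields N"
proof -
  have "smooth_on (snd d ` fst d) (\<lambda>x. P (chart_inv d x) (X (chart_inv d x)) d)" if d: "d \<in> N" for d
  proof (rule smooth_on_cong[OF open_image[OF d]])
    show "smooth_on (snd d ` fst d)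
      (\<lambda>x. \<Sum>b\<in>Basis. (X (chart_inv d x) d \<bullet> b) *\<^sub>R P (chart_inv d x) (coord_vector N d (chart_inv d x) b) d)"
    proof (rule smooth_on_sum[OF open_image[OF d]], rule smooth_on_scaleR[OF open_image[OF d]])
      fix b :: 'e
      show "smooth_on (snd d ` fst d) (\<lambda>x. X (chart_inv d x) d \<bullet> b)"
        by (rule smooth_on_bounded_linear[OF open_image[OF d] bounded_linear_inner_left field_smooth[OF X d]])
      show "smooth_on (snd d ` fst d) (\<lambda>x. P (chart_inv d x) (coord_vector N d (chart_inv d x) b) d)"
        using P d by (simp add: smooth_endofield_def)
    qed
    fix x assume x: "x \<in> snd d ` fst d"
    let ?q = "chart_inv d x"
    have q: "?q \<in> fst d" "?q \<in> points N" using chart_inv_in[OF x] chart_inv_points[OF d x] by auto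
    have Pq: "u \<in> tangent_space N ?q \<Longrightarrow> v \<in> tangent_space N ?q \<Longrightarrow> P ?q (u + v) = P ?q u + P ?q v"
      "u \<in> tangent_space N ?q \<Longrightarrow> P ?q (r *\<^sub>R u) = r *\<^sub>R P ?q u" for u v r
      using P q(2) unfolding smooth_endofield_def linear_map_on_def by blast+
    note T = subspace_tangent_space[of ?q]
    have cv: "coord_vector N d ?q e \<in> tangent_space N ?q" "coord_vector N d ?q e d = e" for e
      by (rule coord_vector_tangent[OF d q(1)])+
    have cv_lin: "linear (coord_vector N d ?q)"
      by (rule linearI; rule tangent_eqI[OF _ _ d q(1)])
         (simp_all add: cv subspace_add[OF T] subspace_scale[OF T])
    have "linear (\<lambda>e. P ?q (coord_vector N d ?q e) d)"
      by (rule linearI) (simp_all add: linear_add[OF cv_lin] linear_cmul[OF cv_lin] Pq cv)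
    from linear_expand_Basis[OF this, of "X ?q d"]
      tangent_coord_vector[OF field_tangent[OF X q(2)] d q(1)]
    show "(\<Sum>b\<in>Basis. (X ?q d \<bullet> b) *\<^sub>R P ?q (coord_vector N d ?q b) d) = P ?q (X ?q) d" by simp
  qed
  moreover have "P q (X q) \<in> tangent_space N q" if "q \<in> points N" for q
    using P field_tangent[OF X that] that unfolding smooth_endofield_def linear_map_on_def by blast
  ultimately show ?thesis by (simp add: vector_fields_def)
qed

lemma field_coords_smooth:
  assumes X: "X \<in> vector_fields N" and d: "d \<in> N"
  shows "smooth_on (snd d ` fst d) (\<lambda>x. coords (chart_inv d x) (X (chart_inv d x)))"
proof (rule smooth_on_cong[OF open_image[OF d]])
  show "smooth_on (snd d ` fst d) (\<lambda>x. \<Sum>b\<in>Basis. (X (chart_inv d x) d \<bullet> b) *\<^sub>R theta d x b)"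
  proof (rule smooth_on_sum[OF open_image[OF d]], rule smooth_on_scaleR[OF open_image[OF d]])
    fix b :: 'e
    show "smooth_on (snd d ` fst d) (\<lambda>x. X (chart_inv d x) d \<bullet> b)"
      by (rule smooth_on_bounded_linear[OF open_image[OF d] bounded_linear_inner_left field_smooth[OF X d]])
  qed (rule theta(1)[OF d])
  fix x assume x: "x \<in> snd d ` fst d"
  show "(\<Sum>b\<in>Basis. (X (chart_inv d x) d \<bullet> b) *\<^sub>R theta d x b) = coords (chart_inv d x) (X (chart_inv d x))"
    using coords_chart[OF d chart_inv_in(1)[OF x] field_tangent[OF X chart_inv_points[OF d x]]]
      linear_expand_Basis[OF theta(2)[OF d x], of "X (chart_inv d x) d"] chart_inv_in(2)[OF x] by simp
qed

text \<open>The derivative of the frame coordinates, that is, the flat connection for which the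
  frame is parallel.\<close>

definition coords_deriv :: "('p, 'e) vfield \<Rightarrow> 'p \<Rightarrow> ('p, 'e) tvec \<Rightarrow> 'e" where
  "coords_deriv X q v = (let c = chart_at N q in
     frechet_derivative (\<lambda>x. coords (chart_inv c x) (X (chart_inv c x))) (at (snd c q)) (v c))"

lemma coords_deriv_frame:
  assumes q: "q \<in> points N"
  shows "coords_deriv (frame w) q v = 0"
proof -
  let ?c = "chart_at N q"
  have c: "?c \<in> N" "q \<in> fst ?c" using chart_at[OF q] by auto
  have "((\<lambda>x. coords (chart_inv ?c x) (frame w (chart_inv ?c x))) has_derivative (\<lambda>v. 0)) (at (snd ?c q))"
    by (rule has_derivative_transform_within_open[OF has_derivative_const[of w] open_image[OF c(1)]])
       (use c coords_frame chart_inv_points[OF c(1)] in auto)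
  from frechet_derivative_at[OF this] show ?thesis unfolding coords_deriv_def Let_def by metis
qed

end

section \<open>Affine connections in frame coordinates\<close>

locale framed_connection = framed_manifold N frame
  for N :: "('p, 'e::euclidean_space) chart set" and frame +
  fixes nabla :: "('p, 'e) connection"
  assumes affine: "affine_connection N nabla"
begin

lemma nabla_endofield: "Y \<in> vector_fields N \<Longrightarrow> smooth_endofield N (nabla Y)"
  using affine by (simp add: affine_connection_def)

lemma nabla_tangent:
  "Y \<in> vector_fields N \<Longrightarrow> q \<in> points N \<Longrightarrow> v \<in> tangent_space N q \<Longrightarrow> nabla Y q v \<in> tangent_space N q"
  using nabla_endofield unfolding smooth_endofield_def linear_map_on_def by blast

lemma nabla_add:
  "Y \<in> vector_fields N \<Longrightarrow> Z \<in> vector_fields N \<Longrightarrow> q \<in> points N \<Longrightarrow> v \<in> tangent_space N q \<Longrightarrow>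
    nabla (\<lambda>q. Y q + Z q) q v = nabla Y q v + nabla Z q v"
  using affine by (simp add: affine_connection_def)

lemma nabla_scale:
  "smooth_function N f \<Longrightarrow> Y \<in> vector_fields N \<Longrightarrow> q \<in> points N \<Longrightarrow> v \<in> tangent_space N q \<Longrightarrow>
    nabla (\<lambda>q. f q *\<^sub>R Y q) q v = dir_deriv N f q v *\<^sub>R Y q + f q *\<^sub>R nabla Y q v"
  using affine by (simp add: affine_connection_def)

text \<open>The values of a vector field outside \<open>points N\<close> are arbitrary. A field vanishing on \<open>points N\<close> is
  multiplied by the function that is \<open>0\<close> on \<open>points N\<close> and \<open>1\<close> elsewhere without being changed.\<close>

lemma nabla_vanishing:
  assumes Z: "Z \<in> vector_fields N" and 0: "\<And>q. q \<in> points N \<Longrightarrow> Z q = 0"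
    and q: "q \<in> points N" and v: "v \<in> tangent_space N q"
  shows "nabla Z q v = 0"
proof -
  define f :: "'p \<Rightarrow> real" where "f q = (if q \<in> points N then 0 else 1)" for q
  have "smooth_on (snd c ` fst c) (f \<circ> chart_inv c)" if c: "c \<in> N" for c
    by (rule smooth_on_cong[OF open_image[OF c] smooth_on_const[of _ 0]])
       (simp add: f_def chart_inv_points[OF c])
  then have f: "smooth_function N f" by (simp add: smooth_function_def)
  have "Z = (\<lambda>q. f q *\<^sub>R Z q)" using 0 by (auto simp: f_def fun_eq_iff)
  then have "nabla Z q v = dir_deriv N f q v *\<^sub>R Z q + f q *\<^sub>R nabla Z q v"
    using nabla_scale[OF f Z q v] by simp
  then show ?thesis using 0[OF q] q by (simp add: f_def)
qed

text \<open>A connection acts on functions of the whole type, so values outside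
  \<open>points N\<close> have to be shown irrelevant: the difference of the two fields vanishes on
  \<open>points N\<close>.\<close>

lemma nabla_cong:
  assumes Y: "Y \<in> vector_fields N" and eq: "\<And>q. q \<in> points N \<Longrightarrow> Y q = Z q"
    and q: "q \<in> points N" and v: "v \<in> tangent_space N q"
  shows "nabla Y q v = nabla Z q v"
proof -
  have Z: "Z \<in> vector_fields N" by (rule vector_fields_cong[OF Y eq])
  have mY: "(\<lambda>q. (-1) *\<^sub>R Y q) \<in> vector_fields N"
    by (rule vector_fields_scale[OF smooth_function_const Y])
  have D: "(\<lambda>q. Z q + (-1) *\<^sub>R Y q) \<in> vector_fields N" by (rule vector_fields_add[OF Z mY])
  have "nabla (\<lambda>q. Y q + (Z q + (-1) *\<^sub>R Y q)) q v = nabla Y q v + nabla (\<lambda>q. Z q + (-1) *\<^sub>R Y q) q v"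
    by (rule nabla_add[OF Y D q v])
  also have "nabla (\<lambda>q. Z q + (-1) *\<^sub>R Y q) q v = 0"
    by (rule nabla_vanishing[OF D _ q v]) (simp add: eq)
  finally show ?thesis by simp
qed

lemma nabla_sum:
  assumes "\<And>i. i \<in> F \<Longrightarrow> X i \<in> vector_fields N" "q \<in> points N" "v \<in> tangent_space N q"
  shows "nabla (\<lambda>q. \<Sum>i\<in>F. X i q) q v = (\<Sum>i\<in>F. nabla (X i) q v)"
  using assms(1)
proof (induction F rule: infinite_finite_induct)
  case (insert i F)
  have "nabla (\<lambda>q. X i q + (\<Sum>i\<in>F. X i q)) q v = nabla (X i) q v + nabla (\<lambda>q. \<Sum>i\<in>F. X i q) q v"
    by (rule nabla_add[OF _ vector_fields_sum assms(2,3)]) (use insert in auto)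
  moreover have "nabla (\<lambda>q. \<Sum>i\<in>F. X i q) q v = (\<Sum>i\<in>F. nabla (X i) q v)"
    using insert by blast
  ultimately show ?case by (simp only: sum.insert[OF insert(1,2)])
qed (simp_all add: nabla_vanishing[OF vector_fields_0 _ assms(2,3)])

text \<open>For fixed \<open>q\<close> this is \<open>T u w\<close>; the first vector argument is
  the direction of differentiation.\<close>

definition christoffel :: "'p \<Rightarrow> 'e \<Rightarrow> 'e \<Rightarrow> 'e" where
  "christoffel q u w = coords q (nabla (frame w) q (frame u q))"

text \<open>The Leibniz rule for the global expansion of \<open>X\<close> in the frame, whose
  coefficients are smooth functions on the whole manifold, so that no cut-off functions are
  needed.\<close>

lemma nabla_expand:
  assumes X: "X \<in> vector_fields N" and q: "q \<in> points N" and v: "v \<in> tangent_space N q"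
  shows "nabla X q v = frame (coords_deriv X q v) q + (\<Sum>b\<in>Basis. (coords q (X q) \<bullet> b) *\<^sub>R nabla (frame b) q v)"
proof -
  let ?c = "chart_at N q"
  have c: "?c \<in> N" "q \<in> fst ?c" using chart_at[OF q] by auto
  define f where "f b q = coords q (X q) \<bullet> b" for b q
  have f: "smooth_function N (f b)" for b
    unfolding smooth_function_def comp_def f_def
    by (intro ballI smooth_on_bounded_linear[OF open_image bounded_linear_inner_left field_coords_smooth[OF X]])
  have df: "dir_deriv N (f b) q v = coords_deriv X q v \<bullet> b" for b
  proof -
    have "((\<lambda>x. coords (chart_inv ?c x) (X (chart_inv ?c x)) \<bullet> b) has_derivative
        (\<lambda>v. frechet_derivative (\<lambda>x. coords (chart_inv ?c x) (X (chart_inv ?c x))) (at (snd ?c q)) v \<bullet> b)) (at (snd ?c q))"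
      by (rule has_derivative_inner_left[OF smooth_on_has_derivative[OF field_coords_smooth[OF X c(1)]]])
         (use c in auto)
    from frechet_derivative_at[OF this, symmetric] show ?thesis
      by (simp add: dir_deriv_def coords_deriv_def Let_def f_def comp_def)
  qed
  have fb: "(\<lambda>q. f b q *\<^sub>R frame b q) \<in> vector_fields N" for b
    by (rule vector_fields_scale[OF f frame_field])
  have eq: "X r = (\<Sum>b\<in>Basis. f b r *\<^sub>R frame b r)" if r: "r \<in> points N" for r
    using linear_expand_Basis[OF frame_linear[OF r], of "coords r (X r)"]
      frame_coords[OF r field_tangent[OF X r]] by (simp add: f_def)
  have "nabla X q v = nabla (\<lambda>q. \<Sum>b\<in>Basis. f b q *\<^sub>R frame b q) q v"
    by (rule nabla_cong[OF X eq q v])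
  also have "\<dots> = (\<Sum>b\<in>Basis. nabla (\<lambda>q. f b q *\<^sub>R frame b q) q v)"
    by (rule nabla_sum[OF fb q v])
  also have "\<dots> = (\<Sum>b\<in>Basis. (coords_deriv X q v \<bullet> b) *\<^sub>R frame b q + (coords q (X q) \<bullet> b) *\<^sub>R nabla (frame b) q v)"
    by (simp add: nabla_scale[OF f frame_field q v] df) (simp add: f_def)
  also have "\<dots> = frame (coords_deriv X q v) q + (\<Sum>b\<in>Basis. (coords q (X q) \<bullet> b) *\<^sub>R nabla (frame b) q v)"
    using linear_expand_Basis[OF frame_linear[OF q], of "coords_deriv X q v"] by (simp add: sum.distrib)
  finally show ?thesis .
qed

lemma nabla_frame:
  assumes q: "q \<in> points N" and v: "v \<in> tangent_space N q"
  shows "nabla (frame w) q v = frame (christoffel q (coords q v) w) q"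
  using frame_coords[OF q nabla_tangent[OF frame_field q v]]
  by (simp add: christoffel_def frame_coords[OF q v])

text \<open>Linearity in \<open>w\<close> follows from the Leibniz expansion, since the frame
  coordinates of \<open>frame w\<close> are constant. Linearity in \<open>u\<close> is part of the
  connection being an endomorphism field.\<close>

lemma linear_christoffel:
  assumes q: "q \<in> points N"
  shows "linear (christoffel q u)" "linear (\<lambda>u. christoffel q u w)"
proof -
  have v: "frame u q \<in> tangent_space N q" for u by (rule frame_tangent[OF q])
  have "nabla (frame w) q (frame u q) = (\<Sum>b\<in>Basis. (w \<bullet> b) *\<^sub>R nabla (frame b) q (frame u q))" for w
    using nabla_expand[OF frame_field q v, of w u]
    by (simp add: coords_deriv_frame[OF q] coords_frame[OF q] linear_0[OF frame_linear[OF q]])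
  then have "coords q (nabla (frame w) q (frame u q))
      = coords q (\<Sum>b\<in>Basis. (w \<bullet> b) *\<^sub>R nabla (frame b) q (frame u q))" for w
    by (rule arg_cong)
  then have "christoffel q u w = (\<Sum>b\<in>Basis. (w \<bullet> b) *\<^sub>R christoffel q u b)" for w
    unfolding christoffel_def linear_sum[OF linear_coords[OF q]] linear_cmul[OF linear_coords[OF q]] .
  then have "christoffel q u = (\<lambda>w. \<Sum>b\<in>Basis. (w \<bullet> b) *\<^sub>R christoffel q u b)" by (rule ext)
  moreover have "linear (\<lambda>w. \<Sum>b\<in>Basis. (w \<bullet> b) *\<^sub>R christoffel q u b)"
    by (rule linearI) (simp_all add: inner_add_left scaleR_add_left sum.distrib scaleR_sum_right)
  ultimately show "linear (christoffel q u)" by simp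
  have "linear_map_on (tangent_space N q) (tangent_space N q) (nabla (frame w) q)"
    using nabla_endofield[OF frame_field] q by (simp add: smooth_endofield_def)
  then show "linear (\<lambda>u. christoffel q u w)"
    unfolding christoffel_def linear_map_on_def using v
    by (intro linearI) (simp_all add: linear_add[OF frame_linear[OF q]] linear_cmul[OF frame_linear[OF q]]
        linear_add[OF linear_coords[OF q]] linear_cmul[OF linear_coords[OF q]])
qed

lemma nabla_christoffel:
  assumes X: "X \<in> vector_fields N" and q: "q \<in> points N" and v: "v \<in> tangent_space N q"
  shows "nabla X q v = frame (coords_deriv X q v + christoffel q (coords q v) (coords q (X q))) q"
proof -
  have "(\<Sum>b\<in>Basis. (coords q (X q) \<bullet> b) *\<^sub>R nabla (frame b) q v)
      = frame (\<Sum>b\<in>Basis. (coords q (X q) \<bullet> b) *\<^sub>R christoffel q (coords q v) b) q"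
    by (simp add: nabla_frame[OF q v] linear_sum[OF frame_linear[OF q]] linear_cmul[OF frame_linear[OF q]])
  also have "(\<Sum>b\<in>Basis. (coords q (X q) \<bullet> b) *\<^sub>R christoffel q (coords q v) b)
      = christoffel q (coords q v) (coords q (X q))"
    by (rule linear_expand_Basis[OF linear_christoffel(1)[OF q], symmetric])
  finally show ?thesis
    by (simp only: nabla_expand[OF X q v] linear_add[OF frame_linear[OF q]])
qed

lemma christoffel_smooth:
  assumes d: "d \<in> N"
  shows "smooth_on (snd d ` fst d) (\<lambda>x. christoffel (chart_inv d x) u w)"
  unfolding christoffel_def
  by (rule field_coords_smooth[OF endofield_apply_field[OF nabla_endofield[OF frame_field] frame_field] d])

end

section \<open>Parallel transport in a global frame\<close>

context framed_connection
begin

text \<open>The extension of the curve beyond the closed interval gives a function \<open>f\<close>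
  smooth on an open set, so velocities at the end points are ordinary derivatives of
  \<open>f\<close>.\<close>

lemma smooth_curve_chart:
  assumes \<gamma>: "smooth_curve_on N a b \<gamma>" and t: "t \<in> {a..b}" and d: "d \<in> N" "\<gamma> t \<in> fst d"
  obtains S f where "open S" "t \<in> S" "smooth_on S f"
    "\<And>s. s \<in> S \<Longrightarrow> s \<in> {a..b} \<Longrightarrow> \<gamma> s \<in> fst d \<and> snd d (\<gamma> s) = f s"
proof -
  obtain \<epsilon> \<gamma>' where \<epsilon>: "\<epsilon> > 0" and \<gamma>': "smooth_map {({a - \<epsilon><..<b + \<epsilon>}, \<lambda>t. t)} N \<gamma>'"
    and eq: "\<forall>t\<in>{a..b}. \<gamma>' t = \<gamma> t" using \<gamma> unfolding smooth_curve_on_def by blast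
  define c :: "(real, real) chart" where "c = ({a - \<epsilon><..<b + \<epsilon>}, \<lambda>t. t)"
  have c: "good_chart c" by (simp add: good_chart_def c_def)
  have inv: "chart_inv c s = s" if "s \<in> fst c" for s
    using chart_inv_left[OF c that] by (simp add: c_def)
  define S where "S = fst c \<inter> \<gamma>' -` fst d"
  have img: "snd c ` (fst c \<inter> \<gamma>' -` fst d) = S" by (auto simp: S_def c_def)
  have S: "open S" "smooth_on S (snd d \<circ> \<gamma>' \<circ> chart_inv c)"
    using \<gamma>' d(1) unfolding smooth_map_def c_def[symmetric] img[symmetric] by blast+
  have "smooth_on S (snd d \<circ> \<gamma>')"
    by (rule smooth_on_cong[OF S]) (simp add: S_def inv)
  moreover have "t \<in> S" using t \<epsilon> d(2) eq by (auto simp: S_def c_def)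
  ultimately show thesis
    using that[of S "snd d \<circ> \<gamma>'"] S(1) eq by (auto simp: S_def)
qed

lemma smooth_curve_points:
  assumes "smooth_curve_on N a b \<gamma>" "t \<in> {a..b}"
  shows "\<gamma> t \<in> points N"
proof -
  obtain \<epsilon> \<gamma>' where "\<epsilon> > 0" "smooth_map {({a - \<epsilon><..<b + \<epsilon>}, \<lambda>t. t)} N \<gamma>'"
    and eq: "\<forall>t\<in>{a..b}. \<gamma>' t = \<gamma> t" using assms(1) unfolding smooth_curve_on_def by blast
  then have "\<gamma>' \<in> {a - \<epsilon><..<b + \<epsilon>} \<rightarrow> points N"
    unfolding smooth_map_def by (simp add: points_def)
  moreover have "t \<in> {a - \<epsilon><..<b + \<epsilon>}" using assms(2) \<open>\<epsilon> > 0\<close> by auto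
  ultimately show ?thesis using eq assms(2) by (metis Pi_mem)
qed

lemma velocity_has_derivative:
  assumes \<gamma>: "smooth_curve_on N a b \<gamma>" and ab: "a < b" and t: "t \<in> {a..b}" and d: "d \<in> N" "\<gamma> t \<in> fst d"
    and S: "open S" "t \<in> S" "smooth_on S f"
      "\<And>s. s \<in> S \<Longrightarrow> s \<in> {a..b} \<Longrightarrow> snd d (\<gamma> s) = f s"
  shows "((snd d \<circ> \<gamma>) has_vector_derivative frechet_derivative f (at t) 1) (at t within {a..b})"
    "velocity N \<gamma> {a..b} t d = frechet_derivative f (at t) 1"
proof -
  obtain e where e: "e > 0" "ball t e \<subseteq> S" using S(1,2) open_contains_ball by blast
  have lin: "linear (frechet_derivative f (at t))" by (rule smooth_on_linear_derivative[OF S(3,2)])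
  have eq: "frechet_derivative f (at t) = (\<lambda>h. h *\<^sub>R frechet_derivative f (at t) 1)"
  proof
    show "frechet_derivative f (at t) h = h *\<^sub>R frechet_derivative f (at t) 1" for h
      using linear_cmul[OF lin, of h 1] by simp
  qed
  have "(f has_derivative (\<lambda>h. h *\<^sub>R frechet_derivative f (at t) 1)) (at t)"
    by (rule has_derivative_eq_rhs[OF smooth_on_has_derivative[OF S(3,2)] eq])
  then have "(f has_vector_derivative frechet_derivative f (at t) 1) (at t within {a..b})"
    by (simp add: has_vector_derivative_def has_derivative_at_withinI)
  then show D: "((snd d \<circ> \<gamma>) has_vector_derivative frechet_derivative f (at t) 1) (at t within {a..b})"
    by (rule has_vector_derivative_transform_within[OF _ e(1) t])
       (use S(4) e(2) in \<open>force simp: dist_commute\<close>)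
  have "vector_derivative (snd d \<circ> \<gamma>) (at t within {a..b}) = frechet_derivative f (at t) 1"
    using vector_derivative_within_cbox[of a b t "snd d \<circ> \<gamma>"] ab t D by simp
  then show "velocity N \<gamma> {a..b} t d = frechet_derivative f (at t) 1"
    using d by (simp add: velocity_def)
qed

lemma velocity_vector_derivative:
  assumes \<gamma>: "smooth_curve_on N a b \<gamma>" and ab: "a < b" and t: "t \<in> {a..b}" and d: "d \<in> N" "\<gamma> t \<in> fst d"
  shows "((snd d \<circ> \<gamma>) has_vector_derivative velocity N \<gamma> {a..b} t d) (at t within {a..b})"
proof -
  obtain S f where S: "open S" "t \<in> S" "smooth_on S f"
    "\<And>s. s \<in> S \<Longrightarrow> s \<in> {a..b} \<Longrightarrow> \<gamma> s \<in> fst d \<and> snd d (\<gamma> s) = f s"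
    using smooth_curve_chart[OF \<gamma> t d] by blast
  have "\<And>s. s \<in> S \<Longrightarrow> s \<in> {a..b} \<Longrightarrow> snd d (\<gamma> s) = f s" using S(4) by blast
  from velocity_has_derivative[OF \<gamma> ab t d S(1-3) this] show ?thesis by simp
qed

lemma curve_near_chart:
  assumes \<gamma>: "smooth_curve_on N a b \<gamma>" and t: "t \<in> {a..b}" and d: "d \<in> N" "\<gamma> t \<in> fst d"
  obtains e where "e > 0" "\<And>s. s \<in> {a..b} \<Longrightarrow> dist s t < e \<Longrightarrow> \<gamma> s \<in> fst d"
proof -
  obtain S f where S: "open S" "t \<in> S" "smooth_on S (f :: real \<Rightarrow> 'e)"
    "\<And>s. s \<in> S \<Longrightarrow> s \<in> {a..b} \<Longrightarrow> \<gamma> s \<in> fst d \<and> snd d (\<gamma> s) = f s"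
    using smooth_curve_chart[OF \<gamma> t d] by blast
  obtain e where "e > 0" "ball t e \<subseteq> S" using S(1,2) open_contains_ball by blast
  then show thesis using that[of e] S(4) by (auto simp: dist_commute subset_iff)
qed

text \<open>The set \<open>U\<close> localizes the comparison of \<open>K\<close> with
  \<open>H\<close>: for a change of charts it is the domain of the second chart, which the curve
  stays in only for a short time.\<close>

lemma curve_chain_rule:
  fixes H :: "'e \<Rightarrow> 'c::real_normed_vector"
  assumes \<gamma>: "smooth_curve_on N a b \<gamma>" and ab: "a < b" and t: "t \<in> {a..b}" and d: "d \<in> N" "\<gamma> t \<in> fst d"
    and H: "(H has_derivative H') (at (snd d (\<gamma> t)))"
    and K: "\<And>q. q \<in> fst d \<Longrightarrow> q \<in> U \<Longrightarrow> K q = H (snd d q)"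
    and e: "e > 0" "\<And>s. s \<in> {a..b} \<Longrightarrow> dist s t < e \<Longrightarrow> \<gamma> s \<in> U"
  shows "((\<lambda>s. K (\<gamma> s)) has_vector_derivative H' (velocity N \<gamma> {a..b} t d)) (at t within {a..b})"
proof -
  obtain e' where e': "e' > 0" "\<And>s. s \<in> {a..b} \<Longrightarrow> dist s t < e' \<Longrightarrow> \<gamma> s \<in> fst d"
    using curve_near_chart[OF \<gamma> t d] by blast
  have "((snd d \<circ> \<gamma>) has_derivative (\<lambda>h. h *\<^sub>R velocity N \<gamma> {a..b} t d)) (at t within {a..b})"
    using velocity_vector_derivative[OF \<gamma> ab t d] by (simp add: has_vector_derivative_def)
  from has_derivative_compose[OF this, of H H']
  have "((\<lambda>s. H (snd d (\<gamma> s))) has_derivative (\<lambda>h. H' (h *\<^sub>R velocity N \<gamma> {a..b} t d))) (at t within {a..b})"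
    using H by simp
  then have "((\<lambda>s. H (snd d (\<gamma> s))) has_vector_derivative H' (velocity N \<gamma> {a..b} t d)) (at t within {a..b})"
    by (simp add: has_vector_derivative_def linear_cmul[OF has_derivative_linear[OF H]])
  then show ?thesis
    by (rule has_vector_derivative_transform_within[where d = "min e e'"])
       (use e e' t K in \<open>auto simp: min_def split: if_splits\<close>)
qed

lemma velocity_tangent:
  assumes \<gamma>: "smooth_curve_on N a b \<gamma>" and ab: "a < b" and t: "t \<in> {a..b}"
  shows "velocity N \<gamma> {a..b} t \<in> tangent_space N (\<gamma> t)"
proof (rule tangentI)
  show "velocity N \<gamma> {a..b} t c = 0" if "\<not> (c \<in> N \<and> \<gamma> t \<in> fst c)" for c
    using that unfolding velocity_def by (rule if_not_P)
  fix c d assume cd: "c \<in> N" "d \<in> N" "\<gamma> t \<in> fst c" "\<gamma> t \<in> fst d"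
  have "((snd d \<circ> chart_inv c) has_derivative chart_deriv c d (\<lambda>x. x) (\<gamma> t)) (at (snd c (\<gamma> t)))"
    using local_smooth_has_derivative[OF transition[OF cd]] by (simp add: comp_def)
  moreover obtain e where "e > 0" "\<And>s. s \<in> {a..b} \<Longrightarrow> dist s t < e \<Longrightarrow> \<gamma> s \<in> fst d"
    using curve_near_chart[OF \<gamma> t cd(2,4)] by blast
  ultimately have "((\<lambda>s. snd d (\<gamma> s)) has_vector_derivative
      chart_deriv c d (\<lambda>x. x) (\<gamma> t) (velocity N \<gamma> {a..b} t c)) (at t within {a..b})"
    using chart_inv_left[OF good[OF cd(1)]]
    by (intro curve_chain_rule[OF \<gamma> ab t cd(1,3), where H = "snd d \<circ> chart_inv c" and U = "fst d"]) auto
  moreover have "((\<lambda>s. snd d (\<gamma> s)) has_vector_derivative velocity N \<gamma> {a..b} t d) (at t within {a..b})"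
    using velocity_vector_derivative[OF \<gamma> ab t cd(2,4)] by (simp add: comp_def)
  ultimately show "velocity N \<gamma> {a..b} t d = chart_deriv c d (\<lambda>x. x) (\<gamma> t) (velocity N \<gamma> {a..b} t c)"
    using vector_derivative_within_cbox[OF ab] t by (metis box_real(2))
qed

lemma coords_along_curve:
  assumes \<gamma>: "smooth_curve_on N a b \<gamma>" and ab: "a < b" and t: "t \<in> {a..b}" and X: "X \<in> vector_fields N"
  shows "((\<lambda>s. coords (\<gamma> s) (X (\<gamma> s))) has_vector_derivative
    coords_deriv X (\<gamma> t) (velocity N \<gamma> {a..b} t)) (at t within {a..b})"
proof -
  let ?c = "chart_at N (\<gamma> t)"
  let ?H = "\<lambda>x. coords (chart_inv ?c x) (X (chart_inv ?c x))"
  have c: "?c \<in> N" "\<gamma> t \<in> fst ?c" using chart_at[OF smooth_curve_points[OF \<gamma> t]] by auto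
  have "(?H has_derivative frechet_derivative ?H (at (snd ?c (\<gamma> t)))) (at (snd ?c (\<gamma> t)))"
    by (rule smooth_on_has_derivative[OF field_coords_smooth[OF X c(1)]]) (use c in auto)
  from curve_chain_rule[OF \<gamma> ab t c this, of UNIV "\<lambda>q. coords q (X q)" 1]
  show ?thesis unfolding coords_deriv_def Let_def
    by (simp add: chart_inv_left[OF good[OF c(1)]])
qed

text \<open>In frame coordinates a parallel field \<open>x\<close> along the curve satisfies
  \<open>x' = - transport_coeff x\<close>. The interval \<open>T\<close> is an argument because the
  velocity is taken within it.\<close>

definition transport_coeff :: "(real \<Rightarrow> 'p) \<Rightarrow> real set \<Rightarrow> real \<Rightarrow> 'e \<Rightarrow> 'e" where
  "transport_coeff \<gamma> T s = christoffel (\<gamma> s) (coords (\<gamma> s) (velocity N \<gamma> T s))"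

text \<open>Applying \<open>coords\<close> to the covariant derivative of
  \<open>\<Sum>i. r i E i\<close> turns each term into the derivative of its coordinates plus the
  coefficient applied to them. The sum depends only on \<open>coords\<close> of \<open>V\<close>, so
  the chosen representation drops out.\<close>

lemma parallel_equation:
  assumes \<gamma>: "smooth_curve_on N a b \<gamma>" and ab: "a < b" and t: "t \<in> {a..b}"
    and cov: "has_cov_deriv_along N nabla \<gamma> {a..b} V 0 t"
  shows "((\<lambda>s. coords (\<gamma> s) (V s)) has_vector_derivative
    - transport_coeff \<gamma> {a..b} t (coords (\<gamma> t) (V t))) (at t within {a..b})"
proof -
  let ?q = "\<gamma> t" and ?v = "velocity N \<gamma> {a..b} t"
  have q: "\<gamma> s \<in> points N" if "s \<in> {a..b}" for s by (rule smooth_curve_points[OF \<gamma> that])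
  note lc = linear_coords[OF q] and qt = q[OF t] and v = velocity_tangent[OF \<gamma> ab t]
  obtain m E r r' where E: "\<And>i. i < (m::nat) \<Longrightarrow> E i \<in> vector_fields N"
    and r: "\<And>i. i < m \<Longrightarrow> (r i has_real_derivative r' i) (at t within {a..b})"
    and V: "\<exists>\<delta>>0. \<forall>s\<in>{a..b}. \<bar>s - t\<bar> < \<delta> \<longrightarrow> V s = (\<Sum>i<m. r i s *\<^sub>R E i (\<gamma> s))"
    and W: "0 = (\<Sum>i<m. r' i *\<^sub>R E i ?q + r i t *\<^sub>R nabla (E i) ?q ?v)"
    using cov unfolding has_cov_deriv_along_def by blast
  obtain \<delta> where \<delta>: "\<delta> > 0" "\<And>s. s \<in> {a..b} \<Longrightarrow> \<bar>s - t\<bar> < \<delta> \<Longrightarrow> V s = (\<Sum>i<m. r i s *\<^sub>R E i (\<gamma> s))"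
    using V by blast
  define k where "k i s = coords (\<gamma> s) (E i (\<gamma> s))" for i s
  define k' where "k' i = coords_deriv (E i) ?q ?v" for i
  define \<Gamma> where "\<Gamma> = transport_coeff \<gamma> {a..b} t"
  have \<Gamma>_lin: "linear \<Gamma>" unfolding \<Gamma>_def transport_coeff_def by (rule linear_christoffel(1)[OF qt])
  have V_coords: "coords (\<gamma> s) (V s) = (\<Sum>i<m. r i s *\<^sub>R k i s)" if "s \<in> {a..b}" "\<bar>s - t\<bar> < \<delta>" for s
    unfolding \<delta>(2)[OF that] k_def linear_sum[OF lc[OF that(1)]] linear_cmul[OF lc[OF that(1)]] ..
  have "((\<lambda>s. \<Sum>i<m. r i s *\<^sub>R k i s) has_vector_derivative (\<Sum>i<m. r i t *\<^sub>R k' i + r' i *\<^sub>R k i t))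
      (at t within {a..b})"
  proof (rule has_vector_derivative_sum, rule has_vector_derivative_scaleR)
    fix i assume "i \<in> {..<m}"
    then show "(r i has_real_derivative r' i) (at t within {a..b})"
      and "(k i has_vector_derivative k' i) (at t within {a..b})"
      using r coords_along_curve[OF \<gamma> ab t E] unfolding k_def k'_def by auto
  qed
  then have D: "((\<lambda>s. coords (\<gamma> s) (V s)) has_vector_derivative (\<Sum>i<m. r i t *\<^sub>R k' i + r' i *\<^sub>R k i t))
      (at t within {a..b})"
    by (rule has_vector_derivative_transform_within[OF _ \<delta>(1) t])
       (use V_coords in \<open>simp add: dist_real_def\<close>)
  have "coords ?q (r' i *\<^sub>R E i ?q + r i t *\<^sub>R nabla (E i) ?q ?v) = r' i *\<^sub>R k i t + r i t *\<^sub>R (k' i + \<Gamma> (k i t))"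
    if "i < m" for i
    unfolding nabla_christoffel[OF E[OF that] qt v] linear_add[OF lc[OF t]] linear_cmul[OF lc[OF t]]
      coords_frame[OF qt] k_def k'_def \<Gamma>_def transport_coeff_def ..
  then have "coords ?q (\<Sum>i<m. r' i *\<^sub>R E i ?q + r i t *\<^sub>R nabla (E i) ?q ?v)
      = (\<Sum>i<m. r' i *\<^sub>R k i t + r i t *\<^sub>R (k' i + \<Gamma> (k i t)))"
    unfolding linear_sum[OF lc[OF t]] by (intro sum.cong) auto
  also have "\<dots> = (\<Sum>i<m. r i t *\<^sub>R k' i + r' i *\<^sub>R k i t) + \<Gamma> (\<Sum>i<m. r i t *\<^sub>R k i t)"
    by (simp add: linear_sum[OF \<Gamma>_lin] linear_cmul[OF \<Gamma>_lin] sum.distrib scaleR_add_right)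
  also have "(\<Sum>i<m. r i t *\<^sub>R k i t) = coords ?q (V t)"
    using V_coords[OF t] \<delta>(1) by simp
  finally have "0 = (\<Sum>i<m. r i t *\<^sub>R k' i + r' i *\<^sub>R k i t) + \<Gamma> (coords ?q (V t))"
    unfolding W[symmetric] linear_0[OF lc[OF t]] .
  then have "(\<Sum>i<m. r i t *\<^sub>R k' i + r' i *\<^sub>R k i t) = - \<Gamma> (coords ?q (V t))"
    by (simp add: eq_neg_iff_add_eq_0)
  then show ?thesis using D by (simp add: \<Gamma>_def)
qed

text \<open>In a chart around the point the curve, its velocity, the coframe and the Christoffel
  coefficients are all continuous in the time; this suffices since continuity is local.\<close>

lemma transport_coeff_continuous:
  assumes \<gamma>: "smooth_curve_on N a b \<gamma>" and ab: "a < b"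
  shows "continuous_on {a..b} (\<lambda>s. transport_coeff \<gamma> {a..b} s w)"
  unfolding continuous_on_eq_continuous_within
proof
  fix t assume t: "t \<in> {a..b}"
  let ?d = "chart_at N (\<gamma> t)"
  have d: "?d \<in> N" "\<gamma> t \<in> fst ?d" using chart_at[OF smooth_curve_points[OF \<gamma> t]] by auto
  obtain S f where S: "open S" "t \<in> S" "smooth_on S f"
    "\<And>s. s \<in> S \<Longrightarrow> s \<in> {a..b} \<Longrightarrow> \<gamma> s \<in> fst ?d \<and> snd ?d (\<gamma> s) = f s"
    using smooth_curve_chart[OF \<gamma> t d] by blast
  let ?T = "S \<inter> {a..b}" and ?O = "snd ?d ` fst ?d"
  have f_im: "f ` ?T \<subseteq> ?O" using S(4) by force
  have f: "continuous_on ?T f" using smooth_on_continuous[OF S(3)] continuous_on_subset by blast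
  have f': "continuous_on ?T (\<lambda>s. frechet_derivative f (at s) 1)"
    using smooth_on_continuous[OF smooth_on_frechet_derivative[OF S(3)]] continuous_on_subset by blast
  \<comment> \<open>The frame coordinates of the velocity. Expanding in \<open>Basis\<close>, here
    and in the sum below, reduces joint continuity to continuity with fixed basis vectors.\<close>
  define U where "U s = (\<Sum>b\<in>Basis. (frechet_derivative f (at s) 1 \<bullet> b) *\<^sub>R theta ?d (f s) b)" for s
  have theta_cont: "continuous_on ?T (\<lambda>s. theta ?d (f s) b)" for b
    by (rule continuous_on_compose2[OF smooth_on_continuous[OF theta(1)[OF d(1)]] f f_im])
  have U: "continuous_on ?T U" unfolding U_def by (intro continuous_intros f' theta_cont)
  have chr: "continuous_on ?T (\<lambda>s. christoffel (chart_inv ?d (f s)) b w)" for b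
    by (rule continuous_on_compose2[OF smooth_on_continuous[OF christoffel_smooth[OF d(1)]] f f_im])
  have "continuous_on ?T (\<lambda>s. \<Sum>b\<in>Basis. (U s \<bullet> b) *\<^sub>R christoffel (chart_inv ?d (f s)) b w)"
    by (intro continuous_intros U chr)
  moreover have "(\<Sum>b\<in>Basis. (U s \<bullet> b) *\<^sub>R christoffel (chart_inv ?d (f s)) b w) = transport_coeff \<gamma> {a..b} s w"
    if s: "s \<in> ?T" for s
  proof -
    have s': "s \<in> S" "s \<in> {a..b}" using s by auto
    have sd: "\<gamma> s \<in> fst ?d" "snd ?d (\<gamma> s) = f s" using S(4)[OF s'] by auto
    have inv: "chart_inv ?d (f s) = \<gamma> s" using chart_inv_left[OF good[OF d(1)] sd(1)] sd(2) by simp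
    have "f s \<in> ?O" using sd by force
    then have "U s = theta ?d (f s) (frechet_derivative f (at s) 1)"
      unfolding U_def by (intro linear_expand_Basis[OF theta(2)[OF d(1)], symmetric])
    also have "frechet_derivative f (at s) 1 = velocity N \<gamma> {a..b} s ?d"
      using velocity_has_derivative(2)[OF \<gamma> ab s'(2) d(1) sd(1) S(1) s'(1) S(3)] S(4) by simp
    also have "theta ?d (f s) \<dots> = coords (\<gamma> s) (velocity N \<gamma> {a..b} s)"
      using coords_chart[OF d(1) sd(1) velocity_tangent[OF \<gamma> ab s'(2)]] sd(2) by simp
    finally show ?thesis
      unfolding inv transport_coeff_def
      using linear_expand_Basis[OF linear_christoffel(2)[OF smooth_curve_points[OF \<gamma> s'(2)]], of "U s" w] by simp
  qed
  ultimately have "continuous_on ?T (\<lambda>s. transport_coeff \<gamma> {a..b} s w)"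
    by (rule continuous_on_eq)
  then have "continuous (at t within ?T) (\<lambda>s. transport_coeff \<gamma> {a..b} s w)"
    using S(2) t by (simp add: continuous_on_eq_continuous_within)
  moreover have "at t within ?T = at t within {a..b}"
    by (rule at_within_nhd[OF S(2,1)]) auto
  ultimately show "continuous (at t within {a..b}) (\<lambda>s. transport_coeff \<gamma> {a..b} s w)" by simp
qed

lemma transport_coeff_linear:
  assumes "smooth_curve_on N a b \<gamma>" "s \<in> {a..b}"
  shows "linear (transport_coeff \<gamma> T s)"
  unfolding transport_coeff_def by (rule linear_christoffel(1)[OF smooth_curve_points[OF assms]])

text \<open>Compactness bounds the images of the finitely many basis vectors, linearity does the
  rest. The result is the constant for Gronwall's argument.\<close>

lemma transport_coeff_bounded:
  assumes \<gamma>: "smooth_curve_on N a b \<gamma>" and ab: "a < b"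
  shows "\<exists>C. \<forall>s\<in>{a..b}. \<forall>w. norm (transport_coeff \<gamma> {a..b} s w) \<le> C * norm w"
proof -
  have "\<exists>B. \<forall>s\<in>{a..b}. norm (transport_coeff \<gamma> {a..b} s w) \<le> B" for w
    using compact_imp_bounded[OF compact_continuous_image[OF transport_coeff_continuous[OF \<gamma> ab] compact_Icc]]
    unfolding bounded_iff by blast
  then obtain B where B: "\<And>w s. s \<in> {a..b} \<Longrightarrow> norm (transport_coeff \<gamma> {a..b} s w) \<le> B w" by metis
  have "norm (transport_coeff \<gamma> {a..b} s w) \<le> (\<Sum>e\<in>Basis. B e) * norm w" if s: "s \<in> {a..b}" for s w
  proof -
    have "norm (transport_coeff \<gamma> {a..b} s w) = norm (\<Sum>e\<in>Basis. (w \<bullet> e) *\<^sub>R transport_coeff \<gamma> {a..b} s e)"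
      using linear_expand_Basis[OF transport_coeff_linear[OF \<gamma> s]] by metis
    also have "\<dots> \<le> (\<Sum>e\<in>Basis. \<bar>w \<bullet> e\<bar> * norm (transport_coeff \<gamma> {a..b} s e))"
      by (rule order_trans[OF norm_sum]) simp
    also have "\<dots> \<le> (\<Sum>e\<in>Basis. norm w * B e)"
      by (intro sum_mono mult_mono Basis_le_norm B s) auto
    finally show ?thesis by (simp add: sum_distrib_left mult.commute)
  qed
  then show ?thesis by blast
qed

lemma parallel_transport_ode:
  assumes sub: "subdivision m t" and \<gamma>: "\<And>i. i < m \<Longrightarrow> smooth_curve_on N (t i) (t (Suc i)) \<gamma>"
  defines "\<Theta> \<equiv> \<lambda>i. transport_coeff \<gamma> {t i..t (Suc i)}"
  shows "piecewise_ode m t \<Theta>"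
    and "parallel_along N nabla m t \<gamma> V \<Longrightarrow> piecewise_ode.sol m t \<Theta> (\<lambda>s. coords (\<gamma> s) (V s))"
proof -
  have less: "t i < t (Suc i)" if "i < m" for i using sub that by (simp add: subdivision_def)
  show ode: "piecewise_ode m t \<Theta>"
    unfolding \<Theta>_def
    by (rule piecewise_ode.intro[OF sub transport_coeff_linear[OF \<gamma>] transport_coeff_bounded[OF \<gamma> less]])
  assume "parallel_along N nabla m t \<gamma> V"
  then show "piecewise_ode.sol m t \<Theta> (\<lambda>s. coords (\<gamma> s) (V s))"
    unfolding piecewise_ode.sol_def[OF ode] unfolding \<Theta>_def parallel_along_def
    using parallel_equation[OF \<gamma> less] by blast
qed

end

section \<open>The invariant frame of a quotient of a Lie group\<close>

text \<open>Level \<open>j\<close> consists of the vectors annihilated by every product of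
  \<open>j\<close> operators \<open>f - id\<close> with \<open>f\<close> in \<open>F\<close>: a
  linear counterpart of the upper central series.\<close>

primrec unipotent_flag :: "('e::real_vector \<Rightarrow> 'e) set \<Rightarrow> nat \<Rightarrow> 'e set" where
  "unipotent_flag F 0 = {0}"
| "unipotent_flag F (Suc j) = {w. \<forall>f\<in>F. f w - w \<in> unipotent_flag F j}"

locale lie_group_charts =
  fixes G :: "('g, 'b) monoid_scheme" (structure) and A :: "('g, 'e::euclidean_space) chart set"
  assumes lie: "lie_group G A"

sublocale lie_group_charts \<subseteq> group G
  using lie by (simp add: lie_group_def)

sublocale lie_group_charts \<subseteq> G_charts: smooth_charts A
proof
  have M: "smooth_manifold A" using lie by (simp add: lie_group_def)
  then show good: "good_chart d" if "d \<in> A" for d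
    using that unfolding smooth_manifold_def good_chart_def by blast
  fix c d q assume cd: "c \<in> A" "d \<in> A" "q \<in> fst c" "q \<in> fst d"
  have W: "open (snd c ` (fst c \<inter> fst d))" "smooth_on (snd c ` (fst c \<inter> fst d)) (snd d \<circ> chart_inv c)"
    using M cd unfolding smooth_manifold_def by blast+
  have "\<forall>x\<in>snd c ` (fst c \<inter> fst d). chart_inv c x \<in> fst d"
    using chart_inv_left[OF good[OF cd(1)]] by auto
  then show "local_smooth c d (\<lambda>x. x) q"
    unfolding local_smooth_def using W cd by (intro conjI exI[of _ "snd c ` (fst c \<inter> fst d)"]) (auto simp: comp_def)
qed

context lie_group_charts
begin

lemma points_G: "points A = carrier G"
  using lie by (simp add: lie_group_def)

lemma in_carrier: "c \<in> A \<Longrightarrow> g \<in> fst c \<Longrightarrow> g \<in> carrier G"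
  using G_charts.in_points points_G by metis

lemma chart_exists:
  assumes "g \<in> carrier G"
  obtains c where "c \<in> A" "g \<in> fst c"
  using assms points_G unfolding points_def by blast

text \<open>This chart is fixed once and for all; through its coordinates at the identity the model
  space \<open>'e\<close> becomes the Lie algebra.\<close>

definition c0 :: "('g, 'e) chart" where "c0 = chart_at A \<one>"

lemma c0: "c0 \<in> A" "\<one> \<in> fst c0" "good_chart c0"
  using G_charts.chart_at[of \<one>] points_G G_charts.good by (auto simp: c0_def)

lemma mult_smooth:
  assumes "c \<in> A" "d \<in> A" "e \<in> A" "g \<in> fst c" "h \<in> fst d" "g \<otimes> h \<in> fst e"
  shows "local_smooth (prod_chart c d) e (\<lambda>p. fst p \<otimes> snd p) (g, h)"
proof -
  have "smooth_map (product_atlas A A) A (\<lambda>p. fst p \<otimes> snd p)"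
    using lie by (simp add: lie_group_def case_prod_beta')
  moreover have "prod_chart c d \<in> product_atlas A A"
    using assms(1,2) unfolding product_atlas_def prod_chart_def by blast
  ultimately show ?thesis
    by (rule smooth_map_local_smooth[OF _ _ assms(3)])
       (use assms good_prod_chart[OF G_charts.good[OF assms(1)] G_charts.good[OF assms(2)]] in auto)
qed

lemma local_smooth_mult:
  assumes c: "good_chart c" and f: "local_smooth c c1 f p" "c1 \<in> A" and g: "local_smooth c c2 g p" "c2 \<in> A"
    and d: "d \<in> A" "f p \<otimes> g p \<in> fst d"
  shows "local_smooth c d (\<lambda>x. f x \<otimes> g x) p"
proof -
  have "local_smooth (prod_chart c1 c2) d (\<lambda>p. fst p \<otimes> snd p) (f p, g p)"
    by (rule mult_smooth[OF f(2) g(2) d(1) local_smooth_point(2)[OF f(1)] local_smooth_point(2)[OF g(1)] d(2)])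
  from local_smooth_compose(1)[OF local_smooth_Pair(1)[OF f(1) g(1)] this c
      good_prod_chart[OF G_charts.good[OF f(2)] G_charts.good[OF g(2)]]]
  show ?thesis by simp
qed

lemma local_smooth_inv:
  assumes c: "good_chart c" and f: "local_smooth c c1 f p" "c1 \<in> A" and d: "d \<in> A" "inv (f p) \<in> fst d"
  shows "local_smooth c d (\<lambda>x. inv (f x)) p"
proof -
  have "smooth_map A A (\<lambda>g. inv g)" using lie by (simp add: lie_group_def)
  from smooth_map_local_smooth[OF this f(2) d(1) local_smooth_point(2)[OF f(1)] d(2) G_charts.good[OF f(2)]]
  show ?thesis by (rule local_smooth_compose(1)[OF f(1) _ c G_charts.good[OF f(2)]])
qed

text \<open>On each axis multiplication by the identity is the identity map, and the derivative is
  additive.\<close>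

lemma mult_deriv_one:
  "chart_deriv (prod_chart c0 c0) c0 (\<lambda>p. fst p \<otimes> snd p) (\<one>, \<one>) (a, b) = a + b"
proof -
  let ?P = "prod_chart c0 c0" and ?m = "\<lambda>p. fst p \<otimes> snd p"
  let ?D = "chart_deriv ?P c0 ?m (\<one>, \<one>)"
  have P: "good_chart ?P" by (rule good_prod_chart[OF c0(3) c0(3)])
  have m: "local_smooth ?P c0 ?m (\<one>, \<one>)"
    by (rule mult_smooth) (use c0 in auto)
  note id = local_smooth_id[OF c0(3,2)] and const = local_smooth_const[OF c0(3,2,2)]
  have "chart_deriv c0 c0 (\<lambda>x. ?m (x, \<one>)) \<one> a = ?D (a, 0)"
    using local_smooth_compose(2)[OF local_smooth_Pair(1)[OF id(1) const(1)] m c0(3) P, of a]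
      local_smooth_Pair(2)[OF id(1) const(1)] by (simp add: id(2) const(2))
  moreover have "chart_deriv c0 c0 (\<lambda>x. ?m (x, \<one>)) \<one> = chart_deriv c0 c0 (\<lambda>x. x) \<one>"
    by (rule local_smooth_cong(2)[OF id(1) c0(3), symmetric]) (use in_carrier[OF c0(1)] in auto)
  ultimately have 1: "?D (a, 0) = a" by (simp add: id(2))
  have "chart_deriv c0 c0 (\<lambda>x. ?m (\<one>, x)) \<one> b = ?D (0, b)"
    using local_smooth_compose(2)[OF local_smooth_Pair(1)[OF const(1) id(1)] m c0(3) P, of b]
      local_smooth_Pair(2)[OF const(1) id(1)] by (simp add: id(2) const(2))
  moreover have "chart_deriv c0 c0 (\<lambda>x. ?m (\<one>, x)) \<one> = chart_deriv c0 c0 (\<lambda>x. x) \<one>"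
    by (rule local_smooth_cong(2)[OF id(1) c0(3), symmetric]) (use in_carrier[OF c0(1)] in auto)
  ultimately have 2: "?D (0, b) = b" by (simp add: id(2))
  show ?thesis using linear_add[OF linear_chart_deriv[OF m], of "(a, 0)" "(0, b)"] 1 2 by simp
qed

definition Ad :: "'g \<Rightarrow> 'e \<Rightarrow> 'e" where
  "Ad g = chart_deriv c0 c0 (\<lambda>h. g \<otimes> h \<otimes> inv g) \<one>"

lemma conj_smooth:
  assumes g: "g \<in> carrier G"
  shows "local_smooth c0 c0 (\<lambda>h. g \<otimes> h \<otimes> inv g) \<one>"
proof -
  obtain c where c: "c \<in> A" "g \<in> fst c" using chart_exists[OF g] .
  obtain c' where c': "c' \<in> A" "inv g \<in> fst c'" using chart_exists[OF inv_closed[OF g]] .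
  have "local_smooth c0 c (\<lambda>h. g \<otimes> h) \<one>"
    by (rule local_smooth_mult[OF c0(3) local_smooth_const(1)[OF c0(3,2) c(2)] c(1)
          local_smooth_id(1)[OF c0(3,2)] c0(1) c(1)]) (use g c in simp)
  then show ?thesis
    by (rule local_smooth_mult[OF c0(3) _ c(1) local_smooth_const(1)[OF c0(3,2) c'(2)] c'(1) c0(1)])
       (use g c0 in simp)
qed

lemma linear_Ad: "g \<in> carrier G \<Longrightarrow> linear (Ad g)"
  unfolding Ad_def by (rule linear_chart_deriv[OF conj_smooth])

text \<open>Differentiate \<open>k h \<otimes> h = g \<otimes> h \<otimes> inv g\<close> at the
  identity: the left side gives the derivative of \<open>k\<close> plus the identity, the right side
  \<open>Ad g\<close>.\<close>

lemma commutator_deriv: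
  assumes g: "g \<in> carrier G"
  defines "k \<equiv> \<lambda>h. g \<otimes> h \<otimes> inv g \<otimes> inv h"
  shows "local_smooth c0 c0 k \<one>" "chart_deriv c0 c0 k \<one> w = Ad g w - w"
proof -
  have one: "inv \<one> \<in> fst c0" "g \<otimes> \<one> \<otimes> inv g \<otimes> inv \<one> \<in> fst c0" using c0 g by simp_all
  show k: "local_smooth c0 c0 k \<one>"
    unfolding k_def
    by (rule local_smooth_mult[OF c0(3) conj_smooth[OF g] c0(1)
          local_smooth_inv[OF c0(3) local_smooth_id(1)[OF c0(3,2)] c0(1) c0(1) one(1)] c0(1) c0(1) one(2)])
  note id = local_smooth_id[OF c0(3,2)]
  have k1: "k \<one> = \<one>" using g by (simp add: k_def)
  have m: "local_smooth (prod_chart c0 c0) c0 (\<lambda>p. fst p \<otimes> snd p) (k \<one>, \<one>)"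
    unfolding k1 by (rule mult_smooth) (use c0 in auto)
  have "chart_deriv c0 c0 (\<lambda>h. k h \<otimes> h) \<one> w = chart_deriv c0 c0 k \<one> w + w"
    using local_smooth_compose(2)[OF local_smooth_Pair(1)[OF k id(1)] m c0(3)
        good_prod_chart[OF c0(3) c0(3)], of w]
      local_smooth_Pair(2)[OF k id(1)] mult_deriv_one by (simp add: k1 id(2))
  moreover have "chart_deriv c0 c0 (\<lambda>h. g \<otimes> h \<otimes> inv g) \<one> = chart_deriv c0 c0 (\<lambda>h. k h \<otimes> h) \<one>"
  proof (rule local_smooth_cong(2)[OF conj_smooth[OF g] c0(3)])
    fix h assume "h \<in> fst c0"
    then have "h \<in> carrier G" using in_carrier c0 by blast
    then show "g \<otimes> h \<otimes> inv g = k h \<otimes> h" using g by (simp add: k_def m_assoc)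
  qed
  ultimately show "chart_deriv c0 c0 k \<one> w = Ad g w - w" by (simp add: Ad_def)
qed

section \<open>The flag of the adjoint representation of a nilpotent group\<close>

abbreviation flag :: "nat \<Rightarrow> 'e set" where
  "flag \<equiv> unipotent_flag (Ad ` carrier G)"

lemma subspace_flag: "subspace (flag j)"
proof (induction j)
  case (Suc j)
  show ?case
  proof (rule subspaceI)
    show "0 \<in> flag (Suc j)" using subspace_0[OF Suc] by (simp add: linear_0[OF linear_Ad])
    fix v w r assume v: "v \<in> flag (Suc j)"
    have "Ad g (r *\<^sub>R v) - r *\<^sub>R v = r *\<^sub>R (Ad g v - v)" if "g \<in> carrier G" for g
      by (simp add: linear_cmul[OF linear_Ad[OF that]] scaleR_diff_right)
    then show "r *\<^sub>R v \<in> flag (Suc j)" using v subspace_scale[OF Suc] by simp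
    assume w: "w \<in> flag (Suc j)"
    have "Ad g (v + w) - (v + w) \<in> flag j" if "g \<in> carrier G" for g
    proof -
      have eq: "Ad g (v + w) - (v + w) = (Ad g v - v) + (Ad g w - w)"
        by (simp add: linear_add[OF linear_Ad[OF that]])
      have "Ad g v - v \<in> flag j" "Ad g w - w \<in> flag j" using v w that by simp_all
      then show ?thesis unfolding eq by (rule subspace_add[OF Suc])
    qed
    then show "v + w \<in> flag (Suc j)" by simp
  qed
qed simp

lemma flag_mono: "flag j \<subseteq> flag (Suc j)"
proof (induction j)
  case 0
  show ?case by (simp add: linear_0[OF linear_Ad])
next
  case (Suc j)
  show ?case
  proof
    fix w assume "w \<in> flag (Suc j)"
    then have "\<forall>f\<in>Ad ` carrier G. f w - w \<in> flag j" by (simp only: unipotent_flag.simps mem_Collect_eq)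
    then have "\<forall>f\<in>Ad ` carrier G. f w - w \<in> flag (Suc j)" using Suc by blast
    then show "w \<in> flag (Suc (Suc j))"
      by (simp only: unipotent_flag.simps(2)[of _ "Suc j"] mem_Collect_eq)
  qed
qed

text \<open>Treats curves as maps between charts, so that \<open>local_smooth_compose\<close>
  applies to them.\<close>

definition real_chart :: "(real, real) chart" where
  "real_chart = (UNIV, \<lambda>t. t)"

lemma real_chart: "good_chart real_chart" "fst real_chart = UNIV" "snd real_chart t = t" "chart_inv real_chart t = t"
proof -
  show 1: "good_chart real_chart" "fst real_chart = UNIV" "snd real_chart t = t"
    by (simp_all add: good_chart_def real_chart_def)
  show "chart_inv real_chart t = t" using chart_inv_left[OF 1(1), of t] by (simp add: real_chart_def)
qed

text \<open>The commutator of \<open>g\<close> with a curve in the \<open>m\<close>-th term of the lower central series lies in the next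
  term, and its velocity at \<open>\<one>\<close> is \<open>Ad g w - w\<close>.\<close>

lemma velocity_in_flag:
  assumes k: "lower_central_series G k = {\<one>}"
  shows "m + j = k \<Longrightarrow> local_smooth real_chart c0 \<phi> 0 \<Longrightarrow> \<phi> 0 = \<one> \<Longrightarrow> open V \<Longrightarrow> 0 \<in> V \<Longrightarrow>
    (\<And>t. t \<in> V \<Longrightarrow> \<phi> t \<in> lower_central_series G m \<inter> carrier G) \<Longrightarrow> chart_deriv real_chart c0 \<phi> 0 1 \<in> flag j"
proof (induction j arbitrary: \<phi> m V)
  case 0
  \<comment> \<open>At the end of the lower central series the curve is constant near 0, so its
    velocity is zero.\<close>
  have "chart_deriv real_chart c0 \<phi> 0 = chart_deriv real_chart c0 (\<lambda>t. \<one>) 0"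
    by (rule local_smooth_cong_open(2)[OF 0(2) real_chart(1) 0(4)]) (use 0 k in \<open>auto simp: real_chart\<close>)
  also have "\<dots> = (\<lambda>v. 0)"
    by (rule local_smooth_const(2)[OF real_chart(1) _ c0(2)]) (simp add: real_chart)
  finally show ?case by simp
next
  case (Suc j)
  let ?w = "chart_deriv real_chart c0 \<phi> 0 1"
  have "Ad g ?w - ?w \<in> flag j" if g: "g \<in> carrier G" for g
  proof -
    define K where "K h = g \<otimes> h \<otimes> inv g \<otimes> inv h" for h
    have K: "local_smooth c0 c0 K (\<phi> 0)" "chart_deriv c0 c0 K (\<phi> 0) ?w = Ad g ?w - ?w"
      using commutator_deriv[OF g, folded K_def] Suc.prems(3) by simp_all
    have "chart_deriv real_chart c0 (\<lambda>t. K (\<phi> t)) 0 1 \<in> flag j"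
    proof (rule Suc.IH[of "Suc m" _ V])
      show "Suc m + j = k" using Suc.prems(1) by simp
      show "local_smooth real_chart c0 (\<lambda>t. K (\<phi> t)) 0"
        by (rule local_smooth_compose(1)[OF Suc.prems(2) K(1) real_chart(1) c0(3)])
      show "K (\<phi> 0) = \<one>" using Suc.prems(3) g by (simp add: K_def)
      show "K (\<phi> t) \<in> lower_central_series G (Suc m) \<inter> carrier G" if t: "t \<in> V" for t
      proof
        have \<phi>: "\<phi> t \<in> lower_central_series G m" "\<phi> t \<in> carrier G" using Suc.prems(6)[OF t] by auto
        then show "K (\<phi> t) \<in> carrier G" using g by (simp add: K_def)
        show "K (\<phi> t) \<in> lower_central_series G (Suc m)"
          unfolding lower_central_series.simps K_def using g \<phi>(1) by (intro generate.incl) blast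
      qed
    qed (use Suc.prems in auto)
    then show ?thesis
      using local_smooth_compose(2)[OF Suc.prems(2) K(1) real_chart(1) c0(3), of 1] K(2) by simp
  qed
  then show ?case by simp
qed

text \<open>Every \<open>w\<close> is a velocity at the identity: the straight line in the chart
  \<open>c0\<close> takes the place of a one-parameter subgroup.\<close>

lemma line_smooth:
  fixes w :: 'e
  defines "\<phi> \<equiv> \<lambda>t. chart_inv c0 (snd c0 \<one> + t *\<^sub>R w)"
  shows "local_smooth real_chart c0 \<phi> 0" "chart_deriv real_chart c0 \<phi> 0 1 = w" "\<phi> 0 = \<one>"
    "\<exists>V. open V \<and> 0 \<in> V \<and> (\<forall>t\<in>V. snd c0 \<one> + t *\<^sub>R w \<in> snd c0 ` fst c0 \<and> \<phi> t \<in> carrier G)"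
proof -
  define l where "l t = snd c0 \<one> + t *\<^sub>R w" for t
  define V where "V = l -` (snd c0 ` fst c0)"
  have V: "open V" unfolding V_def l_def
    by (rule open_vimage[OF G_charts.open_image[OF c0(1)]]) (intro continuous_intros)
  have 0: "0 \<in> V" using c0(2) by (simp add: V_def l_def)
  have \<phi>: "\<phi> t = chart_inv c0 (l t)" for t by (simp add: \<phi>_def l_def)
  have inV: "chart_inv c0 (l t) \<in> fst c0" "snd c0 (chart_inv c0 (l t)) = l t" if "t \<in> V" for t
    using chart_inv_in[of "l t" c0] that by (simp_all add: V_def)
  show \<phi>0: "\<phi> 0 = \<one>" using chart_inv_left[OF c0(3,2)] by (simp add: \<phi>_def)
  show "\<exists>V. open V \<and> 0 \<in> V \<and> (\<forall>t\<in>V. snd c0 \<one> + t *\<^sub>R w \<in> snd c0 ` fst c0 \<and> \<phi> t \<in> carrier G)"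
    using V 0 inV(1) in_carrier[OF c0(1)] by (intro exI[of _ V]) (auto simp: \<phi> V_def l_def)
  have eq: "l t = (snd c0 \<circ> \<phi> \<circ> chart_inv real_chart) t" if "t \<in> V" for t
    using inV[OF that] by (simp add: \<phi> real_chart)
  have "smooth_on V l" unfolding l_def
    by (intro smooth_on_add[OF V] smooth_on_const smooth_on_linear[OF V] bounded_linear_scaleR_left)
  then have "smooth_on V (snd c0 \<circ> \<phi> \<circ> chart_inv real_chart)"
    by (rule smooth_on_cong[OF V]) (rule eq)
  then show "local_smooth real_chart c0 \<phi> 0"
    unfolding local_smooth_def using V 0 inV \<phi>0 c0 by (intro conjI exI[of _ V]) (auto simp: real_chart \<phi>)
  have "(l has_derivative (\<lambda>h. h *\<^sub>R w)) (at 0)"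
    unfolding l_def by (auto intro!: derivative_eq_intros)
  then have "((snd c0 \<circ> \<phi> \<circ> chart_inv real_chart) has_derivative (\<lambda>h. h *\<^sub>R w)) (at 0)"
    by (rule has_derivative_transform_within_open[OF _ V 0]) (rule eq)
  from frechet_derivative_at[OF this, symmetric] show "chart_deriv real_chart c0 \<phi> 0 1 = w"
    by (simp add: chart_deriv_def real_chart)
qed

text \<open>Term 0 of the lower central series is the whole group, so
  \<open>velocity_in_flag\<close> puts every velocity in level \<open>k\<close>, where
  \<open>k\<close> is a length at which the series becomes trivial.\<close>

lemma flag_UNIV:
  assumes "nilpotent_group G"
  obtains k where "flag k = UNIV"
proof -
  obtain k where k: "lower_central_series G k = {\<one>}" using assms by (auto simp: nilpotent_group_def)
  have "w \<in> flag k" for w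
  proof -
    obtain V where V: "open V" "0 \<in> V" "\<forall>t\<in>V. chart_inv c0 (snd c0 \<one> + t *\<^sub>R w) \<in> carrier G"
      using line_smooth(4)[of w] by blast
    show ?thesis
      using velocity_in_flag[OF k, of 0 k "\<lambda>t. chart_inv c0 (snd c0 \<one> + t *\<^sub>R w)" V] line_smooth[of w] V by simp
  qed
  then show thesis using that by blast
qed

end

section \<open>The quotient and the right action of the group on it\<close>

locale lie_quotient = lie_group_charts G A
  for G :: "('g, 'b) monoid_scheme" (structure) and A :: "('g, 'e::euclidean_space) chart set" +
  fixes \<Gamma> :: "'g set"
  assumes \<Gamma>: "subgroup \<Gamma> G"
begin

abbreviation N :: "('g set, 'e) chart set" where "N \<equiv> quotient_atlas G A \<Gamma>"

text \<open>Here \<open>\<sigma>\<close> is the local section of the projection on the domain of \<open>d\<close>.\<close>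

lemma quotient_chart:
  assumes "d \<in> N"
  obtains c \<sigma> V where "c \<in> A" "good_chart d" "open V"
    "\<And>q. q \<in> fst d \<Longrightarrow> \<sigma> q \<in> fst c \<and> \<Gamma> #> \<sigma> q = q \<and> snd c (\<sigma> q) \<in> V \<and> snd c (\<sigma> q) = snd d q"
    "\<And>g. g \<in> fst c \<Longrightarrow> snd c g \<in> V \<Longrightarrow> \<Gamma> #> g \<in> fst d \<and> \<sigma> (\<Gamma> #> g) = g"
proof -
  obtain U c where d: "d = ((\<lambda>g. \<Gamma> #> g) ` U, snd c \<circ> inv_into U (\<lambda>g. \<Gamma> #> g))"
    and c: "c \<in> A" and U: "U \<subseteq> fst c" "openin (manifold_topology A) U" "inj_on (\<lambda>g. \<Gamma> #> g) U"
    using assms unfolding quotient_atlas_def by blast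
  define \<sigma> where "\<sigma> = inv_into U (\<lambda>g. \<Gamma> #> g)"
  have inj: "inj_on (snd c) (fst c)" using G_charts.good[OF c] by (simp add: good_chart_def)
  have \<sigma>: "\<sigma> q \<in> U" "\<Gamma> #> \<sigma> q = q" if "q \<in> fst d" for q
    using that inv_into_into[of q "\<lambda>g. \<Gamma> #> g" U] f_inv_into_f[of q "\<lambda>g. \<Gamma> #> g" U] by (simp_all add: d \<sigma>_def)
  have \<sigma>_left: "\<sigma> (\<Gamma> #> g) = g" if "g \<in> U" for g
    using inv_into_f_f[OF U(3) that] by (simp add: \<sigma>_def)
  have "\<And>c. c \<in> A \<Longrightarrow> inj_on (snd c) (fst c)" using G_charts.good by (simp add: good_chart_def)
  from openin_manifold_topology[OF this] U(2) have "open (snd c ` (U \<inter> fst c))" using c by simp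
  then have V: "open (snd c ` U)" using U(1) by (simp add: Int_absorb2)
  have "inj_on (snd d) (fst d)"
  proof (rule inj_onI)
    fix q r assume qr: "q \<in> fst d" "r \<in> fst d" "snd d q = snd d r"
    then have "snd c (\<sigma> q) = snd c (\<sigma> r)" by (simp add: d \<sigma>_def)
    then have "\<sigma> q = \<sigma> r" using inj_onD[OF inj] \<sigma>(1)[OF qr(1)] \<sigma>(1)[OF qr(2)] U(1) by blast
    then show "q = r" using \<sigma>(2)[OF qr(1)] \<sigma>(2)[OF qr(2)] by metis
  qed
  moreover have "snd d ` fst d = snd c ` U"
  proof -
    have "snd d (\<Gamma> #> g) = snd c g" if "g \<in> U" for g using \<sigma>_left[OF that] by (simp add: d \<sigma>_def)
    then show ?thesis by (auto simp: d image_image)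
  qed
  ultimately have good: "good_chart d" using V by (simp add: good_chart_def)
  show thesis
  proof (rule that[OF c good V, of \<sigma>])
    show "\<sigma> q \<in> fst c \<and> \<Gamma> #> \<sigma> q = q \<and> snd c (\<sigma> q) \<in> snd c ` U \<and> snd c (\<sigma> q) = snd d q" if "q \<in> fst d" for q
      using \<sigma>[OF that] U(1) by (auto simp: d \<sigma>_def)
    show "\<Gamma> #> g \<in> fst d \<and> \<sigma> (\<Gamma> #> g) = g" if "g \<in> fst c" "snd c g \<in> snd c ` U" for g
    proof -
      have "g \<in> U" using that U(1) inj_onD[OF inj] by blast
      then show ?thesis using \<sigma>_left by (simp add: d)
    qed
  qed
qed

lemma good_N: "d \<in> N \<Longrightarrow> good_chart d"
  by (rule quotient_chart)

lemma coset_carrier: "g \<in> carrier G \<Longrightarrow> h \<in> carrier G \<Longrightarrow> (\<Gamma> #> g) #> h = \<Gamma> #> (g \<otimes> h)"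
  by (rule coset_mult_assoc[OF subgroup.subset[OF \<Gamma>]])

lemma coset_eqE:
  assumes "\<Gamma> #> g = \<Gamma> #> h" "g \<in> carrier G" "h \<in> carrier G"
  obtains \<gamma> where "\<gamma> \<in> \<Gamma>" "h = \<gamma> \<otimes> g"
proof -
  have "h \<in> \<Gamma> #> g" by (rule repr_independenceD[OF \<Gamma> assms(3,1)])
  then show thesis using that by (auto simp: r_coset_def)
qed

lemma coset_absorb:
  assumes "\<gamma> \<in> \<Gamma>" "g \<in> carrier G"
  shows "\<Gamma> #> (\<gamma> \<otimes> g) = \<Gamma> #> g"
proof -
  have "\<gamma> \<otimes> g \<in> \<Gamma> #> g" using assms(1) by (auto simp: r_coset_def)
  from repr_independence[OF this assms(2) \<Gamma>] show ?thesis by simp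
qed

lemma points_N:
  assumes "q \<in> points N"
  obtains g where "g \<in> carrier G" "q = \<Gamma> #> g"
proof -
  obtain d where d: "d \<in> N" "q \<in> fst d" using assms by (auto simp: points_def)
  obtain c \<sigma> V where "c \<in> A" "\<And>q. q \<in> fst d \<Longrightarrow> \<sigma> q \<in> fst c \<and> \<Gamma> #> \<sigma> q = q \<and> snd c (\<sigma> q) \<in> V \<and> snd c (\<sigma> q) = snd d q"
    using quotient_chart[OF d(1)] by metis
  then show thesis using that[of "\<sigma> q"] d(2) in_carrier by metis
qed

lemma N_in_points: "d \<in> N \<Longrightarrow> q \<in> fst d \<Longrightarrow> q \<in> points N"
  by (auto simp: points_def)

text \<open>The coset operation, applied to a point \<open>q\<close> of the quotient, doubles as the
  right action of the group.\<close>

lemma act_assoc: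
  assumes "q \<in> points N" "g \<in> carrier G" "h \<in> carrier G"
  shows "(q #> g) #> h = q #> (g \<otimes> h)" "q #> \<one> = q"
proof -
  obtain a where a: "a \<in> carrier G" "q = \<Gamma> #> a" using points_N[OF assms(1)] .
  show "(q #> g) #> h = q #> (g \<otimes> h)" "q #> \<one> = q"
    unfolding a(2) using assms(2,3) a(1) by (simp_all add: coset_carrier m_assoc)
qed

text \<open>The action lifts to multiplication in the group: take a local section, multiply, project
  back. Left multiplication by a fixed element of \<open>\<Gamma>\<close> matches the section of the
  target chart and is invisible after projection.\<close>

lemma act_smooth:
  assumes d: "d \<in> N" "d' \<in> N" and c: "c \<in> A" and q: "q \<in> fst d" and h: "h \<in> fst c" and qh: "q #> h \<in> fst d'"
  shows "local_smooth (prod_chart d c) d' (\<lambda>p. fst p #> snd p) (q, h)"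
proof -
  obtain c1 \<sigma> V where c1: "c1 \<in> A" and gd: "good_chart d"
    and \<sigma>: "\<And>q. q \<in> fst d \<Longrightarrow> \<sigma> q \<in> fst c1 \<and> \<Gamma> #> \<sigma> q = q \<and> snd c1 (\<sigma> q) \<in> V \<and> snd c1 (\<sigma> q) = snd d q"
    using quotient_chart[OF d(1)] by metis
  obtain c2 \<tau> V' where c2: "c2 \<in> A" and gd': "good_chart d'" and V': "open V'"
    and \<tau>: "\<And>q. q \<in> fst d' \<Longrightarrow> \<tau> q \<in> fst c2 \<and> \<Gamma> #> \<tau> q = q \<and> snd c2 (\<tau> q) \<in> V' \<and> snd c2 (\<tau> q) = snd d' q"
    and \<tau>': "\<And>g. g \<in> fst c2 \<Longrightarrow> snd c2 g \<in> V' \<Longrightarrow> \<Gamma> #> g \<in> fst d' \<and> \<tau> (\<Gamma> #> g) = g"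
    using quotient_chart[OF d(2)] by metis
  let ?P = "prod_chart d c"
  have gc: "good_chart c" by (rule G_charts.good[OF c])
  have P: "good_chart ?P" by (rule good_prod_chart[OF gd gc])
  have car: "\<sigma> r \<in> carrier G" if "r \<in> fst d" for r using \<sigma>[OF that] in_carrier[OF c1] by blast
  have hcar: "x \<in> carrier G" if "x \<in> fst c" for x using that in_carrier[OF c] by blast
  \<comment> \<open>The product and the value of the target section represent the same coset, hence
    differ by some \<open>\<gamma> \<in> \<Gamma>\<close>. It is chosen at the base point and kept
    fixed nearby.\<close>
  have "\<Gamma> #> (\<sigma> q \<otimes> h) = \<Gamma> #> \<tau> (q #> h)"
    using coset_carrier[OF car[OF q] hcar[OF h]] \<sigma>[OF q] \<tau>[OF qh] by simp
  then obtain \<gamma> where \<gamma>: "\<gamma> \<in> \<Gamma>" "\<tau> (q #> h) = \<gamma> \<otimes> (\<sigma> q \<otimes> h)"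
    using coset_eqE car[OF q] hcar[OF h] \<tau>[OF qh] in_carrier[OF c2] by (metis m_closed)
  have \<gamma>car: "\<gamma> \<in> carrier G" using \<gamma>(1) subgroup.subset[OF \<Gamma>] by blast
  obtain c3 where c3: "c3 \<in> A" "\<sigma> q \<otimes> h \<in> fst c3" using chart_exists car[OF q] hcar[OF h] by (metis m_closed)
  obtain c4 where c4: "c4 \<in> A" "\<gamma> \<in> fst c4" using chart_exists[OF \<gamma>car] .
  have \<sigma>s: "local_smooth d c1 \<sigma> q"
    by (rule local_smooth_chart_identity(1)[OF gd open_UNIV UNIV_I q]) (use \<sigma> in auto)
  have Pq: "(q, h) \<in> fst ?P" using q h by simp
  have 1: "local_smooth ?P c1 (\<lambda>p. \<sigma> (fst p)) (q, h)"
    by (rule local_smooth_compose(1)[OF local_smooth_fst(1)[OF gd gc q h] _ P gd]) (use \<sigma>s in simp)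
  have 2: "local_smooth ?P c3 (\<lambda>p. \<sigma> (fst p) \<otimes> snd p) (q, h)"
    by (rule local_smooth_mult[OF P 1 c1 local_smooth_snd(1)[OF gd gc q h] c c3(1)]) (use c3 in simp)
  have 3: "local_smooth ?P c2 (\<lambda>p. \<gamma> \<otimes> (\<sigma> (fst p) \<otimes> snd p)) (q, h)"
    by (rule local_smooth_mult[OF P local_smooth_const(1)[OF P Pq c4(2)] c4(1) 2 c3(1) c2])
       (use \<gamma>(2) \<tau>[OF qh] in simp)
  have 4: "local_smooth c2 d' (\<lambda>g. \<Gamma> #> g) (\<gamma> \<otimes> (\<sigma> q \<otimes> h))"
    unfolding \<gamma>(2)[symmetric]
  proof (rule local_smooth_chart_identity(1)[OF G_charts.good[OF c2] V'])
    show "snd c2 (\<tau> (q #> h)) \<in> V'" "\<tau> (q #> h) \<in> fst c2" using \<tau>[OF qh] by auto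
    fix g assume g: "g \<in> fst c2" "snd c2 g \<in> V'"
    then show "\<Gamma> #> g \<in> fst d' \<and> snd d' (\<Gamma> #> g) = snd c2 g"
      using \<tau>'[OF g] \<tau>[of "\<Gamma> #> g"] by metis
  qed
  have "local_smooth ?P d' (\<lambda>p. \<Gamma> #> (\<gamma> \<otimes> (\<sigma> (fst p) \<otimes> snd p))) (q, h)"
    by (rule local_smooth_compose(1)[OF 3 _ P G_charts.good[OF c2]]) (use 4 in simp)
  then show ?thesis
  proof (rule local_smooth_cong(1)[OF _ P])
    fix p assume "p \<in> fst ?P"
    then have p: "fst p \<in> fst d" "snd p \<in> fst c" by (auto simp: prod_chart_def)
    show "\<Gamma> #> (\<gamma> \<otimes> (\<sigma> (fst p) \<otimes> snd p)) = fst p #> snd p"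
      using coset_absorb[OF \<gamma>(1) m_closed[OF car[OF p(1)] hcar[OF p(2)]]]
        coset_carrier[OF car[OF p(1)] hcar[OF p(2)]] \<sigma>[OF p(1)] by simp
  qed
qed

end

sublocale lie_quotient \<subseteq> N_charts: smooth_charts N
proof
  fix d d' q assume d: "d \<in> N" "d' \<in> N" "q \<in> fst d" "q \<in> fst d'"
  note c0 = c0
  have gd: "good_chart d" by (rule good_N[OF d(1)])
  have one: "q #> \<one> = q" if "q \<in> fst d" for q using act_assoc(2)[OF N_in_points[OF d(1) that] one_closed one_closed] .
  \<comment> \<open>A transition map is the action of the identity element, so its smoothness is a
    case of \<open>act_smooth\<close>.\<close>
  have "local_smooth (prod_chart d c0) d' (\<lambda>p. fst p #> snd p) (q, \<one>)"
    by (rule act_smooth[OF d(1,2) c0(1) d(3) c0(2)]) (use d one in simp)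
  from local_smooth_compose(1)[OF local_smooth_Pair(1)[OF local_smooth_id(1)[OF gd d(3)]
        local_smooth_const(1)[OF gd d(3) c0(2)]] this gd good_prod_chart[OF gd c0(3)]]
  have "local_smooth d d' (\<lambda>x. x #> \<one>) q" by simp
  then show "local_smooth d d' (\<lambda>x. x) q"
    by (rule local_smooth_cong(1)[OF _ gd]) (rule one)
qed (rule good_N)

section \<open>Fundamental vector fields of the action and their dual coframe\<close>

context lie_quotient
begin

text \<open>The fundamental vector field of the right action for \<open>w\<close>: the image under
  the projection of the left-invariant field on the group with value \<open>w\<close> at the
  identity.\<close>

definition frame :: "'e \<Rightarrow> ('g set, 'e) vfield" where
  "frame w q = (\<lambda>d. if d \<in> N \<and> q \<in> fst d then chart_deriv c0 d (\<lambda>h. q #> h) \<one> w else 0)"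

lemma orbit_smooth:
  assumes d: "d \<in> N" "d' \<in> N" "q \<in> fst d" and g: "c \<in> A" "g \<in> fst c" "q #> g \<in> fst d'"
  shows "local_smooth c d' (\<lambda>h. q #> h) g"
    "chart_deriv c d' (\<lambda>h. q #> h) g w = chart_deriv (prod_chart d c) d' (\<lambda>p. fst p #> snd p) (q, g) (0, w)"
proof -
  have gc: "good_chart c" by (rule G_charts.good[OF g(1)])
  note const = local_smooth_const[OF gc g(2) d(3)] and id = local_smooth_id[OF gc g(2)]
  have act: "local_smooth (prod_chart d c) d' (\<lambda>p. fst p #> snd p) (q, g)"
    by (rule act_smooth[OF d(1,2) g(1) d(3) g(2,3)])
  note comp = local_smooth_compose[OF local_smooth_Pair(1)[OF const(1) id(1)] act gc good_prod_chart[OF good_N[OF d(1)] gc]]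
  show "local_smooth c d' (\<lambda>h. q #> h) g" using comp(1) by simp
  show "chart_deriv c d' (\<lambda>h. q #> h) g w = chart_deriv (prod_chart d c) d' (\<lambda>p. fst p #> snd p) (q, g) (0, w)"
    using comp(2)[of w] local_smooth_Pair(2)[OF const(1) id(1)] by (simp add: const(2) id(2))
qed

lemma frame_chart:
  assumes "d \<in> N" "q \<in> fst d"
  shows "frame w q d = chart_deriv c0 d (\<lambda>h. q #> h) \<one> w"
    "local_smooth c0 d (\<lambda>h. q #> h) \<one>"
proof -
  have one: "q #> \<one> = q" by (rule act_assoc(2)[OF N_in_points[OF assms] one_closed one_closed])
  show "frame w q d = chart_deriv c0 d (\<lambda>h. q #> h) \<one> w" using assms by (simp add: frame_def)
  show "local_smooth c0 d (\<lambda>h. q #> h) \<one>"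
    by (rule orbit_smooth(1)[OF assms(1,1,2) c0(1,2)]) (simp add: one assms)
qed

lemma frame_tangent_space: "frame w q \<in> tangent_space N q"
proof (rule N_charts.tangentI)
  show "frame w q c = 0" if "\<not> (c \<in> N \<and> q \<in> fst c)" for c
    using that unfolding frame_def by (rule if_not_P)
  fix c d assume cd: "c \<in> N" "d \<in> N" "q \<in> fst c" "q \<in> fst d"
  have one: "q #> \<one> = q" by (rule act_assoc(2)[OF N_in_points[OF cd(1,3)] one_closed one_closed])
  have "local_smooth c d (\<lambda>x. x) (q #> \<one>)" unfolding one by (rule N_charts.transition[OF cd])
  from local_smooth_compose(2)[OF frame_chart(2)[OF cd(1,3)] this c0(3) good_N[OF cd(1)], of w]
  show "frame w q d = chart_deriv c d (\<lambda>x. x) q (frame w q c)"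
    using frame_chart(1)[OF cd(2,4)] frame_chart(1)[OF cd(1,3)] by (simp add: one)
qed

lemma frame_vector_field: "frame w \<in> vector_fields N"
proof -
  have "smooth_on (snd d ` fst d) (\<lambda>x. frame w (chart_inv d x) d)" if d: "d \<in> N" for d
  proof (rule smooth_on_cong[OF N_charts.open_image[OF d]])
    show "smooth_on (snd d ` fst d) (\<lambda>x. chart_deriv c0 d (\<lambda>h. fst (chart_inv d x, h) #> snd (chart_inv d x, h)) \<one> w)"
    proof (rule smooth_on_chart_deriv[OF good_N[OF d] c0(3) good_N[OF d], where g = "\<lambda>_. \<one>" and F = "\<lambda>p. fst p #> snd p"])
      fix q assume q: "q \<in> fst d"
      show "local_smooth d c0 (\<lambda>_. \<one>) q" by (rule local_smooth_const(1)[OF good_N[OF d] q c0(2)])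
      show "local_smooth (prod_chart d c0) d (\<lambda>p. fst p #> snd p) (q, \<one>)"
        by (rule act_smooth[OF d d c0(1) q c0(2)])
           (simp add: act_assoc(2)[OF N_in_points[OF d q] one_closed one_closed] q)
    qed
    show "chart_deriv c0 d (\<lambda>h. fst (chart_inv d x, h) #> snd (chart_inv d x, h)) \<one> w = frame w (chart_inv d x) d"
      if "x \<in> snd d ` fst d" for x
      using frame_chart(1)[OF d chart_inv_in(1)[OF that]] by simp
  qed
  then show ?thesis using frame_tangent_space by (simp add: vector_fields_def)
qed

lemma linear_frame: "linear (\<lambda>w. frame w q)"
proof -
  have lin: "linear (chart_deriv c0 d (\<lambda>h. q #> h) \<one>)" if "d \<in> N" "q \<in> fst d" for d
    by (rule linear_chart_deriv[OF frame_chart(2)[OF that]])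
  show ?thesis
    by (rule linearI; rule ext)
       (auto simp: frame_def linear_add[OF lin] linear_cmul[OF lin])
qed

text \<open>The inverse of the frame is the Maurer--Cartan form: the derivative of \<open>r \<mapsto> (\<sigma> q)\<inverse> \<sigma> r\<close> at \<open>r = q\<close>.\<close>

lemma maurer_cartan:
  assumes d: "d \<in> N"
  shows "\<exists>\<theta>. (\<forall>b. smooth_on (snd d ` fst d) (\<lambda>x. \<theta> x b)) \<and>
      (\<forall>x\<in>snd d ` fst d. linear (\<theta> x) \<and> (\<forall>u. frame (\<theta> x u) (chart_inv d x) d = u))"
proof -
  obtain c \<sigma> V where c: "c \<in> A" and gd: "good_chart d"
    and \<sigma>: "\<And>q. q \<in> fst d \<Longrightarrow> \<sigma> q \<in> fst c \<and> \<Gamma> #> \<sigma> q = q \<and> snd c (\<sigma> q) \<in> V \<and> snd c (\<sigma> q) = snd d q"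
    using quotient_chart[OF d] by metis
  have car: "\<sigma> r \<in> carrier G" if "r \<in> fst d" for r using \<sigma>[OF that] in_carrier[OF c] by blast
  have \<sigma>s: "local_smooth d c \<sigma> q" if "q \<in> fst d" for q
    by (rule local_smooth_chart_identity(1)[OF gd open_UNIV UNIV_I that]) (use \<sigma> in auto)
  define \<delta> where "\<delta> p = inv (\<sigma> (fst p)) \<otimes> \<sigma> (snd p)" for p
  let ?P = "prod_chart d d"
  have P: "good_chart ?P" by (rule good_prod_chart[OF gd gd])
  have \<delta>s: "local_smooth ?P c0 \<delta> (q, q)" if q: "q \<in> fst d" for q
  proof -
    obtain c' where c': "c' \<in> A" "inv (\<sigma> q) \<in> fst c'" using chart_exists[OF inv_closed[OF car[OF q]]] .
    have f: "local_smooth ?P c (\<lambda>p. \<sigma> (fst p)) (q, q)" "local_smooth ?P c (\<lambda>p. \<sigma> (snd p)) (q, q)"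
      by (rule local_smooth_compose(1)[OF local_smooth_fst(1)[OF gd gd q q] _ P gd], use \<sigma>s[OF q] in simp)
         (rule local_smooth_compose(1)[OF local_smooth_snd(1)[OF gd gd q q] _ P gd], use \<sigma>s[OF q] in simp)
    have "local_smooth ?P c' (\<lambda>p. inv (\<sigma> (fst p))) (q, q)"
      by (rule local_smooth_inv[OF P f(1) c c'(1)]) (use c' in simp)
    then show ?thesis unfolding \<delta>_def
      by (rule local_smooth_mult[OF P _ c'(1) f(2) c c0(1)]) (use c0 car[OF q] in simp)
  qed
  define \<theta> where "\<theta> x = chart_deriv d c0 (\<lambda>r. \<delta> (chart_inv d x, r)) (chart_inv d x)" for x
  have "smooth_on (snd d ` fst d) (\<lambda>x. \<theta> x b)" for b
    unfolding \<theta>_def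
    by (rule smooth_on_chart_deriv[OF gd gd c0(3) local_smooth_id(1)[OF gd] \<delta>s])
  moreover have "linear (\<theta> x) \<and> (\<forall>u. frame (\<theta> x u) (chart_inv d x) d = u)" if x: "x \<in> snd d ` fst d" for x
  proof -
    let ?q = "chart_inv d x"
    have q: "?q \<in> fst d" by (rule chart_inv_in(1)[OF x])
    have \<delta>q: "local_smooth d c0 (\<lambda>r. \<delta> (?q, r)) ?q"
      by (rule local_smooth_compose(1)[OF local_smooth_Pair(1)[OF local_smooth_const(1)[OF gd q q]
              local_smooth_id(1)[OF gd q]] \<delta>s[OF q] gd P])
    have one: "\<delta> (?q, ?q) = \<one>" using car[OF q] by (simp add: \<delta>_def)
    have orbit: "local_smooth c0 d (\<lambda>h. ?q #> h) (\<delta> (?q, ?q))"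
      unfolding one by (rule frame_chart(2)[OF d q])
    \<comment> \<open>The orbit map of \<open>q\<close> is thus a left inverse of
      \<open>r \<mapsto> \<delta> (q, r)\<close>; the chain rule at \<open>r = q\<close> turns this
      into the equation between frame and coframe.\<close>
    have inv: "?q #> \<delta> (?q, r) = r" if r: "r \<in> fst d" for r
    proof -
      have "?q #> \<delta> (?q, r) = (\<Gamma> #> \<sigma> ?q) #> (inv (\<sigma> ?q) \<otimes> \<sigma> r)"
        using \<sigma>[OF q] by (simp add: \<delta>_def)
      also have "\<dots> = \<Gamma> #> (\<sigma> ?q \<otimes> (inv (\<sigma> ?q) \<otimes> \<sigma> r))"
        by (rule coset_carrier) (use car[OF q] car[OF r] in auto)
      also have "\<dots> = r" using car[OF q] car[OF r] \<sigma>[OF r] by (simp add: m_assoc[symmetric])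
      finally show ?thesis .
    qed
    have "frame (\<theta> x u) ?q d = u" for u
    proof -
      have "frame (\<theta> x u) ?q d = chart_deriv d d (\<lambda>r. ?q #> \<delta> (?q, r)) ?q u"
        using local_smooth_compose(2)[OF \<delta>q orbit gd c0(3), of u] frame_chart(1)[OF d q]
        by (simp add: one \<theta>_def)
      also have "\<dots> = chart_deriv d d (\<lambda>r. r) ?q u"
        using local_smooth_cong(2)[OF local_smooth_id(1)[OF gd q] gd, of "\<lambda>r. ?q #> \<delta> (?q, r)"] inv by simp
      finally show ?thesis by (simp add: local_smooth_id(2)[OF gd q])
    qed
    then show ?thesis using linear_chart_deriv[OF \<delta>q] by (simp add: \<theta>_def)
  qed
  ultimately show ?thesis by blast
qed

end

sublocale lie_quotient \<subseteq> framed_manifold N frame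
  by (intro framed_manifold.intro framed_manifold_axioms.intro N_charts.smooth_charts_axioms
      frame_vector_field linear_frame maurer_cartan)

section \<open>Brackets of invariant vector fields\<close>

lemma has_vector_derivative_quotient:
  assumes "(H has_vector_derivative B) (at (0::real))"
  shows "((\<lambda>s. (H s - H 0) /\<^sub>R s) \<longlongrightarrow> B) (at 0)"
proof -
  have "((\<lambda>s. norm (H (0 + s) - H 0 - s *\<^sub>R B) / norm s) \<longlongrightarrow> 0) (at 0)"
    using assms unfolding has_vector_derivative_def has_derivative_at by simp
  moreover have "\<forall>\<^sub>F s in at 0. norm (H (0 + s) - H 0 - s *\<^sub>R B) / norm s = norm ((H s - H 0) /\<^sub>R s - B)"
  proof -
    have "norm (H s - H 0 - s *\<^sub>R B) / norm s = norm ((H s - H 0) /\<^sub>R s - B)" if "s \<noteq> 0" for s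
    proof -
      have "(H s - H 0) /\<^sub>R s - B = (H s - H 0 - s *\<^sub>R B) /\<^sub>R s"
        using that by (simp add: scaleR_diff_right)
      then show ?thesis by (simp add: divide_inverse mult.commute)
    qed
    then show ?thesis by (auto simp: eventually_at intro!: exI[of _ 1])
  qed
  ultimately have "((\<lambda>s. norm ((H s - H 0) /\<^sub>R s - B)) \<longlongrightarrow> 0) (at 0)"
    by (rule Lim_transform_eventually)
  then show ?thesis using tendsto_norm_zero_iff LIM_zero_iff by blast
qed

text \<open>The deviation of \<open>P s\<close> from the identity is bounded by a quantity tending
  to 0. Once it is below 1/2, \<open>u s\<close> is bounded by twice \<open>P s (u s)\<close>, hence
  \<open>u\<close> itself converges to \<open>B\<close>, and subspaces are closed.\<close>

lemma limit_in_subspace: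
  fixes P :: "'i \<Rightarrow> 'a::euclidean_space \<Rightarrow> 'a"
  assumes F: "F \<noteq> bot" and S: "subspace S"
    and P: "\<forall>\<^sub>F s in F. linear (P s)" "\<And>e. ((\<lambda>s. P s e) \<longlongrightarrow> e) F"
    and u: "\<forall>\<^sub>F s in F. u s \<in> S" and lim: "((\<lambda>s. P s (u s)) \<longlongrightarrow> B) F"
  shows "B \<in> S"
proof -
  define \<delta> where "\<delta> s = (\<Sum>b\<in>Basis. norm (P s b - b))" for s
  have "((\<lambda>s. \<Sum>b\<in>Basis. norm (P s b - b)) \<longlongrightarrow> (\<Sum>b\<in>(Basis::'a set). norm (b - b))) F"
    by (intro tendsto_sum tendsto_norm tendsto_diff P(2) tendsto_const)
  then have \<delta>: "(\<delta> \<longlongrightarrow> 0) F" by (simp add: \<delta>_def[abs_def])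
  have dev: "norm (P s x - x) \<le> norm x * \<delta> s" if "linear (P s)" for s x
  proof -
    have lin: "linear (\<lambda>x. P s x - x)" by (rule linear_compose_sub[OF that linear_ident])
    have "norm (P s x - x) = norm (\<Sum>b\<in>Basis. (x \<bullet> b) *\<^sub>R (P s b - b))"
      using linear_expand_Basis[OF lin, of x] by simp
    also have "\<dots> \<le> (\<Sum>b\<in>Basis. \<bar>x \<bullet> b\<bar> * norm (P s b - b))"
      by (rule order_trans[OF norm_sum]) simp
    also have "\<dots> \<le> (\<Sum>b\<in>Basis. norm x * norm (P s b - b))"
      by (intro sum_mono mult_right_mono Basis_le_norm) auto
    finally show ?thesis by (simp add: \<delta>_def sum_distrib_left)
  qed
  have "\<forall>\<^sub>F s in F. \<delta> s < 1 / 2" using order_tendstoD(2)[OF \<delta>, of "1 / 2"] by simp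
  with P(1) have "\<forall>\<^sub>F s in F. norm (P s (u s) - u s) \<le> 2 * norm (P s (u s)) * \<delta> s"
  proof eventually_elim
    case (elim s)
    have \<delta>0: "0 \<le> \<delta> s" by (simp add: \<delta>_def sum_nonneg)
    have "norm (u s) * \<delta> s \<le> norm (u s) * (1 / 2)" using elim by (intro mult_left_mono) auto
    then have "norm (u s) \<le> 2 * norm (P s (u s))"
      using dev[OF elim(1), of "u s"] norm_triangle_ineq3[of "P s (u s)" "u s"] by simp
    then have "norm (u s) * \<delta> s \<le> 2 * norm (P s (u s)) * \<delta> s" using \<delta>0 by (rule mult_right_mono)
    then show ?case using dev[OF elim(1), of "u s"] by linarith
  qed
  moreover have "((\<lambda>s. 2 * norm (P s (u s)) * \<delta> s) \<longlongrightarrow> 2 * norm B * 0) F"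
    by (intro tendsto_intros lim \<delta>)
  ultimately have "((\<lambda>s. P s (u s) - u s) \<longlongrightarrow> 0) F"
    using Lim_null_comparison by force
  from tendsto_diff[OF lim this] have "(u \<longlongrightarrow> B) F" by simp
  then show ?thesis using Lim_in_closed_set[OF closed_subspace[OF S] u F] by blast
qed

context lie_quotient
begin

lemma act_one: "d \<in> N \<Longrightarrow> q \<in> fst d \<Longrightarrow> q #> \<one> = q"
  by (rule act_assoc(2)[OF N_in_points one_closed one_closed])

text \<open>Right translation by \<open>g\<close> maps the frame vector of \<open>Ad g w\<close> to that of \<open>w\<close>, since
  \<open>q (g h g\<inverse>) g = q g h\<close>.\<close>

lemma frame_translate:
  assumes d: "d \<in> N" "q \<in> fst d" and g: "g \<in> fst c0" "q #> g \<in> fst d"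
  shows "frame w (q #> g) d
    = chart_deriv (prod_chart d c0) d (\<lambda>p. fst p #> snd p) (q, g) (frame (Ad g w) q d, 0)"
proof -
  let ?act = "\<lambda>p. fst p #> snd p"
  have gc: "g \<in> carrier G" by (rule in_carrier[OF c0(1) g(1)])
  have conj1: "g \<otimes> \<one> \<otimes> inv g = \<one>" using gc by simp
  have gd: "good_chart d" by (rule good_N[OF d(1)])
  define f where "f h = q #> (g \<otimes> h \<otimes> inv g)" for h
  have orbit: "local_smooth c0 d (\<lambda>h. q #> h) (g \<otimes> \<one> \<otimes> inv g)"
    unfolding conj1 by (rule frame_chart(2)[OF d])
  have f: "local_smooth c0 d f \<one>" "chart_deriv c0 d f \<one> w = frame (Ad g w) q d"
    unfolding f_def
    using local_smooth_compose[OF conj_smooth[OF gc] orbit c0(3,3)] frame_chart(1)[OF d]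
    by (simp_all add: conj1 Ad_def)
  have f1: "f \<one> = q" by (simp add: f_def conj1 act_one[OF d])
  have act: "local_smooth (prod_chart d c0) d ?act (f \<one>, g)"
    unfolding f1 by (rule act_smooth[OF d(1,1) c0(1) d(2) g])
  note const = local_smooth_const[OF c0(3,2) g(1)]
  note comp = local_smooth_compose[OF local_smooth_Pair(1)[OF f(1) const(1)] act c0(3) good_prod_chart[OF gd c0(3)]]
  have "chart_deriv c0 d (\<lambda>h. ?act (f h, g)) \<one> w
      = chart_deriv (prod_chart d c0) d ?act (q, g) (frame (Ad g w) q d, 0)"
    using comp(2)[of w] local_smooth_Pair(2)[OF f(1) const(1)] by (simp add: f1 f(2) const(2))
  moreover have "chart_deriv c0 d (\<lambda>h. ?act (f h, g)) \<one> = chart_deriv c0 d (\<lambda>h. (q #> g) #> h) \<one>"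
  proof (rule local_smooth_cong(2)[OF comp(1) c0(3)])
    fix h assume "h \<in> fst c0"
    then have h: "h \<in> carrier G" using in_carrier[OF c0(1)] by blast
    have q: "q \<in> points N" by (rule N_in_points[OF d])
    show "?act (f h, g) = (q #> g) #> h"
      using gc h by (simp add: f_def act_assoc(1)[OF q] m_assoc)
  qed
  ultimately show ?thesis using frame_chart(1)[OF d(1) g(2)] by simp
qed

text \<open>The bracket is the derivative at 0 of the difference between \<open>frame w\<close> at
  \<open>q #> g s\<close> and its value at \<open>q\<close> carried there by right translation. By
  \<open>frame_translate\<close> this difference is the translate of the frame vector of
  \<open>Ad (g s) w - w\<close>, an element of level \<open>j\<close>, and the limit of the
  difference quotients stays in the corresponding subspace.\<close>

lemma frame_bracket:
  assumes d: "d \<in> N" "q \<in> fst d" and w: "w \<in> flag (Suc j)"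
  shows "lie_bracket N (frame v) (frame w) q d \<in> (\<lambda>u. frame u q d) ` flag j"
proof -
  let ?P = "prod_chart d c0" and ?act = "\<lambda>p. fst p #> snd p"
  define \<Phi> where "\<Phi> = snd d \<circ> ?act \<circ> chart_inv ?P"
  define x0 where "x0 = snd d q"
  define y0 where "y0 = snd c0 \<one>"
  define D where "D z = frechet_derivative \<Phi> (at z)" for z
  define X where "X w x = frame w (chart_inv d x) d" for w x
  define a where "a = frame w q d"
  let ?O = "snd d ` fst d"
  have gd: "good_chart d" by (rule good_N[OF d(1)])
  have O: "open ?O" by (rule N_charts.open_image[OF d(1)])
  have q: "q \<in> points N" by (rule N_in_points[OF d])
  have x0: "x0 \<in> ?O" "chart_inv d x0 = q" using chart_inv_left[OF gd d(2)] d(2) by (simp_all add: x0_def)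
  have "local_smooth ?P d ?act (q, \<one>)"
    by (rule act_smooth[OF d(1,1) c0(1) d(2) c0(2)]) (simp add: act_one[OF d] d)
  then obtain W where W: "open W" "(x0, y0) \<in> W" "W \<subseteq> snd ?P ` fst ?P"
    "\<And>z. z \<in> W \<Longrightarrow> ?act (chart_inv ?P z) \<in> fst d" "smooth_on W \<Phi>"
    unfolding local_smooth_def \<Phi>_def x0_def y0_def prod_chart_simps by blast
  have deriv: "chart_deriv ?P d ?act (r, g) = D (snd d r, snd c0 g)" for r g
    by (simp add: chart_deriv_def D_def \<Phi>_def)
  have X_smooth: "smooth_on ?O (X w)" for w
    unfolding X_def by (rule field_smooth[OF frame_vector_field d(1)])
  have X_eq: "X w x = D (x, y0) (0, w)" if x: "x \<in> ?O" for w x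
  proof -
    have r: "chart_inv d x \<in> fst d" "snd d (chart_inv d x) = x" using chart_inv_in[OF x] by auto
    have "X w x = chart_deriv ?P d ?act (chart_inv d x, \<one>) (0, w)"
      unfolding X_def frame_chart(1)[OF d(1) r(1)]
      by (rule orbit_smooth(2)[OF d(1,1) r(1) c0(1,2)]) (simp add: act_one[OF d(1) r(1)] r(1))
    then show ?thesis by (simp add: deriv r(2) y0_def)
  qed
  have X0: "X w x0 = frame w q d" for w by (simp add: X_def x0(2))
  have D_first: "D (x0, y0) (e, 0) = e" for e
  proof -
    note id = local_smooth_id[OF gd d(2)] and const = local_smooth_const[OF gd d(2) c0(2)]
    have act: "local_smooth ?P d ?act (q, \<one>)"
      by (rule act_smooth[OF d(1,1) c0(1) d(2) c0(2)]) (simp add: act_one[OF d] d)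
    note comp = local_smooth_compose[OF local_smooth_Pair(1)[OF id(1) const(1)] act gd good_prod_chart[OF gd c0(3)]]
    have "chart_deriv d d (\<lambda>r. ?act (r, \<one>)) q e = D (x0, y0) (e, 0)"
      using comp(2)[of e] local_smooth_Pair(2)[OF id(1) const(1)]
      by (simp add: id(2) const(2) deriv x0_def y0_def)
    moreover have "chart_deriv d d (\<lambda>r. ?act (r, \<one>)) q = chart_deriv d d (\<lambda>r. r) q"
      by (rule local_smooth_cong(2)[OF comp(1) gd]) (simp add: act_one[OF d(1)])
    ultimately show ?thesis by (simp add: id(2))
  qed
  define l where "l s = (x0, y0 + s *\<^sub>R v)" for s
  define g where "g s = chart_inv c0 (y0 + s *\<^sub>R v)" for s
  define T where "T = l -` W"
  have T: "open T" unfolding T_def l_def by (rule open_vimage[OF W(1)]) (intro continuous_intros)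
  have l0: "l 0 = (x0, y0)" by (simp add: l_def)
  have T0: "0 \<in> T" using W(2) by (simp add: T_def l0)
  have g: "g s \<in> fst c0" "snd c0 (g s) = y0 + s *\<^sub>R v" "q #> g s \<in> fst d" "snd d (q #> g s) = \<Phi> (l s)"
    if "s \<in> T" for s
  proof -
    have ls: "l s \<in> W" using that by (simp add: T_def)
    then have "l s \<in> ?O \<times> snd c0 ` fst c0" using W(3) unfolding image_prod_chart by blast
    then have y: "y0 + s *\<^sub>R v \<in> snd c0 ` fst c0" by (simp add: l_def)
    then show "g s \<in> fst c0" "snd c0 (g s) = y0 + s *\<^sub>R v" using chart_inv_in[OF y] by (simp_all add: g_def)
    have "chart_inv ?P (l s) = (q, g s)"
      unfolding l_def g_def using chart_inv_prod[OF gd c0(3) x0(1) y] x0(2) by simp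
    then show "q #> g s \<in> fst d" "snd d (q #> g s) = \<Phi> (l s)"
      using W(4)[OF ls] by (simp_all add: \<Phi>_def)
  qed
  have g0: "g 0 = \<one>" using chart_inv_left[OF c0(3,2)] by (simp add: g_def y0_def)
  have D_lin: "linear (D z)" if "z \<in> W" for z
    unfolding D_def by (rule smooth_on_linear_derivative[OF W(5) that])
  \<comment> \<open>Here \<open>D (l s) (a, 0)\<close> is the value \<open>a\<close> of the field at
    \<open>q\<close>, moved by the differential of right translation by \<open>g s\<close>.\<close>
  define H where "H s = X w (\<Phi> (l s)) - D (l s) (a, 0)" for s
  have H: "H s = D (l s) (frame (Ad (g s) w - w) q d, 0)" if s: "s \<in> T" for s
  proof -
    have ls: "l s \<in> W" using s by (simp add: T_def)
    have "X w (\<Phi> (l s)) = frame w (q #> g s) d"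
      using g(4)[OF s] chart_inv_left[OF gd g(3)[OF s]] by (simp add: X_def)
    also have "\<dots> = D (l s) (frame (Ad (g s) w) q d, 0)"
      using frame_translate[OF d g(1)[OF s] g(3)[OF s]] g(2)[OF s] by (simp add: deriv l_def x0_def)
    finally show ?thesis
      unfolding H_def a_def linear_diff[OF linear_frame]
      using linear_diff[OF D_lin[OF ls], of "(frame (Ad (g s) w) q d, 0)" "(frame w q d, 0)"] by simp
  qed
  define B where "B = lie_bracket N (frame v) (frame w) q d"
  have l': "(l has_derivative (\<lambda>h. (0, h *\<^sub>R v))) (at 0)"
    unfolding l_def by (auto intro!: derivative_eq_intros)
  have \<Phi>0: "\<Phi> (l 0) = x0" using g(4)[OF T0] by (simp add: g0 act_one[OF d] x0_def)
  have "(H has_vector_derivative B) (at 0)"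
  proof -
    have DX: "(X w has_derivative frechet_derivative (X w) (at x0)) (at x0)" for w
      by (rule smooth_on_has_derivative[OF X_smooth x0(1)])
    have "((\<lambda>s. \<Phi> (l s)) has_derivative (\<lambda>h. D (x0, y0) (0, h *\<^sub>R v))) (at 0)"
      by (rule has_derivative_compose[OF l']) (use smooth_on_has_derivative[OF W(5,2)] in \<open>simp add: l0 D_def\<close>)
    then have "((\<lambda>s. X w (\<Phi> (l s))) has_derivative (\<lambda>h. frechet_derivative (X w) (at x0) (D (x0, y0) (0, h *\<^sub>R v)))) (at 0)"
      by (rule has_derivative_compose) (use DX in \<open>simp add: \<Phi>0\<close>)
    moreover have "D (x0, y0) (0, h *\<^sub>R v) = h *\<^sub>R frame v q d" for h
      using X_eq[OF x0(1)] linear_cmul[OF D_lin[OF W(2)], of h "(0, v)"] by (simp add: X0)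
    ultimately have 1: "((\<lambda>s. X w (\<Phi> (l s))) has_derivative
        (\<lambda>h. h *\<^sub>R frechet_derivative (X w) (at x0) (frame v q d))) (at 0)"
      using linear_cmul[OF smooth_on_linear_derivative[OF X_smooth x0(1)]] by simp
    define Q where "Q z = D z (a, 0)" for z
    have Q: "smooth_on W Q" unfolding Q_def D_def by (rule smooth_on_frechet_derivative[OF W(5)])
    have R: "smooth_on W (\<lambda>z. D z (0, v))" unfolding D_def by (rule smooth_on_frechet_derivative[OF W(5)])
    have "((\<lambda>x. D (x, y0) (0, v)) has_derivative
        (\<lambda>h. frechet_derivative (\<lambda>z. D z (0, v)) (at (x0, y0)) (h, 0))) (at x0)"
      by (rule has_derivative_compose[where f = "\<lambda>x. (x, y0)", OF _ smooth_on_has_derivative[OF R W(2)]])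
         (auto intro!: derivative_eq_intros)
    then have "(X v has_derivative (\<lambda>h. frechet_derivative (\<lambda>z. D z (0, v)) (at (x0, y0)) (h, 0))) (at x0)"
      by (rule has_derivative_transform_within_open[OF _ O x0(1)]) (simp add: X_eq)
    from frechet_derivative_at[OF this, symmetric]
    have "frechet_derivative (X v) (at x0) a = frechet_derivative (\<lambda>z. D z (0, v)) (at (x0, y0)) (a, 0)" by simp
    \<comment> \<open>As \<open>X v\<close> is the partial derivative of \<open>\<Phi>\<close> in
      the group direction \<open>v\<close>, its derivative along \<open>a\<close> is a mixed second
      derivative. Interchanging the order gives the change of the translated vector \<open>a\<close>
      along the curve, the second term of the bracket.\<close>
    also have "\<dots> = frechet_derivative Q (at (x0, y0)) (0, v)"
      unfolding Q_def D_def by (rule second_derivative_commute[OF W(1,2,5)])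
    finally have DQ: "frechet_derivative Q (at (x0, y0)) (0, v) = frechet_derivative (X v) (at x0) a" ..
    have "((\<lambda>s. Q (l s)) has_derivative (\<lambda>h. frechet_derivative Q (at (x0, y0)) (0, h *\<^sub>R v))) (at 0)"
      by (rule has_derivative_compose[OF l']) (use smooth_on_has_derivative[OF Q W(2)] in \<open>simp add: l0\<close>)
    moreover have "frechet_derivative Q (at (x0, y0)) (0, h *\<^sub>R v) = h *\<^sub>R frechet_derivative (X v) (at x0) a" for h
      using linear_cmul[OF smooth_on_linear_derivative[OF Q W(2)], of h "(0, v)"] by (simp add: DQ)
    ultimately have 2: "((\<lambda>s. Q (l s)) has_derivative (\<lambda>h. h *\<^sub>R frechet_derivative (X v) (at x0) a)) (at 0)"
      by simp
    have "B = frechet_derivative (X w) (at x0) (frame v q d) - frechet_derivative (X v) (at x0) a"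
      using d by (simp add: B_def lie_bracket_def X_def[abs_def] x0_def a_def)
    then show ?thesis
      using has_derivative_diff[OF 1 2]
      by (simp add: has_vector_derivative_def H_def[abs_def] Q_def scaleR_diff_right)
  qed
  then have "((\<lambda>s. (H s - H 0) /\<^sub>R s) \<longlongrightarrow> B) (at 0)"
    by (rule has_vector_derivative_quotient)
  moreover have "H 0 = 0" using \<Phi>0 by (simp add: H_def X0 l0 D_first a_def)
  ultimately have lim: "((\<lambda>s. H s /\<^sub>R s) \<longlongrightarrow> B) (at 0)" by simp
  define u where "u s = frame ((Ad (g s) w - w) /\<^sub>R s) q d" for s
  have ev: "\<forall>\<^sub>F s in at 0. s \<in> T" using eventually_at_topological T T0 by blast
  have S: "subspace ((\<lambda>u. frame u q d) ` flag j)"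
  proof (rule linear_subspace_image[OF _ subspace_flag])
    show "linear (\<lambda>u. frame u q d)"
      using linear_compose[OF linear_frame linear_apply_tvec] by (simp add: comp_def)
  qed
  show ?thesis
    unfolding B_def[symmetric]
  \<comment> \<open>The differentials of the right translations tend to the identity as
    \<open>s\<close> tends to 0, so the translation is removed in the limit.\<close>
  proof (rule limit_in_subspace[OF _ S, where P = "\<lambda>s e. D (l s) (e, 0)" and u = u and F = "at 0"])
    show "\<forall>\<^sub>F s in at 0. linear (\<lambda>e. D (l s) (e, 0))"
      using ev
    proof eventually_elim
      case (elim s)
      then have "linear (D (l s))" using D_lin by (simp add: T_def)
      moreover have "linear (\<lambda>e :: 'e. (e, 0 :: 'e))" by (rule linearI) simp_all
      ultimately show ?case using linear_compose[of "\<lambda>e. (e, 0)" "D (l s)"] by (simp add: comp_def)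
    qed
    show "((\<lambda>s. D (l s) (e, 0)) \<longlongrightarrow> e) (at 0)" for e
    proof -
      have 1: "isCont (\<lambda>z. D z (e, 0)) (l 0)"
        using smooth_on_continuous[OF smooth_on_frechet_derivative[OF W(5)]] W(1,2)
        by (simp add: D_def l0 continuous_on_eq_continuous_at)
      have 2: "isCont l 0" unfolding l_def by (intro continuous_intros)
      have "isCont (\<lambda>s. D (l s) (e, 0)) 0"
        by (rule isCont_o2[where f = l and g = "\<lambda>z. D z (e, 0)", OF 2 1])
      then show ?thesis by (simp add: isCont_def l0 D_first)
    qed
    show "\<forall>\<^sub>F s in at 0. u s \<in> (\<lambda>u. frame u q d) ` flag j"
      using ev
    proof eventually_elim
      case (elim s)
      have "g s \<in> carrier G" by (rule in_carrier[OF c0(1) g(1)[OF elim]])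
      then have "Ad (g s) w - w \<in> flag j" using w by simp
      then have "(Ad (g s) w - w) /\<^sub>R s \<in> flag j" by (rule subspace_scale[OF subspace_flag])
      then show ?case unfolding u_def by blast
    qed
    have "\<forall>\<^sub>F s in at 0. H s /\<^sub>R s = D (l s) (u s, 0)"
      using ev
    proof eventually_elim
      case (elim s)
      then have ls: "l s \<in> W" by (simp add: T_def)
      have "u s = (1 / s) *\<^sub>R frame (Ad (g s) w - w) q d"
        unfolding u_def linear_cmul[OF linear_frame] by (simp add: divide_inverse)
      then show ?case
        using H[OF elim] linear_cmul[OF D_lin[OF ls], of "1 / s" "(frame (Ad (g s) w - w) q d, 0)"]
        by (simp add: divide_inverse)
    qed
    then show "((\<lambda>s. D (l s) (u s, 0)) \<longlongrightarrow> B) (at 0)"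
      using lim by (rule Lim_transform_eventually[rotated])
  qed simp
qed

end

lemma (in smooth_charts) differential_tangent:
  assumes f: "smooth_map N N f" and p: "p \<in> points N"
  shows "differential N N f p v \<in> tangent_space N (f p)"
proof (rule tangentI)
  let ?c = "chart_at N p"
  have c: "?c \<in> N" "p \<in> fst ?c" using chart_at[OF p] by auto
  have eq: "differential N N f p v d = chart_deriv ?c d f p (v ?c)" if "d \<in> N" "f p \<in> fst d" for d
    using that by (simp add: differential_def chart_deriv_def Let_def)
  show "differential N N f p v d = 0" if "\<not> (d \<in> N \<and> f p \<in> fst d)" for d
    using that unfolding differential_def Let_def by (rule if_not_P)
  fix d d' assume d: "d \<in> N" "d' \<in> N" "f p \<in> fst d" "f p \<in> fst d'"
  have fs: "local_smooth ?c d f p" by (rule smooth_map_local_smooth[OF f c(1) d(1) c(2) d(3) good[OF c(1)]])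
  show "differential N N f p v d' = chart_deriv d d' (\<lambda>x. x) (f p) (differential N N f p v d)"
    unfolding eq[OF d(1,3)] eq[OF d(2,4)]
    by (rule local_smooth_compose(2)[OF fs transition[OF d] good[OF c(1)] good[OF d(1)]])
qed

context lie_quotient
begin

text \<open>The structure at the identity, read in \<open>c0\<close>. By left invariance it is the
  constant matrix of the induced structure in the frame at every point, see
  \<open>holomorphic_frame\<close>.\<close>

definition invariant_part :: "('g, 'e) endofield \<Rightarrow> 'e \<Rightarrow> 'e" where
  "invariant_part I w = I \<one> (coord_vector A c0 \<one> w) c0"

lemma coord_vector_one: "coord_vector A c0 \<one> w \<in> tangent_space A \<one>" "coord_vector A c0 \<one> w c0 = w"
  by (rule G_charts.coord_vector_tangent[OF c0(1,2)])+

lemma one_point: "\<one> \<in> points A"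
  by (simp add: points_G)

text \<open>Both sides are the derivative at the identity of
  \<open>h \<mapsto> \<Gamma> #> (g \<otimes> h)\<close>.\<close>

lemma projection_differential:
  assumes g: "g \<in> carrier G" and q: "\<Gamma> #> g \<in> points N" and V: "V \<in> tangent_space A \<one>"
    and \<pi>: "smooth_map A N (\<lambda>g. \<Gamma> #> g)" and L: "smooth_map A A (\<lambda>h. g \<otimes> h)"
  shows "differential A N (\<lambda>g. \<Gamma> #> g) g (differential A A (\<lambda>h. g \<otimes> h) \<one> V) = frame (V c0) (\<Gamma> #> g)"
proof
  fix d
  let ?c = "chart_at A g"
  have c: "?c \<in> A" "g \<in> fst ?c" using G_charts.chart_at[of g] g by (auto simp: points_G)
  have L': "differential A A (\<lambda>h. g \<otimes> h) \<one> V ?c = chart_deriv c0 ?c (\<lambda>h. g \<otimes> h) \<one> (V c0)"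
    using c g by (simp add: differential_def chart_deriv_def Let_def c0_def)
  show "differential A N (\<lambda>g. \<Gamma> #> g) g (differential A A (\<lambda>h. g \<otimes> h) \<one> V) d = frame (V c0) (\<Gamma> #> g) d"
  proof (cases "d \<in> N \<and> \<Gamma> #> g \<in> fst d")
    case True
    then have d: "d \<in> N" "\<Gamma> #> g \<in> fst d" by auto
    have Ls: "local_smooth c0 ?c (\<lambda>h. g \<otimes> h) \<one>"
      by (rule smooth_map_local_smooth[OF L c0(1) c(1) c0(2) _ c0(3)]) (use c g in simp)
    have \<pi>s: "local_smooth ?c d (\<lambda>g. \<Gamma> #> g) (g \<otimes> \<one>)"
      using smooth_map_local_smooth[OF \<pi> c(1) d(1) c(2) d(2) G_charts.good[OF c(1)]] g by simp
    note comp = local_smooth_compose[OF Ls \<pi>s c0(3) G_charts.good[OF c(1)]]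
    have "chart_deriv c0 d (\<lambda>h. \<Gamma> #> (g \<otimes> h)) \<one> = chart_deriv c0 d (\<lambda>h. (\<Gamma> #> g) #> h) \<one>"
      by (rule local_smooth_cong(2)[OF comp(1) c0(3)])
         (simp add: coset_carrier[OF g in_carrier[OF c0(1)]])
    moreover have "differential A N (\<lambda>g. \<Gamma> #> g) g (differential A A (\<lambda>h. g \<otimes> h) \<one> V) d
        = chart_deriv ?c d (\<lambda>g. \<Gamma> #> g) g (chart_deriv c0 ?c (\<lambda>h. g \<otimes> h) \<one> (V c0))"
      using d L' by (simp add: differential_def[of A N] chart_deriv_def[of ?c] Let_def)
    ultimately show ?thesis
      using comp(2)[of "V c0"] frame_chart(1)[OF d] g by simp
  next
    case False
    then show ?thesis by (auto simp: differential_def frame_def Let_def)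
  qed
qed

text \<open>A frame vector is moved from the identity by a left translation and then by the
  projection; the structures commute with both differentials.\<close>

lemma holomorphic_frame:
  assumes inv: "left_invariant G A I'" and hol: "holomorphic_map A I' N I (\<lambda>g. \<Gamma> #> g)"
    and I': "smooth_endofield A I'" and q: "q \<in> points N"
  shows "I q (frame w q) = frame (invariant_part I' w) q"
proof -
  obtain g where g: "g \<in> carrier G" "q = \<Gamma> #> g" using points_N[OF q] .
  let ?V = "coord_vector A c0 \<one> w" and ?\<pi> = "\<lambda>g. \<Gamma> #> g" and ?L = "\<lambda>h. g \<otimes> h"
  have V: "?V \<in> tangent_space A \<one>" by (rule coord_vector_one)
  have IV: "I' \<one> ?V \<in> tangent_space A \<one>"
    using I' V one_point unfolding smooth_endofield_def linear_map_on_def by blast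
  have L: "smooth_map A A ?L" and \<pi>: "smooth_map A N ?\<pi>"
    using inv hol g unfolding left_invariant_def holomorphic_map_def by blast+
  have LV: "differential A A ?L \<one> ?V \<in> tangent_space A g"
    using G_charts.differential_tangent[OF L one_point, of ?V] g by simp
  have "differential A A ?L \<one> (I' \<one> ?V) = I' (?L \<one>) (differential A A ?L \<one> ?V)"
    using inv g(1) one_point V unfolding left_invariant_def holomorphic_map_def by blast
  then have 1: "differential A A ?L \<one> (I' \<one> ?V) = I' g (differential A A ?L \<one> ?V)" using g by simp
  have 2: "differential A N ?\<pi> g (I' g (differential A A ?L \<one> ?V))
      = I (\<Gamma> #> g) (differential A N ?\<pi> g (differential A A ?L \<one> ?V))"
    using hol g(1) LV points_G unfolding holomorphic_map_def by blast
  have q': "\<Gamma> #> g \<in> points N" using q g by simp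
  have "frame (invariant_part I' w) q = differential A N ?\<pi> g (differential A A ?L \<one> (I' \<one> ?V))"
    using projection_differential[OF g(1) q' IV \<pi> L] g(2) by (simp add: invariant_part_def)
  also have "\<dots> = I q (frame w q)"
    unfolding 1 2 projection_differential[OF g(1) q' V \<pi> L] coord_vector_one(2) g(2) ..
  finally show ?thesis ..
qed

lemma linear_invariant_part:
  assumes "smooth_endofield A I'"
  shows "linear (invariant_part I')"
proof -
  note T = G_charts.subspace_tangent_space[of \<one>]
  note cv = coord_vector_one
  have lin: "linear_map_on (tangent_space A \<one>) (tangent_space A \<one>) (I' \<one>)"
    using assms one_point by (simp add: smooth_endofield_def)
  have cv_add: "coord_vector A c0 \<one> (x + y) = coord_vector A c0 \<one> x + coord_vector A c0 \<one> y" for x y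
    by (rule G_charts.tangent_eqI[OF _ _ c0(1,2)]) (simp_all add: cv subspace_add[OF T])
  have cv_scale: "coord_vector A c0 \<one> (r *\<^sub>R x) = r *\<^sub>R coord_vector A c0 \<one> x" for r x
    by (rule G_charts.tangent_eqI[OF _ _ c0(1,2)]) (simp_all add: cv subspace_scale[OF T])
  show ?thesis
    by (rule linearI) (use lin cv(1) in \<open>simp_all add: invariant_part_def cv_add cv_scale linear_map_on_def\<close>)
qed

lemma coord_vector_invariant_part:
  assumes "smooth_endofield A I'"
  shows "coord_vector A c0 \<one> (invariant_part I' w) = I' \<one> (coord_vector A c0 \<one> w)"
proof -
  have "I' \<one> (coord_vector A c0 \<one> w) \<in> tangent_space A \<one>"
    using assms coord_vector_one(1) one_point unfolding smooth_endofield_def linear_map_on_def by blast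
  from G_charts.tangent_coord_vector[OF this c0(1,2)] show ?thesis by (simp add: invariant_part_def)
qed

end

section \<open>Holonomy of the Obata connection in a quaternionic frame\<close>

text \<open>What remains of the group: structures that are constant in the frame, and a flag lowered
  by brackets of frame fields. Nilpotency survives only in \<open>Z_k\<close> and
  \<open>bracket_Z\<close>.\<close>

locale quaternionic_frame = framed_connection N frame nabla
  for N :: "('p, 'e::euclidean_space) chart set" and frame and nabla :: "('p, 'e) connection" +
  fixes I J K :: "('p, 'e) endofield" and I0 J0 K0 :: "'e \<Rightarrow> 'e" and Z :: "nat \<Rightarrow> 'e set" and k n :: nat
  assumes obata: "obata_connection N I J K nabla"
    and I_frame: "q \<in> points N \<Longrightarrow> I q (frame w q) = frame (I0 w) q"
    and J_frame: "q \<in> points N \<Longrightarrow> J q (frame w q) = frame (J0 w) q"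
    and K_frame: "q \<in> points N \<Longrightarrow> K q (frame w q) = frame (K0 w) q"
    and linear_IJK: "linear I0" "linear J0" "linear K0"
    and I0_I0: "I0 (I0 x) = - x" and J0_J0: "J0 (J0 x) = - x" and I0_J0: "I0 (J0 x) = - J0 (I0 x)"
    and subspace_Z: "subspace (Z j)" and Z_0: "Z 0 = {0}" and Z_k: "Z k = UNIV" and Z_mono: "Z j \<subseteq> Z (Suc j)"
    and bracket_Z: "q \<in> points N \<Longrightarrow> w \<in> Z (Suc j) \<Longrightarrow> coords q (lie_bracket N (frame v) (frame w) q) \<in> Z j"
    and dimension: "DIM('e) = 4 * n"

sublocale quaternionic_frame \<subseteq> linear_complex_structure I0
  by (rule linear_complex_structure.intro[OF linear_IJK(1) I0_I0])

context quaternionic_frame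
begin

text \<open>As \<open>P\<close> is constant in the frame, it sends \<open>frame w\<close> to another
  frame field, so that parallelism becomes commutation of two matrices.\<close>

lemma parallel_christoffel:
  assumes par: "parallel_endofield N nabla P" and P: "\<And>q w. q \<in> points N \<Longrightarrow> P q (frame w q) = frame (P0 w) q"
    and q: "q \<in> points N"
  shows "christoffel q u (P0 w) = P0 (christoffel q u w)"
proof -
  have v: "frame u q \<in> tangent_space N q" by (rule frame_tangent[OF q])
  have "nabla (frame (P0 w)) q (frame u q) = nabla (\<lambda>q. P q (frame w q)) q (frame u q)"
    by (rule nabla_cong[OF frame_field _ q v]) (rule P[symmetric])
  also have "\<dots> = P q (nabla (frame w) q (frame u q))"
    using par frame_field q v unfolding parallel_endofield_def by blast
  also have "\<dots> = frame (P0 (christoffel q u w)) q"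
    by (simp only: nabla_frame[OF q v] coords_frame[OF q] P[OF q])
  finally show ?thesis by (simp only: nabla_frame[OF q v] coords_frame[OF q]) (metis coords_frame[OF q])
qed

lemma christoffel_IJK:
  assumes "q \<in> points N"
  shows "christoffel q u (I0 w) = I0 (christoffel q u w)" "christoffel q u (J0 w) = J0 (christoffel q u w)"
    "christoffel q u (K0 w) = K0 (christoffel q u w)"
proof -
  have par: "parallel_endofield N nabla I" "parallel_endofield N nabla J" "parallel_endofield N nabla K"
    using obata by (simp_all add: obata_connection_def)
  show "christoffel q u (I0 w) = I0 (christoffel q u w)"
    using parallel_christoffel[where P = I and ?P0.0 = I0 and q = q and u = u and w = w] par(1) I_frame assms by blast
  show "christoffel q u (J0 w) = J0 (christoffel q u w)"
    using parallel_christoffel[where P = J and ?P0.0 = J0 and q = q and u = u and w = w] par(2) J_frame assms by blast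
  show "christoffel q u (K0 w) = K0 (christoffel q u w)"
    using parallel_christoffel[where P = K and ?P0.0 = K0 and q = q and u = u and w = w] par(3) K_frame assms by blast
qed

lemma christoffel_torsion:
  assumes q: "q \<in> points N"
  shows "christoffel q u w - christoffel q w u = coords q (lie_bracket N (frame u) (frame w) q)"
proof -
  have "nabla (frame w) q (frame u q) - nabla (frame u) q (frame w q) = lie_bracket N (frame u) (frame w) q"
    using obata frame_field q unfolding obata_connection_def torsion_free_def by blast
  then show ?thesis by (simp add: christoffel_def linear_diff[OF linear_coords[OF q], symmetric])
qed

lemma christoffel_traces:
  assumes q: "q \<in> points N"
  shows "tr (christoffel q u) = 0" "tr (\<lambda>w. I0 (christoffel q u w)) = 0"
proof -
  have step: "christoffel q v w - christoffel q w v \<in> Z j" if "w \<in> Z (Suc j)" for j v w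
    unfolding christoffel_torsion[OF q] by (rule bracket_Z[OF q that])
  show "tr (christoffel q u) = 0" "tr (\<lambda>w. I0 (christoffel q u w)) = 0"
    using obata_traces_zero[of "christoffel q" I0 J0 Z k u, OF linear_christoffel(2)[OF q] linear_christoffel(1)[OF q]
        linear_IJK(1,2) I0_I0 J0_J0 I0_J0 christoffel_IJK(1,2)[OF q] subspace_Z Z_0 Z_k Z_mono step]
    by blast+
qed

context
  fixes p :: 'p and h :: "('p, 'e) tvec \<Rightarrow> ('p, 'e) tvec"
  assumes p: "p \<in> points N" and h: "h \<in> holonomy_group N nabla p"
begin

text \<open>\<open>\<nu> x\<close> consists of the frame coordinates of the parallel field along the loop that starts at \<open>frame x p\<close>.\<close>

lemma transport_solutions:
  "\<exists>m t \<Theta> \<nu>. piecewise_complex_ode m t \<Theta> I0 \<and>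
    (\<forall>i<m. \<forall>s\<in>{t i..t (Suc i)}. \<forall>x. \<Theta> i s (J0 x) = J0 (\<Theta> i s x) \<and> \<Theta> i s (K0 x) = K0 (\<Theta> i s x)) \<and>
    (\<forall>x. piecewise_ode.sol m t \<Theta> (\<nu> x) \<and> \<nu> x 0 = x \<and> h (frame x p) = frame (\<nu> x 1) p)"
proof -
  obtain \<gamma> m t where sub: "subdivision m t" and \<gamma>: "\<And>i. i < m \<Longrightarrow> smooth_curve_on N (t i) (t (Suc i)) \<gamma>"
    and loop: "\<gamma> 0 = p" "\<gamma> 1 = p"
    and V: "\<forall>v\<in>tangent_space N p. \<exists>V. parallel_along N nabla m t \<gamma> V \<and> V 0 = v \<and> V 1 = h v"
    using h unfolding holonomy_group_def by blast
  have "\<forall>x. \<exists>V. parallel_along N nabla m t \<gamma> V \<and> V 0 = frame x p \<and> V 1 = h (frame x p)"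
    using V frame_tangent[OF p] by blast
  then obtain W where W: "\<And>x. parallel_along N nabla m t \<gamma> (W x)" "\<And>x. W x 0 = frame x p"
    "\<And>x. W x 1 = h (frame x p)" by metis
  define \<Theta> where "\<Theta> = (\<lambda>i. transport_coeff \<gamma> {t i..t (Suc i)})"
  have ode: "piecewise_ode m t \<Theta>"
    unfolding \<Theta>_def by (rule parallel_transport_ode(1)[OF sub \<gamma>])
  have q: "\<gamma> s \<in> points N" if "i < m" "s \<in> {t i..t (Suc i)}" for i s
    by (rule smooth_curve_points[OF \<gamma>[OF that(1)] that(2)])
  have 1: "piecewise_complex_ode m t \<Theta> I0"
    by (intro piecewise_complex_ode.intro piecewise_complex_ode_axioms.intro ode linear_complex_structure_axioms)
       (simp_all add: \<Theta>_def transport_coeff_def christoffel_IJK(1)[OF q] christoffel_traces[OF q])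
  have 2: "\<Theta> i s (J0 x) = J0 (\<Theta> i s x)" "\<Theta> i s (K0 x) = K0 (\<Theta> i s x)"
    if "i < m" "s \<in> {t i..t (Suc i)}" for i s x
    by (simp_all add: \<Theta>_def transport_coeff_def christoffel_IJK[OF q[OF that]])
  have 3: "piecewise_ode.sol m t \<Theta> (\<lambda>s. coords (\<gamma> s) (W x s))" for x
    unfolding \<Theta>_def by (rule parallel_transport_ode(2)[OF sub \<gamma> W(1)])
  have 4: "coords (\<gamma> 0) (W x 0) = x" for x by (simp add: loop W(2) coords_frame[OF p])
  have "W x 1 \<in> tangent_space N (\<gamma> 1)" for x
    using W(1)[of x] unfolding parallel_along_def by simp
  then have 5: "h (frame x p) = frame (coords (\<gamma> 1) (W x 1)) p" for x
    using frame_coords[OF p] by (simp add: loop W(3))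
  show ?thesis
    by (intro exI[of _ m] exI[of _ t] exI[of _ \<Theta>] exI[of _ "\<lambda>x s. coords (\<gamma> s) (W x s)"])
       (use 1 2 3 4 5 in blast)
qed

definition hol :: "'e \<Rightarrow> 'e" where
  "hol x = coords p (h (frame x p))"

text \<open>In coordinates the holonomy sends an initial value to the value at time 1 of its
  solution. The linear properties follow from uniqueness of solutions, and invariance of forms is
  Liouville's formula.\<close>

lemma hol_properties:
  shows h_frame: "h (frame x p) = frame (hol x) p" and linear_hol: "linear hol" and inj_hol: "inj hol"
    and hol_I: "hol (I0 x) = I0 (hol x)" and hol_J: "hol (J0 x) = J0 (hol x)" and hol_K: "hol (K0 x) = K0 (hol x)"
    and hol_calt: "\<And>\<Omega> xs. calt I0 (2 * n) \<Omega> \<Longrightarrow> length xs = 2 * n \<Longrightarrow> \<Omega> (map hol xs) = \<Omega> xs"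
proof -
  obtain m t \<Theta> \<nu> where ode: "piecewise_complex_ode m t \<Theta> I0"
    and comm: "\<forall>i<m. \<forall>s\<in>{t i..t (Suc i)}. \<forall>x. \<Theta> i s (J0 x) = J0 (\<Theta> i s x) \<and> \<Theta> i s (K0 x) = K0 (\<Theta> i s x)"
    and sols: "\<forall>x. piecewise_ode.sol m t \<Theta> (\<nu> x) \<and> \<nu> x 0 = x \<and> h (frame x p) = frame (\<nu> x 1) p"
    using transport_solutions by blast
  have \<Theta>_J: "\<Theta> i s (J0 x) = J0 (\<Theta> i s x)" and \<Theta>_K: "\<Theta> i s (K0 x) = K0 (\<Theta> i s x)"
    if "i < m" "s \<in> {t i..t (Suc i)}" for i s x using comm that by blast+
  have \<nu>: "piecewise_ode.sol m t \<Theta> (\<nu> x)" "\<nu> x 0 = x" "h (frame x p) = frame (\<nu> x 1) p" for x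
    using sols by blast+
  interpret piecewise_complex_ode m t \<Theta> I0 by (rule ode)
  have hol: "hol x = \<nu> x 1" for x unfolding hol_def \<nu>(3) by (rule coords_frame[OF p])
  show "h (frame x p) = frame (hol x) p" for x by (simp add: hol \<nu>(3))
  \<comment> \<open>Both sides are the values at time 1 of solutions that start at
    \<open>L x\<close>.\<close>
  have lin: "hol (L x) = L (hol x)"
    if "linear L" "\<And>i s x. i < m \<Longrightarrow> s \<in> {t i..t (Suc i)} \<Longrightarrow> \<Theta> i s (L x) = L (\<Theta> i s x)" for L x
    unfolding hol by (rule sol_unique[OF \<nu>(1) sol_linear[OF \<nu>(1) that]]) (simp_all add: \<nu>(2))
  show "hol (I0 x) = I0 (hol x)" "hol (J0 x) = J0 (hol x)" "hol (K0 x) = K0 (hol x)" for x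
    by (rule lin[OF linear_IJK(1) \<Theta>_I], assumption+)
       (rule lin[OF linear_IJK(2) \<Theta>_J], assumption+, rule lin[OF linear_IJK(3) \<Theta>_K], assumption+)
  show linear_hol: "linear hol"
  proof (rule linearI)
    show "hol (x + y) = hol x + hol y" for x y
      unfolding hol by (rule sol_unique[OF \<nu>(1) sol_add[OF \<nu>(1) \<nu>(1)]]) (simp_all add: \<nu>(2))
    show "hol (r *\<^sub>R x) = r *\<^sub>R hol x" for r x
      by (rule lin[OF linear_scaleR]) (rule linear_cmul[OF linear_\<Theta>])
  qed
  have "x = 0" if "hol x = 0" for x using sol_zero[OF \<nu>(1), of 1 x] that by (simp add: hol \<nu>(2))
  then show "inj hol" using linear_injective_0[OF linear_hol] by blast
  show "\<Omega> (map hol xs) = \<Omega> xs" if \<Omega>: "calt I0 (2 * n) \<Omega>" and xs: "length xs = 2 * n" for \<Omega> xs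
  proof -
    have "DIM('e) = 2 * (2 * n)" using dimension by simp
    from calt_sol_invariant[OF \<Omega> this \<nu>(1), of "\<lambda>i. xs ! i"]
    have "\<Omega> (map (\<lambda>i. hol (xs ! i)) [0..<2 * n]) = \<Omega> (map (\<lambda>i. xs ! i) [0..<2 * n])"
      by (simp add: hol \<nu>(2))
    moreover have "map (\<lambda>i. xs ! i) [0..<2 * n] = xs" using map_nth[of xs] xs by simp
    moreover have "map (\<lambda>i. hol (xs ! i)) [0..<2 * n] = map hol (map (\<lambda>i. xs ! i) [0..<2 * n])" by simp
    ultimately show ?thesis by metis
  qed
qed

lemma hol_cscale: "hol (cscale I0 a x) = cscale I0 a (hol x)"
  by (simp add: cscale_def linear_add[OF linear_hol] linear_cmul[OF linear_hol] hol_I)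

lemma holonomy_GLH: "h \<in> GLH (tangent_space N p) (I p) (J p) (K p)"
proof -
  let ?T = "tangent_space N p"
  have T: "v = frame (coords p v) p" if "v \<in> ?T" for v using frame_coords[OF p that] by simp
  have hT: "h v = frame (hol (coords p v)) p" if "v \<in> ?T" for v using T[OF that] h_frame by metis
  have frameT: "frame x p \<in> ?T" for x by (rule frame_tangent[OF p])
  note lc = linear_coords[OF p] and lf = frame_linear[OF p]
  note sub = subspace_tangent_space[of p]
  have "linear_map_on ?T ?T h"
    unfolding linear_map_on_def
  proof (intro conjI ballI allI)
    show "h \<in> ?T \<rightarrow> ?T" using hT frameT by simp
    fix u assume u: "u \<in> ?T"
    show "h (r *\<^sub>R u) = r *\<^sub>R h u" for r
      unfolding hT[OF u] hT[OF subspace_scale[OF sub u]] linear_cmul[OF lc] linear_cmul[OF linear_hol] linear_cmul[OF lf] ..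
    fix v assume v: "v \<in> ?T"
    show "h (u + v) = h u + h v"
      unfolding hT[OF u] hT[OF v] hT[OF subspace_add[OF sub u v]] linear_add[OF lc] linear_add[OF linear_hol] linear_add[OF lf] ..
  qed
  moreover have "bij_betw h ?T ?T"
    unfolding bij_betw_def
  proof
    show "inj_on h ?T"
    proof (rule inj_onI)
      fix u v assume uv: "u \<in> ?T" "v \<in> ?T" "h u = h v"
      then have "hol (coords p u) = hol (coords p v)" using hT coords_frame[OF p] by metis
      then have "coords p u = coords p v" using inj_hol by (simp add: inj_eq)
      then show "u = v" using T uv(1,2) by metis
    qed
    have "surj hol" using linear_hol inj_hol by (simp add: linear_injective_imp_surjective)
    show "h ` ?T = ?T"
    proof
      show "h ` ?T \<subseteq> ?T" using hT frameT by auto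
      show "?T \<subseteq> h ` ?T"
      proof
        fix v assume v: "v \<in> ?T"
        obtain x where "coords p v = hol x" using \<open>surj hol\<close> by blast
        then have "h (frame x p) = v" using h_frame T[OF v] by metis
        then show "v \<in> h ` ?T" using frameT by blast
      qed
    qed
  qed
  moreover have "h (I p v) = I p (h v) \<and> h (J p v) = J p (h v) \<and> h (K p v) = K p (h v)" if "v \<in> ?T" for v
  proof -
    have "h (I p (frame x p)) = I p (h (frame x p)) \<and> h (J p (frame x p)) = J p (h (frame x p)) \<and>
        h (K p (frame x p)) = K p (h (frame x p))" for x
      by (simp only: I_frame[OF p] J_frame[OF p] K_frame[OF p] h_frame hol_I hol_J hol_K simp_thms)
    from this[of "coords p v"] show ?thesis using frame_coords[OF p that] by simp
  qed
  moreover have "h \<in> extensional ?T" using h by (simp add: holonomy_group_def)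
  ultimately show ?thesis by (simp add: GLH_def)
qed

section \<open>The (1,0)-vectors and their top exterior power\<close>

abbreviation W10 where "W10 \<equiv> space10 (tangent_space N p) (I p)"

text \<open>The pair stands for \<open>x - i I0 x\<close>, the usual identification of a complex
  vector space with its (1,0)-part: multiplication by \<open>i\<close> corresponds to
  \<open>I0\<close>, and the real part recovers \<open>x\<close>.\<close>

definition vec10 :: "'e \<Rightarrow> ('p, 'e) tvec \<times> ('p, 'e) tvec" where
  "vec10 x = (frame x p, frame (- I0 x) p)"

lemma W10_range: "W10 = range vec10"
proof
  note lf = frame_linear[OF p]
  show "range vec10 \<subseteq> W10"
  proof
    fix z assume "z \<in> range vec10"
    then obtain x where z: "z = vec10 x" by blast
    have "I p (frame (- I0 x) p) = frame x p"
      unfolding I_frame[OF p] linear_neg[OF linear_I] I0_I0 by simp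
    moreover have "I p (frame x p) = - frame (- I0 x) p"
      unfolding I_frame[OF p] linear_neg[OF lf] by simp
    ultimately show "z \<in> W10"
      by (simp add: z space10_def vec10_def scaleC_def frame_tangent[OF p])
  qed
  show "W10 \<subseteq> range vec10"
  proof
    fix z assume z: "z \<in> W10"
    obtain a b where ab: "z = (a, b)" by (cases z)
    have a: "a \<in> tangent_space N p" "I p a = - b" using z by (auto simp: space10_def ab scaleC_def)
    then have "b = - I p (frame (coords p a) p)" using frame_coords[OF p] by simp
    also have "\<dots> = frame (- I0 (coords p a)) p" unfolding I_frame[OF p] linear_neg[OF lf] ..
    finally have "z = vec10 (coords p a)" using frame_coords[OF p a(1)] by (simp add: ab vec10_def)
    then show "z \<in> range vec10" by blast
  qed
qed

lemma vec10_complex_linear: "vec10 (cscale I0 a x + cscale I0 b y) = scaleC a (vec10 x) + scaleC b (vec10 y)"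
proof -
  note lf = frame_linear[OF p]
  have 1: "vec10 (cscale I0 a x) = scaleC a (vec10 x)" for a x
    by (simp add: vec10_def scaleC_def cscale_def linear_add[OF lf] linear_cmul[OF lf] linear_neg[OF lf]
        linear_add[OF linear_I] linear_cmul[OF linear_I] I0_I0 linear_diff[OF lf])
  have "vec10 (x + y) = vec10 x + vec10 y" for x y
    unfolding vec10_def linear_add[OF linear_I] minus_add_distrib linear_add[OF lf] by simp
  then show ?thesis by (simp add: 1)
qed

definition coords10 :: "('p, 'e) tvec \<times> ('p, 'e) tvec \<Rightarrow> 'e" where
  "coords10 z = coords p (fst z)"

lemma coords10_vec10: "coords10 (vec10 x) = x"
  by (simp add: coords10_def vec10_def coords_frame[OF p])

lemma vec10_coords10: "z \<in> W10 \<Longrightarrow> vec10 (coords10 z) = z"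
  using W10_range coords10_vec10 by auto

lemma tuples_vec10:
  assumes "ws \<in> tuples j W10"
  shows "ws = map vec10 (map coords10 ws)"
  using assms vec10_coords10 by (auto simp: tuples_def subset_iff intro!: map_idI[symmetric])

lemma map_vec10_tuples: "length xs = j \<Longrightarrow> map vec10 xs \<in> tuples j W10"
  by (auto simp: tuples_def W10_range)

text \<open>Transport along \<open>vec10\<close>, which makes the invariance of forms under
  \<open>hol\<close> available on the (1,0)-vectors.\<close>

lemma alt_forms_calt:
  assumes "\<omega> \<in> alt_forms j W10"
  shows "calt I0 j (\<lambda>xs. \<omega> (map vec10 xs))"
  unfolding calt_def
proof (intro conjI allI impI; elim conjE)
  fix xs :: "'e list" and i u v a b assume xs: "length xs = j" "i < j"
  have "vec10 u \<in> W10" "vec10 v \<in> W10" by (auto simp: W10_range)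
  then have "\<omega> ((map vec10 xs)[i := scaleC a (vec10 u) + scaleC b (vec10 v)])
      = a * \<omega> ((map vec10 xs)[i := vec10 u]) + b * \<omega> ((map vec10 xs)[i := vec10 v])"
    using assms map_vec10_tuples[OF xs(1)] xs(2) unfolding alt_forms_def by blast
  then show "\<omega> (map vec10 (xs[i := cscale I0 a u + cscale I0 b v]))
      = a * \<omega> (map vec10 (xs[i := u])) + b * \<omega> (map vec10 (xs[i := v]))"
    by (simp only: map_update vec10_complex_linear)
next
  fix xs :: "'e list" and i i' assume xs: "length xs = j" "i < j" "i' < j" "i \<noteq> i'" "xs ! i = xs ! i'"
  then have "map vec10 xs ! i = map vec10 xs ! i'" by simp
  then show "\<omega> (map vec10 xs) = 0"
    using assms map_vec10_tuples[OF xs(1)] xs(2-4) unfolding alt_forms_def by blast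
qed

lemma calt_alt_forms:
  assumes "calt I0 j \<Omega>"
  shows "(\<lambda>ws. \<Omega> (map coords10 ws)) \<in> alt_forms j W10"
  unfolding alt_forms_def mem_Collect_eq
proof (intro conjI ballI allI impI; (elim conjE)?)
  fix ws i u v a b assume ws: "ws \<in> tuples j W10" "i < j" and uv: "u \<in> W10" "v \<in> W10"
  obtain x y where xy: "u = vec10 x" "v = vec10 y" using uv by (auto simp: W10_range)
  have "length (map coords10 ws) = j" using ws by (simp add: tuples_def)
  then have "\<Omega> ((map coords10 ws)[i := cscale I0 a x + cscale I0 b y])
      = a * \<Omega> ((map coords10 ws)[i := x]) + b * \<Omega> ((map coords10 ws)[i := y])"
    using assms ws(2) unfolding calt_def by blast
  then show "\<Omega> (map coords10 (ws[i := scaleC a u + scaleC b v]))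
      = a * \<Omega> (map coords10 (ws[i := u])) + b * \<Omega> (map coords10 (ws[i := v]))"
    by (simp only: xy map_update vec10_complex_linear[symmetric] coords10_vec10)
next
  fix ws i i' assume ws: "ws \<in> tuples j W10" "i < j" "i' < j" "i \<noteq> i'" "ws ! i = ws ! i'"
  then have "length (map coords10 ws) = j" "map coords10 ws ! i = map coords10 ws ! i'"
    by (simp_all add: tuples_def)
  then show "\<Omega> (map coords10 ws) = 0" using assms ws(2-4) unfolding calt_def by blast
qed

lemma h_vec10: "map_prod h h (vec10 x) = vec10 (hol x)"
  by (simp add: vec10_def h_frame linear_neg[OF linear_hol] hol_I)

text \<open>\<open>exterior_map\<close> evaluates a wedge product at the pulled back form, and
  \<open>wedge\<close> returns the default 0 unless that form belongs to
  \<open>alt_forms\<close>.\<close>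

lemma alt_forms_pullback:
  assumes "\<omega> \<in> alt_forms j W10"
  shows "(\<lambda>ws. \<omega> (map (map_prod h h) ws)) \<in> alt_forms j W10"
  unfolding alt_forms_def mem_Collect_eq
proof (intro conjI ballI allI impI; (elim conjE)?)
  let ?h = "map_prod h h"
  have "?h z \<in> W10" if "z \<in> W10" for z using that by (auto simp: W10_range h_vec10)
  then have tup: "map ?h ws \<in> tuples j W10" if "ws \<in> tuples j W10" for ws
    using that by (auto simp: tuples_def)
  fix ws i assume ws: "ws \<in> tuples j W10" "i < j"
  {
    fix u v a b assume uv: "u \<in> W10" "v \<in> W10"
    obtain x y where xy: "u = vec10 x" "v = vec10 y" using uv by (auto simp: W10_range)
    have "?h (scaleC a u + scaleC b v) = scaleC a (?h u) + scaleC b (?h v)"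
      unfolding xy vec10_complex_linear[symmetric] h_vec10 linear_add[OF linear_hol] hol_cscale ..
    moreover have "?h u \<in> W10" "?h v \<in> W10" by (auto simp: xy h_vec10 W10_range)
    then have "\<omega> ((map ?h ws)[i := scaleC a (?h u) + scaleC b (?h v)])
        = a * \<omega> ((map ?h ws)[i := ?h u]) + b * \<omega> ((map ?h ws)[i := ?h v])"
      using assms tup[OF ws(1)] ws(2) unfolding alt_forms_def by blast
    ultimately show "\<omega> (map ?h (ws[i := scaleC a u + scaleC b v]))
        = a * \<omega> (map ?h (ws[i := u])) + b * \<omega> (map ?h (ws[i := v]))"
      by (simp only: map_update)
  next
    fix i' assume i': "i' < j" "i \<noteq> i'" "ws ! i = ws ! i'"
    then have "map ?h ws ! i = map ?h ws ! i'" using ws by (simp add: tuples_def)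
    then show "\<omega> (map ?h ws) = 0" using assms tup[OF ws(1)] ws(2) i'(1,2) unfolding alt_forms_def by blast
  }
qed

lemma alt_forms_invariant:
  assumes \<omega>: "\<omega> \<in> alt_forms (2 * n) W10" and ws: "ws \<in> tuples (2 * n) W10"
  shows "\<omega> (map (map_prod h h) ws) = \<omega> ws"
proof -
  let ?xs = "map coords10 ws"
  have "length ?xs = 2 * n" using ws by (simp add: tuples_def)
  from hol_calt[OF alt_forms_calt[OF \<omega>] this]
  have "\<omega> (map vec10 (map hol ?xs)) = \<omega> (map vec10 ?xs)" .
  moreover have "map (map_prod h h) (map vec10 ?xs) = map vec10 (map hol ?xs)" by (simp add: h_vec10)
  ultimately show ?thesis using tuples_vec10[OF ws] by metis
qed

lemma exterior_map_identity:
  assumes "T \<in> exterior_power (2 * n) W10"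
  shows "exterior_map (2 * n) W10 (map_prod h h) T = T"
proof -
  obtain m z ws where T: "T = (\<lambda>\<omega>. \<Sum>j<(m::nat). z j * wedge (2 * n) W10 (ws j) \<omega>)"
    and ws: "\<And>j. j < m \<Longrightarrow> ws j \<in> tuples (2 * n) W10"
    using assms unfolding exterior_power_def by blast
  show ?thesis
  proof
    fix \<omega>
    show "exterior_map (2 * n) W10 (map_prod h h) T \<omega> = T \<omega>"
    proof (cases "\<omega> \<in> alt_forms (2 * n) W10")
      case True
      then show ?thesis
        unfolding exterior_map_def T wedge_def
        by (simp add: alt_forms_pullback alt_forms_invariant[OF True ws])
    next
      \<comment> \<open>Outside \<open>alt_forms\<close> both sides take the default value
        0.\<close>
      case False
      then show ?thesis unfolding exterior_map_def T wedge_def by simp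
    qed
  qed
qed

text \<open>Since \<open>h\<close> acts trivially on the exterior power, 1 is an admissible scalar.
  It is the only one because the power has a nonzero element: the wedge of a complex basis, on which
  the determinant form is 1.\<close>

lemma quat_det_one: "quat_det n (tangent_space N p) (I p) h = 1"
  unfolding quat_det_def
proof (rule the_equality)
  show "\<forall>T\<in>exterior_power (2 * n) W10. exterior_map (2 * n) W10 (map_prod h h) T = (\<lambda>\<omega>. 1 * T \<omega>)"
    using exterior_map_identity by simp
  fix z assume z: "\<forall>T\<in>exterior_power (2 * n) W10. exterior_map (2 * n) W10 (map_prod h h) T = (\<lambda>\<omega>. z * T \<omega>)"
  have dim: "DIM('e) = 2 * (2 * n)" using dimension by simp
  obtain x where x: "cindep I0 (2 * n) x" using cindep_exists[OF dim] by blast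
  obtain \<Omega> where \<Omega>: "calt I0 (2 * n) \<Omega>" "\<Omega> (map x [0..<2 * n]) = 1" using calt_exists[OF x dim] .
  define \<omega> where "\<omega> ws = \<Omega> (map coords10 ws)" for ws
  define ws where "ws = map vec10 (map x [0..<2 * n])"
  define T where "T = wedge (2 * n) W10 ws"
  have \<omega>: "\<omega> \<in> alt_forms (2 * n) W10" using calt_alt_forms[OF \<Omega>(1)] unfolding \<omega>_def .
  have "ws \<in> tuples (2 * n) W10" unfolding ws_def by (rule map_vec10_tuples) simp
  then have "T \<in> exterior_power (2 * n) W10"
    unfolding exterior_power_def T_def
    by (intro CollectI exI[of _ "1::nat"] exI[of _ "\<lambda>_. 1"] exI[of _ "\<lambda>_. ws"]) simp
  then have "T = (\<lambda>\<omega>. z * T \<omega>)" using z exterior_map_identity by metis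
  moreover have "T \<omega> = 1"
    using \<omega> \<Omega>(2) by (simp add: T_def wedge_def \<omega>_def ws_def comp_def coords10_vec10)
  ultimately show "z = 1" by (metis mult.right_neutral)
qed

lemma holonomy_SLH: "h \<in> SLH n (tangent_space N p) (I p) (J p) (K p)"
  using holonomy_GLH quat_det_one by (simp add: SLH_def)

end

end

theorem corollary3p3:
  fixes G :: "('g, 'b) monoid_scheme"
    and A :: "('g, 'e::euclidean_space) chart set"
    and \<Gamma> :: "'g set"
    and N :: "('g set, 'e) chart set"
    and I J K :: "('g set, 'e) endofield"
    and nabla :: "('g set, 'e) connection"
    and n :: nat
    and p :: "'g set"
  assumes "hypercomplex_nilmanifold G A \<Gamma> I J K"
    and "N = quotient_atlas G A \<Gamma>"
    and "DIM('e) = 4 * n"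
    and "obata_connection N I J K nabla"
    and "p \<in> points N"
  shows "holonomy_group N nabla p \<subseteq> SLH n (tangent_space N p) (I p) (J p) (K p)"
proof
  fix h assume h: "h \<in> holonomy_group N nabla p"
  have nil: "lie_group G A" "nilpotent_group G" "subgroup \<Gamma> G"
    using assms(1) by (auto simp: hypercomplex_nilmanifold_def nilmanifold_def)
  obtain I' J' K' where hyp: "hypercomplex_structure A I' J' K'"
    and inv: "left_invariant G A I'" "left_invariant G A J'" "left_invariant G A K'"
    and hol: "holomorphic_map A I' N I (\<lambda>g. \<Gamma> #>\<^bsub>G\<^esub> g)" "holomorphic_map A J' N J (\<lambda>g. \<Gamma> #>\<^bsub>G\<^esub> g)"
      "holomorphic_map A K' N K (\<lambda>g. \<Gamma> #>\<^bsub>G\<^esub> g)"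
    using assms(1,2) unfolding hypercomplex_nilmanifold_def by blast
  have smooth: "smooth_endofield A I'" "smooth_endofield A J'" "smooth_endofield A K'"
    using hyp by (simp_all add: hypercomplex_structure_def complex_structure_def almost_complex_structure_def)
  interpret lie_quotient G A \<Gamma>
    by (intro lie_quotient.intro lie_group_charts.intro lie_quotient_axioms.intro nil)
  note N = assms(2)
  obtain k where k: "flag k = UNIV" using flag_UNIV[OF nil(2)] .
  define I0 where "I0 = invariant_part I'"
  define J0 where "J0 = invariant_part J'"
  define K0 where "K0 = invariant_part K'"
  have cv: "coord_vector A c0 \<one>\<^bsub>G\<^esub> w \<in> tangent_space A \<one>\<^bsub>G\<^esub>" for w by (rule coord_vector_one)
  have comp: "invariant_part P (invariant_part Q w) = P \<one>\<^bsub>G\<^esub> (Q \<one>\<^bsub>G\<^esub> (coord_vector A c0 \<one>\<^bsub>G\<^esub> w)) c0"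
    if "smooth_endofield A Q" for P Q w
    unfolding invariant_part_def[of P] coord_vector_invariant_part[OF that] ..
  have II: "I0 (I0 x) = - x" for x
    using hyp one_point cv[of x] coord_vector_one(2)[of x]
    by (simp add: I0_def comp[OF smooth(1)] hypercomplex_structure_def complex_structure_def almost_complex_structure_def)
  have JJ: "J0 (J0 x) = - x" for x
    using hyp one_point cv[of x] coord_vector_one(2)[of x]
    by (simp add: J0_def comp[OF smooth(2)] hypercomplex_structure_def complex_structure_def almost_complex_structure_def)
  \<comment> \<open>Both sides are \<open>K'\<close> at the identity applied to the coordinate
    vector of \<open>x\<close>, read in \<open>c0\<close>.\<close>
  have IJ: "I0 (J0 x) = - J0 (I0 x)" for x
    using hyp one_point cv[of x]
    by (simp add: I0_def J0_def comp[OF smooth(1)] comp[OF smooth(2)] hypercomplex_structure_def)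
  have conn: "framed_connection N frame nabla"
    unfolding N
    by (intro framed_connection.intro framed_connection_axioms.intro framed_manifold_axioms)
       (use assms(4) in \<open>simp add: obata_connection_def N\<close>)
  then interpret conn: framed_connection N frame nabla .
  have coords_bracket: "coords q (lie_bracket N (frame v) (frame w) q) \<in> flag j"
    if q: "q \<in> points N" and w: "w \<in> flag (Suc j)" for q v w j
  proof -
    let ?d = "chart_at N q"
    have d: "?d \<in> N" "q \<in> fst ?d" using conn.chart_at[OF q] by auto
    \<comment> \<open>\<open>frame_bracket\<close> describes the bracket in a single chart; for
      \<open>chart_at N q\<close> this is the very component that \<open>coords\<close>
      reads.\<close>
    obtain u where u: "u \<in> flag j" "lie_bracket N (frame v) (frame w) q ?d = frame u q ?d"
      using frame_bracket[of ?d q w j v] d w unfolding N by blast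
    have "coords q (lie_bracket N (frame v) (frame w) q) = coords q (frame u q)"
      using u(2) unfolding coords_def Let_def N by simp
    then show ?thesis using u(1) coords_frame q unfolding N by simp
  qed
  have "quaternionic_frame N frame nabla I J K I0 J0 K0 flag k n"
  proof (intro quaternionic_frame.intro quaternionic_frame_axioms.intro conn assms(3,4) II JJ IJ)
    show "I q (frame w q) = frame (I0 w) q" "J q (frame w q) = frame (J0 w) q" "K q (frame w q) = frame (K0 w) q"
      if "q \<in> points N" for q w
      using holomorphic_frame[OF inv(1) hol(1)[unfolded N] smooth(1)] holomorphic_frame[OF inv(2) hol(2)[unfolded N] smooth(2)]
        holomorphic_frame[OF inv(3) hol(3)[unfolded N] smooth(3)] that
      unfolding N I0_def J0_def K0_def by blast+
    show "linear I0" "linear J0" "linear K0"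
      unfolding I0_def J0_def K0_def using linear_invariant_part smooth by blast+
  qed (use subspace_flag flag_mono k coords_bracket N in auto)
  then show "h \<in> SLH n (tangent_space N p) (I p) (J p) (K p)"
    by (rule quaternionic_frame.holonomy_SLH[OF _ assms(5) h])
qed

end
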